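(* Let $-\frac34<s<0$ and $\max\{\frac38,\frac18-\frac s2\}<b<\frac12$. Then there exists $\sigma_0>\frac12$ such that for any $\sigma$ with $\frac12<\sigma<\sigma_0$ there is a constant $C$ such that, for all $u,v\in X^{s,b}$, $$\|uv\|_{X^{s,\sigma-1}}\le C\,\|u\|_{X^{s,b}}\|v\|_{X^{s,b}}$$ and $$\|uv\|_{Z^{s,\sigma-1}}\le C\,\|u\|_{X^{s,b}}\|v\|_{X^{s,b}}.$$
   Context: $\langle\cdot\rangle=(1+|\cdot|^2)^{1/2}$ and $\widehat w(\xi,\tau)$ is the space-time Fourier transform of $w=w(x,t)$. For $s,b\in\mathbb R$, $X^{s,b}$ and $Z^{s,b}$ are the completions of the Schwartz class $\mathcal S(\mathbb R^2)$ in the norms $$\|w\|_{X^{s,b}}=\big\|\langle\xi\rangle^s\langle\tau+\xi^2\rangle^b\widehat w(\xi,\tau)\big\|_{L^2_{\xi,\tau}(\mathbb R^2)},\qquad \|w\|_{Z^{s,b}}=\big\|\langle\tau\rangle^{s/2}\langle\tau+\xi^2\rangle^b\widehat w(\xi,\tau)\big\|_{L^2_{\xi,\tau}(\mathbb R^2)}.$$ The product $uv$ (no complex conjugates) is understood for Schwartz functions and extended by density. The constant $C$ may depend on $s,b,\sigma$ but not on $u,v$. *)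

theory Defs
  imports "HOL-Analysis.Analysis"
begin

text \<open>Functions of space and time are functions on \<^typ>\<open>real \<times> real\<close>, with arguments
  \<open>(x, t)\<close>; their Fourier transforms have arguments \<open>(\<xi>, \<tau>)\<close>.\<close>

section \<open>Schwartz functions and the Fourier transform\<close>

text \<open>The iterated partial derivative along the directions in the list; the head of the list is
  the derivative taken last.\<close>

definition iter_deriv :: "'a::euclidean_space list \<Rightarrow> ('a \<Rightarrow> complex) \<Rightarrow> 'a \<Rightarrow> complex" where
  "iter_deriv es f = foldr (\<lambda>e g z. frechet_derivative g (at z) e) es f"

text \<open>Requiring every iterated partial derivative to be differentiable makes \<open>f\<close> smooth, and
  the Frechet derivatives occurring in \<^const>\<open>iter_deriv\<close> are then genuine.\<close>

definition schwartz :: "('a::euclidean_space \<Rightarrow> complex) set" where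
  "schwartz = {f. \<forall>es \<in> lists Basis.
      iter_deriv es f differentiable_on UNIV \<and>
      (\<forall>n::nat. bounded (range (\<lambda>z. (1 + norm z) ^ n *\<^sub>R iter_deriv es f z)))}"

definition fourier :: "('a::euclidean_space \<Rightarrow> complex) \<Rightarrow> 'a \<Rightarrow> complex" where
  "fourier w \<zeta> = (LINT z|lborel. exp (- \<i> * of_real (\<zeta> \<bullet> z)) * w z)"

section \<open>The norms\<close>

definition jbracket :: "real \<Rightarrow> real" where
  "jbracket y = (1 + \<bar>y\<bar>\<^sup>2) powr (1/2)"

text \<open>Both norms are only ever applied to Schwartz functions, for which the integrals are finite.\<close>

definition X_norm :: "real \<Rightarrow> real \<Rightarrow> (real \<times> real \<Rightarrow> complex) \<Rightarrow> real" where
  "X_norm s b w = sqrt (integral\<^sup>L lborel (\<lambda>(\<xi>, \<tau>).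
     (jbracket \<xi> powr s * jbracket (\<tau> + \<xi>\<^sup>2) powr b * norm (fourier w (\<xi>, \<tau>)))\<^sup>2))"

definition Z_norm :: "real \<Rightarrow> real \<Rightarrow> (real \<times> real \<Rightarrow> complex) \<Rightarrow> real" where
  "Z_norm s b w = sqrt (integral\<^sup>L lborel (\<lambda>(\<xi>, \<tau>).
     (jbracket \<tau> powr (s/2) * jbracket (\<tau> + \<xi>\<^sup>2) powr b * norm (fourier w (\<xi>, \<tau>)))\<^sup>2))"

section \<open>Completion of the Schwartz class\<close>

text \<open>The completion in a norm \<open>N\<close> consists of the equivalence classes of \<open>N\<close>-Cauchy sequences
  of Schwartz functions, two sequences being equivalent if their difference tends to \<open>0\<close> in \<open>N\<close>.\<close>

type_synonym 'a fun_seq = "nat \<Rightarrow> 'a \<Rightarrow> complex"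

definition cauchy_seqs :: "(('a::euclidean_space \<Rightarrow> complex) \<Rightarrow> real) \<Rightarrow> 'a fun_seq set" where
  "cauchy_seqs N = {f. (\<forall>n. f n \<in> schwartz) \<and>
     (\<forall>\<epsilon>>0. \<exists>M. \<forall>m\<ge>M. \<forall>n\<ge>M. N (\<lambda>z. f m z - f n z) < \<epsilon>)}"

text \<open>The relation is defined on all sequences of Schwartz functions, so that the class of a
  sequence that is not Cauchy is nonempty and does not belong to the completion.\<close>

definition null_rel ::
    "(('a::euclidean_space \<Rightarrow> complex) \<Rightarrow> real) \<Rightarrow> ('a fun_seq \<times> 'a fun_seq) set" where
  "null_rel N = {(f, g). (\<forall>n. f n \<in> schwartz) \<and> (\<forall>n. g n \<in> schwartz) \<and>
     (\<lambda>n. N (\<lambda>z. f n z - g n z)) \<longlonglongrightarrow> 0}"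

definition completion ::
    "(('a::euclidean_space \<Rightarrow> complex) \<Rightarrow> real) \<Rightarrow> 'a fun_seq set set" where
  "completion N = cauchy_seqs N // null_rel N"

definition completion_norm ::
    "(('a::euclidean_space \<Rightarrow> complex) \<Rightarrow> real) \<Rightarrow> 'a fun_seq set \<Rightarrow> real" where
  "completion_norm N u = (THE r. \<forall>f\<in>u. (\<lambda>n. N (f n)) \<longlonglongrightarrow> r)"

text \<open>The extension by density of the pointwise product, with values in the completion in \<open>N\<close>:
  if \<open>u\<close> and \<open>v\<close> are classes of the sequences \<open>f\<close> and \<open>g\<close>, the product is the class of the
  sequence \<open>f n * g n\<close>. This union over all representatives belongs to \<^term>\<open>completion N\<close> only if
  the product sequences are all \<open>N\<close>-Cauchy and equivalent to each other, that is, only if the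
  extension exists at \<open>(u, v)\<close>.\<close>

definition completion_mult ::
    "(('a::euclidean_space \<Rightarrow> complex) \<Rightarrow> real) \<Rightarrow>
      'a fun_seq set \<Rightarrow> 'a fun_seq set \<Rightarrow> 'a fun_seq set" where
  "completion_mult N u v = (\<Union>f\<in>u. \<Union>g\<in>v. null_rel N `` {\<lambda>n z. f n z * g n z})"

definition X_space :: "real \<Rightarrow> real \<Rightarrow> (real \<times> real) fun_seq set set" where
  "X_space s b = completion (X_norm s b)"

definition Z_space :: "real \<Rightarrow> real \<Rightarrow> (real \<times> real) fun_seq set set" where
  "Z_space s b = completion (Z_norm s b)"

end

theory Submission
  imports Defs "HOL-Probability.Probability"
begin

text \<open>
  Write \<open>\<lambda> = \<tau> + \<xi>\<^sup>2\<close> for the modulation of the product and \<open>\<lambda>\<^sub>1\<close>, \<open>\<lambda>\<^sub>2\<close> for those of the factors.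
  Since \<open>\<lambda> = \<lambda>\<^sub>1 + \<lambda>\<^sub>2 + 2 \<xi>\<^sub>1 \<xi>\<^sub>2\<close>, the largest modulation is at least \<open>2/3 \<bar>\<xi>\<^sub>1 \<xi>\<^sub>2\<bar>\<close>, which pays for the
  negative regularity. Where the modulation of one of the three functions is the largest, the
  Cauchy-Schwarz inequality in the variable of that function reduces the estimate to a uniform bound
  on the integral of the squared kernel. All conditions on the exponents are strict, so powers of
  the largest modulation can be traded to improve the decay \<open>\<langle>\<cdot>\<rangle>\<^sup>-\<^sup>2\<^sup>b\<close> in each of the two smaller
  modulations to an integrable one, and these two modulations then serve as integration variables.
  The frequencies at which this change of variables degenerates are treated directly. Products
  become convolutions by Fourier inversion, and the bound for Schwartz functions extends to the
  completions because a bounded bilinear map sends pairs of Cauchy sequences to Cauchy sequences.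
\<close>

section \<open>Schwartz functions\<close>

text \<open>The thresholds on \<open>b\<close> come from counting powers of the largest modulation.
  Let \<open>\<rho> = - s\<close>. Once the other two modulations are integrable, the squared kernel
  keeps the power \<open>\<kappa>\<close> of the largest one, which tends to 4b - 1 as sigma tends
  to 1/2 and theta to 0. The squared frequency weights are |xi_1 xi_2|^(2 rho). The Jacobian of the
  passage to modulation variables is linear in the frequencies and pays for |xi_1 xi_2|^(1/2), so 2
  rho <= 1/2 + kappa is required; this is b > 1/8 - s/2. Where the output weight cancels the larger
  frequency, the square of the smaller one is at most |xi_1 xi_2| and kappa >= rho is required; this
  is the average of the former condition and of kappa >= 1/2, which is b > 3/8. The Z norm is the
  obstacle to a single kernel: <tau>^(s/2) gains nothing when |tau| is small against xi^2. But then
  the output modulation tau + xi^2 is comparable with xi^2, and its negative power replaces the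
  missing weight.\<close>

lemma iter_deriv_Nil [simp]: "iter_deriv [] f = f"
  by (simp add: iter_deriv_def)

lemma iter_deriv_Cons:
  "iter_deriv (e # es) f = (\<lambda>z. frechet_derivative (iter_deriv es f) (at z) e)"
  by (simp add: iter_deriv_def)

lemma iter_deriv_snoc:
  "iter_deriv (es @ [e]) f = iter_deriv es (\<lambda>z. frechet_derivative f (at z) e)"
  by (simp add: iter_deriv_def)

text \<open>A coinduction principle: closure under a single derivative is enough, so each closure
  property below only has to exhibit a suitable invariant set \<open>P\<close>.\<close>

lemma schwartz_coinduct:
  assumes "f \<in> P"
    and diff: "\<And>g. g \<in> P \<Longrightarrow> g differentiable_on UNIV"
    and decay: "\<And>g n. g \<in> P \<Longrightarrow> bounded (range (\<lambda>z. (1 + norm z) ^ n *\<^sub>R g z))"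
    and closed: "\<And>g e. g \<in> P \<Longrightarrow> e \<in> Basis \<Longrightarrow> (\<lambda>z. frechet_derivative g (at z) e) \<in> P"
  shows "f \<in> schwartz"
proof -
  have "iter_deriv es f \<in> P" if "es \<in> lists Basis" for es
    using that
  proof (induction es)
    case Nil
    then show ?case using \<open>f \<in> P\<close> by simp
  next
    case (Cons e es)
    then have "iter_deriv es f \<in> P" "e \<in> Basis" by auto
    then show ?case using closed[of "iter_deriv es f" e] by (simp add: iter_deriv_Cons)
  qed
  then show ?thesis using diff decay unfolding schwartz_def by blast
qed

lemma schwartz_differentiable: "f \<in> schwartz \<Longrightarrow> f differentiable (at z)"
  unfolding schwartz_def by (auto dest!: bspec[of _ _ "[]"] simp: differentiable_on_def)

lemma schwartz_has_derivative:
  "f \<in> schwartz \<Longrightarrow> (f has_derivative frechet_derivative f (at z)) (at z)"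
  using schwartz_differentiable frechet_derivative_works by blast

lemma schwartz_decay:
  assumes "f \<in> schwartz"
  obtains C where "\<And>z. (1 + norm z) ^ n * norm (f z) \<le> C" "0 \<le> C"
proof -
  have "bounded (range (\<lambda>z. (1 + norm z) ^ n *\<^sub>R f z))"
    using assms unfolding schwartz_def by (auto dest!: bspec[of _ _ "[]"])
  then obtain C where C: "\<And>z. norm ((1 + norm z) ^ n *\<^sub>R f z) \<le> C"
    unfolding bounded_iff by auto
  have "(1 + norm z) ^ n * norm (f z) \<le> C" for z
    using C[of z] by simp
  moreover have "0 \<le> C" using C[of 0] norm_ge_zero order_trans by blast
  ultimately show ?thesis using that by blast
qed

lemma bounded_range_scaleR_weight:
  assumes "\<And>z. (1 + norm z) ^ n * norm (f z) \<le> C"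
  shows "bounded (range (\<lambda>z. (1 + norm z) ^ n *\<^sub>R f z))"
  using assms unfolding bounded_iff by (intro exI[of _ C]) auto

lemma schwartz_frechet_derivative:
  assumes "f \<in> schwartz" "e \<in> Basis"
  shows "(\<lambda>z. frechet_derivative f (at z) e) \<in> schwartz"
proof -
  have "iter_deriv es (\<lambda>z. frechet_derivative f (at z) e) = iter_deriv (es @ [e]) f" for es
    by (simp add: iter_deriv_snoc)
  moreover have "es @ [e] \<in> lists Basis" if "es \<in> lists Basis" for es
    using that assms(2) by auto
  ultimately show ?thesis using assms(1) unfolding schwartz_def by auto
qed

lemma schwartz_continuous_on: "f \<in> schwartz \<Longrightarrow> continuous_on UNIV f"
  by (simp add: continuous_at_imp_continuous_on differentiable_imp_continuous_within
      schwartz_differentiable)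

lemma frechet_derivative_eqI:
  "(g has_derivative g') (at z) \<Longrightarrow> frechet_derivative g (at z) e = g' e"
  using frechet_derivative_at by metis

lemma schwartz_add:
  assumes "f \<in> schwartz" "g \<in> schwartz"
  shows "(\<lambda>z. f z + g z) \<in> schwartz"
proof (rule schwartz_coinduct[where P = "{\<lambda>z. f z + g z | f g. f \<in> schwartz \<and> g \<in> schwartz}"])
  show "(\<lambda>z. f z + g z) \<in> {\<lambda>z. f z + g z | f g. f \<in> schwartz \<and> g \<in> schwartz}"
    using assms by blast
next
  fix h :: "'a \<Rightarrow> complex"
  assume "h \<in> {\<lambda>z. f z + g z | f g. f \<in> schwartz \<and> g \<in> schwartz}"
  then obtain f g where h: "h = (\<lambda>z. f z + g z)" and f: "f \<in> schwartz" and g: "g \<in> schwartz"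
    by blast
  show "h differentiable_on UNIV"
    unfolding h differentiable_on_def using f g
    by (simp add: schwartz_differentiable)
  show "bounded (range (\<lambda>z. (1 + norm z) ^ n *\<^sub>R h z))" for n
  proof -
    obtain A where A: "\<And>z. (1 + norm z) ^ n * norm (f z) \<le> A" using schwartz_decay[OF f] by blast
    obtain B where B: "\<And>z. (1 + norm z) ^ n * norm (g z) \<le> B" using schwartz_decay[OF g] by blast
    have "(1 + norm z) ^ n * norm (h z) \<le> A + B" for z
    proof -
      have "(1 + norm z) ^ n * norm (h z) \<le> (1 + norm z) ^ n * (norm (f z) + norm (g z))"
        unfolding h by (intro mult_left_mono norm_triangle_ineq) auto
      then show ?thesis using A[of z] B[of z] by (simp add: algebra_simps)
    qed
    then show ?thesis by (rule bounded_range_scaleR_weight)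
  qed
  fix e :: 'a assume e: "e \<in> Basis"
  have "frechet_derivative h (at z) e =
      frechet_derivative f (at z) e + frechet_derivative g (at z) e" for z
    unfolding h by (rule frechet_derivative_eqI)
      (intro has_derivative_add schwartz_has_derivative f g)
  then show "(\<lambda>z. frechet_derivative h (at z) e)
      \<in> {\<lambda>z. f z + g z | f g. f \<in> schwartz \<and> g \<in> schwartz}"
    using schwartz_frechet_derivative[OF f e] schwartz_frechet_derivative[OF g e] by auto
qed

lemma schwartz_mult:
  assumes "f \<in> schwartz" "g \<in> schwartz"
  shows "(\<lambda>z. f z * g z) \<in> schwartz"
proof -
  \<comment> \<open>The Leibniz rule turns one product into two, so single products are not
    invariant under derivatives; finite sums of them are.\<close>
  let ?P = "{\<lambda>z. \<Sum>i\<in>I. f i z * g i z | I f g.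
    finite (I :: nat set) \<and> (\<forall>i. f i \<in> schwartz \<and> g i \<in> schwartz)}"
  show ?thesis
  proof (rule schwartz_coinduct[where P = ?P])
    have "(\<lambda>z. f z * g z) = (\<lambda>z. \<Sum>i\<in>{0::nat}. f z * g z)" by auto
    then show "(\<lambda>z. f z * g z) \<in> ?P"
      using assms by (intro CollectI exI[of _ "{0}"] exI[of _ "\<lambda>_. f"] exI[of _ "\<lambda>_. g"]) auto
  next
    fix h :: "'a \<Rightarrow> complex"
    assume "h \<in> ?P"
    then obtain I and f g :: "nat \<Rightarrow> 'a \<Rightarrow> complex" where h: "h = (\<lambda>z. \<Sum>i\<in>I. f i z * g i z)"
        and I: "finite I" and f: "\<And>i. f i \<in> schwartz" and g: "\<And>i. g i \<in> schwartz"
      by blast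
    show "h differentiable_on UNIV"
      unfolding h differentiable_on_def using f g I
      by (simp add: schwartz_differentiable differentiable_sum)
    show "bounded (range (\<lambda>z. (1 + norm z) ^ n *\<^sub>R h z))" for n
    proof -
      have "\<exists>C. \<forall>z. (1 + norm z) ^ n * norm (f i z) \<le> C" for i
        using schwartz_decay[OF f[of i]] by blast
      then obtain A where A: "\<And>i z. (1 + norm z) ^ n * norm (f i z) \<le> A i" by metis
      have "\<exists>C. \<forall>z. (1 + norm z) ^ 0 * norm (g i z) \<le> C" for i
        using schwartz_decay[OF g[of i]] by blast
      then obtain B where B: "\<And>i z. (1 + norm z) ^ 0 * norm (g i z) \<le> B i" by metis
      have "(1 + norm z) ^ n * norm (h z) \<le> (\<Sum>i\<in>I. A i * B i)" for z
      proof -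
        have "(1 + norm z) ^ n * norm (h z) \<le> (1 + norm z) ^ n * (\<Sum>i\<in>I. norm (f i z * g i z))"
          unfolding h by (intro mult_left_mono norm_sum) auto
        also have "\<dots> = (\<Sum>i\<in>I. ((1 + norm z) ^ n * norm (f i z)) * norm (g i z))"
          by (simp add: sum_distrib_left norm_mult mult.assoc)
        also have "\<dots> \<le> (\<Sum>i\<in>I. A i * B i)"
        proof (rule sum_mono, rule mult_mono)
          fix i
          show "(1 + norm z) ^ n * norm (f i z) \<le> A i" by (rule A)
          then show "0 \<le> A i" by (rule order_trans[rotated]) simp
          show "norm (g i z) \<le> B i" using B[of z i] by simp
        qed simp
        finally show ?thesis .
      qed
      then show ?thesis by (rule bounded_range_scaleR_weight)
    qed
    fix e :: 'a assume e: "e \<in> Basis"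
    \<comment> \<open>The summand \<open>i\<close> splits into the indices \<open>2 * i\<close>,
      with the derivative on \<open>g i\<close>, and \<open>2 * i + 1\<close>, with the derivative
      on \<open>f i\<close>.\<close>
    define F where "F j = (if even j then f (j div 2)
      else (\<lambda>z. frechet_derivative (f (j div 2)) (at z) e))" for j
    define G where "G j = (if even j then (\<lambda>z. frechet_derivative (g (j div 2)) (at z) e)
      else g (j div 2))" for j
    define J where "J = (\<lambda>i. 2 * i) ` I \<union> (\<lambda>i. 2 * i + 1) ` I"
    have "frechet_derivative h (at z) e = (\<Sum>j\<in>J. F j z * G j z)" for z
    proof -
      have "frechet_derivative h (at z) e = (\<Sum>i\<in>I. f i z * frechet_derivative (g i) (at z) e +
          frechet_derivative (f i) (at z) e * g i z)"
        unfolding h by (rule frechet_derivative_eqI)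
          (intro has_derivative_sum has_derivative_mult schwartz_has_derivative f g)
      also have "\<dots> = (\<Sum>j\<in>(\<lambda>i. 2 * i) ` I. F j z * G j z) + (\<Sum>j\<in>(\<lambda>i. 2 * i + 1) ` I. F j z * G j z)"
        by (subst (1 2) sum.reindex) (auto simp: F_def G_def sum.distrib inj_on_def)
      also have "\<dots> = (\<Sum>j\<in>J. F j z * G j z)"
        unfolding J_def by (rule sum.union_disjoint[symmetric]) (use I in \<open>auto, presburger\<close>)
      finally show ?thesis .
    qed
    moreover have "F j \<in> schwartz" "G j \<in> schwartz" for j
      using f g e by (auto simp: F_def G_def intro: schwartz_frechet_derivative)
    moreover have "finite J" using I by (simp add: J_def)
    ultimately show "(\<lambda>z. frechet_derivative h (at z) e) \<in> ?P"
      by (intro CollectI exI[of _ J] exI[of _ F] exI[of _ G]) auto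
  qed
qed

lemma schwartz_uminus:
  assumes "f \<in> schwartz"
  shows "(\<lambda>z. - f z) \<in> schwartz"
proof (rule schwartz_coinduct[where P = "{\<lambda>z. - f z | f. f \<in> schwartz}"])
  fix h :: "'a \<Rightarrow> complex"
  assume "h \<in> {\<lambda>z. - f z | f. f \<in> schwartz}"
  then obtain f where h: "h = (\<lambda>z. - f z)" and f: "f \<in> schwartz" by blast
  show "h differentiable_on UNIV"
    unfolding h differentiable_on_def using f
    by (simp add: schwartz_differentiable)
  show "bounded (range (\<lambda>z. (1 + norm z) ^ n *\<^sub>R h z))" for n
    by (rule schwartz_decay[OF f, of n]) (auto simp: h intro: bounded_range_scaleR_weight)
  fix e :: 'a assume e: "e \<in> Basis"
  have "frechet_derivative h (at z) e = - frechet_derivative f (at z) e" for z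
    unfolding h by (rule frechet_derivative_eqI) (intro has_derivative_minus schwartz_has_derivative f)
  then show "(\<lambda>z. frechet_derivative h (at z) e) \<in> {\<lambda>z. - f z | f. f \<in> schwartz}"
    using schwartz_frechet_derivative[OF f e] by auto
qed (use assms in blast)

lemma schwartz_diff:
  assumes "f \<in> schwartz" "g \<in> schwartz"
  shows "(\<lambda>z. f z - g z) \<in> schwartz"
  using schwartz_add[OF assms(1) schwartz_uminus[OF assms(2)]] by simp

section \<open>Completions\<close>

text \<open>The triangle inequality is restricted to Schwartz functions because a divergent Bochner
  integral has the value 0, and the norms of other functions then carry no information.\<close>

locale schwartz_seminorm =
  fixes N :: "('a::euclidean_space \<Rightarrow> complex) \<Rightarrow> real"
  assumes nonneg: "0 \<le> N f"
    and zero: "N (\<lambda>z. 0) = 0"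
    and minus: "N (\<lambda>z. - f z) = N f"
    and triangle: "f \<in> schwartz \<Longrightarrow> g \<in> schwartz \<Longrightarrow> N (\<lambda>z. f z + g z) \<le> N f + N g"
begin

lemma diff_commute: "N (\<lambda>z. f z - g z) = N (\<lambda>z. g z - f z)"
  using minus[of "\<lambda>z. f z - g z"] by simp

lemma triangle_diff:
  assumes "f \<in> schwartz" "g \<in> schwartz" "h \<in> schwartz"
  shows "N (\<lambda>z. f z - h z) \<le> N (\<lambda>z. f z - g z) + N (\<lambda>z. g z - h z)"
  using triangle[of "\<lambda>z. f z - g z" "\<lambda>z. g z - h z"] assms by (simp add: schwartz_diff)

lemma abs_diff_le:
  assumes "f \<in> schwartz" "g \<in> schwartz"
  shows "\<bar>N f - N g\<bar> \<le> N (\<lambda>z. f z - g z)"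
proof -
  have "N f \<le> N (\<lambda>z. f z - g z) + N g"
    using triangle[of "\<lambda>z. f z - g z" g] assms by (simp add: schwartz_diff)
  moreover have "N g \<le> N (\<lambda>z. g z - f z) + N f"
    using triangle[of "\<lambda>z. g z - f z" f] assms by (simp add: schwartz_diff)
  ultimately show ?thesis using diff_commute[of f g] by simp
qed

lemma null_rel_refl: "(\<And>n. f n \<in> schwartz) \<Longrightarrow> (f, f) \<in> null_rel N"
  by (simp add: null_rel_def zero)

lemma null_rel_sym: "(f, g) \<in> null_rel N \<Longrightarrow> (g, f) \<in> null_rel N"
proof -
  assume fg: "(f, g) \<in> null_rel N"
  have "(\<lambda>n. N (\<lambda>z. f n z - g n z)) = (\<lambda>n. N (\<lambda>z. g n z - f n z))"
    by (intro ext diff_commute)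
  with fg show ?thesis by (simp add: null_rel_def)
qed

lemma null_rel_trans:
  assumes "(f, g) \<in> null_rel N" "(g, h) \<in> null_rel N"
  shows "(f, h) \<in> null_rel N"
proof -
  have S: "f n \<in> schwartz" "g n \<in> schwartz" "h n \<in> schwartz" for n
    using assms by (auto simp: null_rel_def)
  have "(\<lambda>n. N (\<lambda>z. f n z - g n z) + N (\<lambda>z. g n z - h n z)) \<longlonglongrightarrow> 0"
    using assms by (intro tendsto_add_zero) (auto simp: null_rel_def)
  then have "(\<lambda>n. N (\<lambda>z. f n z - h n z)) \<longlonglongrightarrow> 0"
    by (rule Lim_null_comparison[OF always_eventually, rotated]) (auto simp: nonneg intro!: triangle_diff S)
  then show ?thesis using S by (simp add: null_rel_def)
qed

lemma null_rel_class_eq: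
  "(f, g) \<in> null_rel N \<Longrightarrow> null_rel N `` {f} = null_rel N `` {g}"
  using null_rel_sym null_rel_trans by blast

lemma cauchy_seqs_convergent:
  assumes f: "f \<in> cauchy_seqs N"
  shows "convergent (\<lambda>n. N (f n))"
proof -
  have S: "f n \<in> schwartz" for n using f by (simp add: cauchy_seqs_def)
  have "Cauchy (\<lambda>n. N (f n))"
  proof (rule CauchyI)
    fix \<epsilon> :: real assume "0 < \<epsilon>"
    then obtain M where M: "\<forall>m\<ge>M. \<forall>n\<ge>M. N (\<lambda>z. f m z - f n z) < \<epsilon>"
      using f by (auto simp: cauchy_seqs_def)
    have "norm (N (f m) - N (f n)) < \<epsilon>" if "m \<ge> M" "n \<ge> M" for m n
      using abs_diff_le[OF S S, of m n] M that by (force simp: real_norm_def)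
    then show "\<exists>M. \<forall>m\<ge>M. \<forall>n\<ge>M. norm (N (f m) - N (f n)) < \<epsilon>" by blast
  qed
  then show ?thesis by (simp add: Cauchy_convergent_iff)
qed

text \<open>This makes the definite description in \<open>completion_norm\<close> denote: the limit
  exists along one Cauchy representative, and \<open>abs_diff_le\<close> transfers it to every
  equivalent sequence.\<close>

lemma completion_norm_tendsto:
  assumes u: "u \<in> completion N" and f: "f \<in> u"
  shows "(\<lambda>n. N (f n)) \<longlonglongrightarrow> completion_norm N u"
proof -
  obtain f\<^sub>0 where f\<^sub>0: "f\<^sub>0 \<in> cauchy_seqs N" and u_eq: "u = null_rel N `` {f\<^sub>0}"
    using u unfolding completion_def by (rule quotientE)
  obtain r where r: "(\<lambda>n. N (f\<^sub>0 n)) \<longlonglongrightarrow> r"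
    using cauchy_seqs_convergent[OF f\<^sub>0] by (auto simp: convergent_def)
  have lim: "(\<lambda>n. N (g n)) \<longlonglongrightarrow> r" if "g \<in> u" for g
  proof -
    have rel: "(f\<^sub>0, g) \<in> null_rel N" using that u_eq by auto
    have "(\<lambda>n. N (g n) - N (f\<^sub>0 n)) \<longlonglongrightarrow> 0"
    proof (rule tendsto_rabs_zero_cancel, rule tendsto_sandwich[OF _ _ tendsto_const, of 0])
      show "(\<lambda>n. N (\<lambda>z. f\<^sub>0 n z - g n z)) \<longlonglongrightarrow> 0" using rel by (simp add: null_rel_def)
      show "\<forall>\<^sub>F n in sequentially. \<bar>N (g n) - N (f\<^sub>0 n)\<bar> \<le> N (\<lambda>z. f\<^sub>0 n z - g n z)"
        using rel abs_diff_le by (intro always_eventually allI)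
          (subst abs_minus_commute, auto simp: null_rel_def)
    qed auto
    from tendsto_add[OF this r] show ?thesis by simp
  qed
  have "completion_norm N u = r"
    unfolding completion_norm_def
  proof (rule the_equality)
    show "\<forall>f\<in>u. (\<lambda>n. N (f n)) \<longlonglongrightarrow> r" using lim by blast
    show "r' = r" if "\<forall>f\<in>u. (\<lambda>n. N (f n)) \<longlonglongrightarrow> r'" for r'
      using that lim f LIMSEQ_unique by blast
  qed
  then show ?thesis using lim f by simp
qed

lemma completion_null_rel:
  assumes "u \<in> completion N" "f \<in> u" "g \<in> u"
  shows "(f, g) \<in> null_rel N"
  using assms null_rel_sym null_rel_trans unfolding completion_def quotient_def by blast

lemma completion_cauchy_seqs:
  assumes u: "u \<in> completion N" and f: "f \<in> u"
  shows "f \<in> cauchy_seqs N"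
proof -
  obtain f\<^sub>0 where f\<^sub>0: "f\<^sub>0 \<in> cauchy_seqs N" and u_eq: "u = null_rel N `` {f\<^sub>0}"
    using u unfolding completion_def by (rule quotientE)
  have S: "f n \<in> schwartz" "f\<^sub>0 n \<in> schwartz" for n
    using f u_eq by (auto simp: null_rel_def)
  have lim: "(\<lambda>n. N (\<lambda>z. f\<^sub>0 n z - f n z)) \<longlonglongrightarrow> 0"
    using f u_eq by (auto simp: null_rel_def)
  have "\<exists>M. \<forall>m\<ge>M. \<forall>n\<ge>M. N (\<lambda>z. f m z - f n z) < \<epsilon>" if "0 < \<epsilon>" for \<epsilon>
  proof -
    have "0 < \<epsilon> / 3" using that by simp
    then obtain M where M: "\<forall>m\<ge>M. \<forall>n\<ge>M. N (\<lambda>z. f\<^sub>0 m z - f\<^sub>0 n z) < \<epsilon> / 3"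
      using f\<^sub>0 unfolding cauchy_seqs_def by blast
    obtain M' where M': "\<And>n. n \<ge> M' \<Longrightarrow> N (\<lambda>z. f\<^sub>0 n z - f n z) < \<epsilon> / 3"
      using LIMSEQ_D[OF lim \<open>0 < \<epsilon> / 3\<close>] by (auto simp: nonneg)
    have "N (\<lambda>z. f m z - f n z) < \<epsilon>" if "m \<ge> max M M'" "n \<ge> max M M'" for m n
    proof -
      have "N (\<lambda>z. f m z - f n z) \<le> N (\<lambda>z. f m z - f\<^sub>0 m z) + N (\<lambda>z. f\<^sub>0 m z - f n z)"
        by (intro triangle_diff S)
      also have "N (\<lambda>z. f\<^sub>0 m z - f n z) \<le> N (\<lambda>z. f\<^sub>0 m z - f\<^sub>0 n z) + N (\<lambda>z. f\<^sub>0 n z - f n z)"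
        by (intro triangle_diff S)
      also have "N (\<lambda>z. f m z - f\<^sub>0 m z) = N (\<lambda>z. f\<^sub>0 m z - f m z)" by (rule diff_commute)
      finally show ?thesis using M M'[of m] M'[of n] that by force
    qed
    then show ?thesis by blast
  qed
  then show ?thesis using S by (auto simp: cauchy_seqs_def)
qed

lemma completion_nonempty: "u \<in> completion N \<Longrightarrow> \<exists>f. f \<in> u"
  using null_rel_refl unfolding completion_def quotient_def cauchy_seqs_def by blast

end

text \<open>Since \<open>completion_mult\<close> is a union over all representatives, membership in
  the completion means that all product sequences lie in one class. The estimate
  \<open>prod_diff\<close> for a difference of products gives this as well as the Cauchy property,
  and the norm bound then passes to the limit.\<close>

lemma completion_mult_bounded:
  assumes "schwartz_seminorm N" "schwartz_seminorm N'"
    and bilinear: "\<And>f g. f \<in> schwartz \<Longrightarrow> g \<in> schwartz \<Longrightarrow> N' (\<lambda>z. f z * g z) \<le> C * N f * N g"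
    and C: "0 \<le> C" and u: "u \<in> completion N" and v: "v \<in> completion N"
  shows "completion_mult N' u v \<in> completion N'"
    and "completion_norm N' (completion_mult N' u v) \<le> C * completion_norm N u * completion_norm N v"
proof -
  interpret N: schwartz_seminorm N by fact
  interpret N': schwartz_seminorm N' by fact
  have prod_diff: "N' (\<lambda>z. f z * g z - f' z * g' z)
      \<le> C * N (\<lambda>z. f z - f' z) * N g + C * N f' * N (\<lambda>z. g z - g' z)"
    if "f \<in> schwartz" "g \<in> schwartz" "f' \<in> schwartz" "g' \<in> schwartz" for f g f' g'
  proof -
    have "(\<lambda>z. f z * g z - f' z * g' z) = (\<lambda>z. (f z - f' z) * g z + f' z * (g z - g' z))"
      by (simp add: algebra_simps)
    then have "N' (\<lambda>z. f z * g z - f' z * g' z)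
        \<le> N' (\<lambda>z. (f z - f' z) * g z) + N' (\<lambda>z. f' z * (g z - g' z))"
      using that by (simp only:) (intro N'.triangle schwartz_mult schwartz_diff)
    also have "\<dots> \<le> C * N (\<lambda>z. f z - f' z) * N g + C * N f' * N (\<lambda>z. g z - g' z)"
      using that by (intro add_mono bilinear schwartz_diff)
    finally show ?thesis .
  qed
  obtain f g where f: "f \<in> u" and g: "g \<in> v"
    using N.completion_nonempty u v by meson
  have cf: "f \<in> cauchy_seqs N" and cg: "g \<in> cauchy_seqs N"
    using N.completion_cauchy_seqs u v f g by auto
  have S: "f n \<in> schwartz" "g n \<in> schwartz" for n
    using cf cg by (auto simp: cauchy_seqs_def)
  have lf: "(\<lambda>n. N (f n)) \<longlonglongrightarrow> completion_norm N u" and lg: "(\<lambda>n. N (g n)) \<longlonglongrightarrow> completion_norm N v"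
    using N.completion_norm_tendsto u v f g by auto
  define p where "p = (\<lambda>n z. f n z * g n z)"
  have Sp: "p n \<in> schwartz" for n unfolding p_def by (intro schwartz_mult S)
  have cp: "p \<in> cauchy_seqs N'"
  proof -
    obtain A where A: "\<And>n. N (f n) \<le> A" "0 \<le> A"
      using convergent_imp_Bseq[of "\<lambda>n. N (f n)"] lf
      by (metis BseqD abs_le_D1 convergentI order_less_imp_le real_norm_def)
    obtain B where B: "\<And>n. N (g n) \<le> B" "0 \<le> B"
      using convergent_imp_Bseq[of "\<lambda>n. N (g n)"] lg
      by (metis BseqD abs_le_D1 convergentI order_less_imp_le real_norm_def)
    have "\<exists>M. \<forall>m\<ge>M. \<forall>n\<ge>M. N' (\<lambda>z. p m z - p n z) < \<epsilon>" if "0 < \<epsilon>" for \<epsilon>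
    proof -
      \<comment> \<open>The summand 1 keeps the denominator positive when \<open>C * (A + B)\<close>
        vanishes.\<close>
      define \<delta> where "\<delta> = \<epsilon> / (C * (A + B) + 1)"
      have pos: "C * (A + B) + 1 > 0"
        using C A B by (simp add: add_nonneg_pos)
      then have "\<delta> > 0" using that by (simp add: \<delta>_def)
      then obtain M M' where M: "\<forall>m\<ge>M. \<forall>n\<ge>M. N (\<lambda>z. f m z - f n z) < \<delta>"
        and M': "\<forall>m\<ge>M'. \<forall>n\<ge>M'. N (\<lambda>z. g m z - g n z) < \<delta>"
        using cf cg unfolding cauchy_seqs_def by blast
      have "N' (\<lambda>z. p m z - p n z) < \<epsilon>" if "m \<ge> max M M'" "n \<ge> max M M'" for m n
      proof -
        have "N' (\<lambda>z. p m z - p n z)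
            \<le> C * N (\<lambda>z. f m z - f n z) * N (g m) + C * N (f n) * N (\<lambda>z. g m z - g n z)"
          unfolding p_def by (intro prod_diff S)
        also have "\<dots> \<le> C * \<delta> * B + C * A * \<delta>"
          using M M' that C A B N.nonneg \<open>\<delta> > 0\<close>
          by (intro add_mono mult_mono mult_nonneg_nonneg) (auto intro: less_imp_le)
        also have "\<dots> = (C * (A + B)) * \<delta>" by (simp add: algebra_simps)
        also have "\<dots> < (C * (A + B) + 1) * \<delta>" using \<open>\<delta> > 0\<close> by (simp add: algebra_simps)
        also have "\<dots> = \<epsilon>" using pos by (simp add: \<delta>_def)
        finally show ?thesis .
      qed
      then show ?thesis by blast
    qed
    then show ?thesis using Sp by (auto simp: cauchy_seqs_def)
  qed
  have "null_rel N' `` {\<lambda>n z. f' n z * g' n z} = null_rel N' `` {p}" if "f' \<in> u" "g' \<in> v" for f' g'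
  proof (rule N'.null_rel_class_eq, rule N'.null_rel_sym)
    have rf: "(f, f') \<in> null_rel N" and rg: "(g, g') \<in> null_rel N"
      using N.completion_null_rel u v f g that by auto
    have S': "f' n \<in> schwartz" "g' n \<in> schwartz" for n
      using rf rg by (auto simp: null_rel_def)
    have "(\<lambda>n. N (f' n)) \<longlonglongrightarrow> completion_norm N u"
      using N.completion_norm_tendsto u that by auto
    then have "(\<lambda>n. C * N (\<lambda>z. f n z - f' n z) * N (g n) + C * N (f' n) * N (\<lambda>z. g n z - g' n z))
        \<longlonglongrightarrow> 0"
      using rf rg lg unfolding null_rel_def by (auto intro!: tendsto_eq_intros)
    then have "(\<lambda>n. N' (\<lambda>z. p n z - f' n z * g' n z)) \<longlonglongrightarrow> 0"
      by (rule Lim_null_comparison[OF always_eventually, rotated])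
        (auto simp: p_def N'.nonneg intro!: prod_diff S S')
    then show "(p, \<lambda>n z. f' n z * g' n z) \<in> null_rel N'"
      using Sp S' by (auto simp: null_rel_def intro: schwartz_mult)
  qed
  then have eq: "completion_mult N' u v = null_rel N' `` {p}"
    using f g unfolding completion_mult_def by blast
  show mem: "completion_mult N' u v \<in> completion N'"
    unfolding eq completion_def using cp by (rule quotientI)
  have "p \<in> completion_mult N' u v" unfolding eq using N'.null_rel_refl Sp by blast
  then have "(\<lambda>n. N' (p n)) \<longlonglongrightarrow> completion_norm N' (completion_mult N' u v)"
    using N'.completion_norm_tendsto mem by blast
  moreover have "(\<lambda>n. C * N (f n) * N (g n)) \<longlonglongrightarrow> C * completion_norm N u * completion_norm N v"
    using lf lg by (intro tendsto_intros)
  ultimately show "completion_norm N' (completion_mult N' u v)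
      \<le> C * completion_norm N u * completion_norm N v"
    by (rule LIMSEQ_le) (auto simp: p_def intro: bilinear S)
qed

section \<open>Pointwise bounds for the kernel\<close>

text \<open>Comparable with \<open>jbracket\<close> up to a factor 2, but piecewise linear, so that
  comparisons of brackets reduce to linear arithmetic.\<close>

definition br :: "real \<Rightarrow> real" where
  "br y = 1 + \<bar>y\<bar>"

lemma br_ge_1 [simp]: "1 \<le> br y" and br_pos [simp]: "0 < br y" and br_nonneg [simp]: "0 \<le> br y"
  and br_nonzero [simp]: "br y \<noteq> 0"
  by (auto simp: br_def)

lemma br_mono: "\<bar>x\<bar> \<le> \<bar>y\<bar> \<Longrightarrow> br x \<le> br y"
  by (simp add: br_def)

lemma br_le_double: "1 \<le> \<bar>y\<bar> \<Longrightarrow> br y \<le> 2 * \<bar>y\<bar>"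
  by (simp add: br_def)

lemma br_square_le: "(br y)\<^sup>2 \<le> 2 * (1 + y\<^sup>2)"
proof -
  have "0 \<le> (1 - \<bar>y\<bar>)\<^sup>2" by simp
  then show ?thesis by (simp add: br_def power2_eq_square algebra_simps)
qed

text \<open>Applied with \<open>z\<close> the square of the output frequency: at low time frequency
  the output modulation is comparable with it.\<close>

lemma br_low_time:
  assumes "\<bar>t\<bar> \<le> z / 4"
  shows "1 + 3 / 4 * z \<le> br (t + z)" and "br (t + z) \<le> 1 + 5 / 4 * z"
  using assms by (auto simp: br_def abs_if split: if_splits)

lemma powr_square_base: "0 < u \<Longrightarrow> (u\<^sup>2) powr e = u powr (2 * e)" for u :: real
  by (simp add: powr_powr flip: powr_numeral)

text \<open>In the application \<open>\<rho> = - s\<close> and \<open>a = 1 - \<sigma>\<close>. The exponent \<open>\<kappa>\<close> below is what remains of the largest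
  modulation after the decay in the other two has been improved to the integrable \<open>w\<close>.\<close>

locale exponents =
  fixes \<rho> a b \<theta> :: real
  assumes \<rho>_pos: "0 < \<rho>" and a_pos: "0 < a" and b_pos: "0 < b" and \<theta>_pos: "0 < \<theta>"
    and \<rho>_le: "\<rho> \<le> 2 * a" and \<theta>_le: "1 + \<theta> \<le> 4 * b"
    and a_le: "2 * a \<le> 1 + \<theta>" and b_le: "2 * b \<le> 1 + \<theta>"
    and gain_ge_half: "1 / 2 \<le> 4 * b + 2 * a - 2 - 2 * \<theta>"
    and gain_ge_\<rho>: "2 * \<rho> - 1 / 2 \<le> 4 * b + 2 * a - 2 - 2 * \<theta>"
begin

definition \<kappa> :: real where
  "\<kappa> = 4 * b + 2 * a - 2 - 2 * \<theta>"

definition w :: "real \<Rightarrow> real" where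
  "w y = br y powr (- 1 - \<theta>)"

lemma w_pos [simp]: "0 < w y" and w_nonneg [simp]: "0 \<le> w y"
  by (auto simp: w_def less_imp_le)

text \<open>\<open>\<kappa>_ge_\<rho>\<close> is the average of the two gain hypotheses.\<close>

lemma \<kappa>_pos: "0 < \<kappa>" and \<kappa>_ge_\<rho>: "\<rho> \<le> \<kappa>" and \<kappa>_ge_2\<rho>: "2 * \<rho> \<le> 1 / 2 + \<kappa>"
  using gain_ge_half gain_ge_\<rho> by (auto simp: \<kappa>_def)

text \<open>Here \<open>x\<close>, \<open>y\<close> are the frequencies of the two factors, \<open>l\<close>, \<open>p\<close>, \<open>q\<close> the modulations of the
  product and of the factors, and \<open>W\<close> is the square of the output weight.\<close>

definition ker_sq :: "real \<Rightarrow> real \<Rightarrow> real \<Rightarrow> real \<Rightarrow> real \<Rightarrow> real \<Rightarrow> real" where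
  "ker_sq W x y l p q = W * (br x powr (2 * \<rho>) * br y powr (2 * \<rho>))
     * (br l powr (- 2 * a) * br p powr (- 2 * b) * br q powr (- 2 * b))"

lemma ker_sq_commute: "ker_sq W x y l p q = ker_sq W y x l q p"
  by (simp add: ker_sq_def mult_ac)

section \<open>Trading decay between the modulations\<close>

lemma decay_exchange:
  assumes "br u \<le> v" "e \<le> 1 + \<theta>"
  shows "br u powr (- e) \<le> v powr (1 + \<theta> - e) * w u"
proof -
  have "br u powr (- e) = br u powr (1 + \<theta> - e) * w u"
    by (simp add: w_def flip: powr_add)
  also have "\<dots> \<le> v powr (1 + \<theta> - e) * w u"
    using assms by (intro mult_right_mono powr_mono2) auto
  finally show ?thesis .
qed

text \<open>Moving both factors to the smaller bracket gives the exponent \<open>- 4 * b\<close>,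
  which is integrable by \<open>\<theta>_le\<close>.\<close>

lemma decay_product_le: "br p powr (- 2 * b) * br q powr (- 2 * b) \<le> w p + w q"
proof -
  have *: "br u powr (- 2 * b) * br v powr (- 2 * b) \<le> w u" if "br u \<le> br v" for u v
  proof -
    have "br u powr (- 2 * b) * br v powr (- 2 * b) \<le> br u powr (- 2 * b) * br u powr (- 2 * b)"
      using that b_pos by (intro mult_left_mono powr_mono2') auto
    also have "\<dots> = br u powr (- 4 * b)" by (simp flip: powr_add)
    also have "\<dots> \<le> w u" unfolding w_def using \<theta>_le by (intro powr_mono) auto
    finally show ?thesis .
  qed
  show ?thesis
    using *[of p q] *[of q p] w_nonneg[of p] w_nonneg[of q] by (cases "br p \<le> br q") (simp_all add: mult.commute del: w_nonneg)
qed

text \<open>Where a frequency variable is confined to a bounded interval, an integrable factor in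
  that variable can be inserted at the price of a constant.\<close>

lemma one_le_w: "\<bar>y\<bar> \<le> 1 \<Longrightarrow> 1 \<le> 2 powr (1 + \<theta>) * w y"
proof -
  assume "\<bar>y\<bar> \<le> 1"
  then have "1 \<le> (2 / br y) powr (1 + \<theta>)"
    using \<theta>_pos by (intro ge_one_powr_ge_zero) (auto simp: br_def)
  also have "\<dots> = 2 powr (1 + \<theta>) * w y"
    using powr_minus_divide[of "br y" "1 + \<theta>"] by (simp add: w_def powr_divide)
  finally show ?thesis .
qed

text \<open>Here \<open>m\<close> is the largest modulation. Improving the decay in \<open>u\<close>
  and \<open>v\<close> to \<open>w\<close> costs the powers \<open>1 + \<theta> - e\<close> and
  \<open>1 + \<theta> - e'\<close> of \<open>br m\<close>. By \<open>sum\<close>, exactly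
  \<open>br m powr (- \<kappa>)\<close> is left over, and it pays for \<open>Q\<close>.\<close>

lemma decay_le_dominant:
  assumes u: "\<bar>u\<bar> \<le> \<bar>m\<bar>" "e \<le> 1 + \<theta>" and v: "\<bar>v\<bar> \<le> \<bar>m\<bar>" "e' \<le> 1 + \<theta>"
    and sum: "d + e + e' = \<kappa> + 2 + 2 * \<theta>" and Q: "0 \<le> Q" "Q \<le> B * br m powr \<kappa>"
  shows "Q * (br m powr (- d) * br u powr (- e) * br v powr (- e')) \<le> B * w u * w v"
proof -
  have le: "br u powr (- e) * br v powr (- e')
      \<le> (br m powr (1 + \<theta> - e) * w u) * (br m powr (1 + \<theta> - e') * w v)"
    using u v by (intro mult_mono decay_exchange br_mono) auto
  have "Q * (br m powr (- d) * (br u powr (- e) * br v powr (- e')))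
      \<le> (B * br m powr \<kappa>) * (br m powr (- d) * ((br m powr (1 + \<theta> - e) * w u) * (br m powr (1 + \<theta> - e') * w v)))"
    by (rule mult_mono[OF Q(2) mult_left_mono[OF le]]) (use order_trans[OF Q] in auto)
  also have "\<dots> = B * (br m powr \<kappa> * br m powr (- d) * br m powr (1 + \<theta> - e) * br m powr (1 + \<theta> - e')) * w u * w v"
    by (simp add: mult_ac)
  also have "br m powr \<kappa> * br m powr (- d) * br m powr (1 + \<theta> - e) * br m powr (1 + \<theta> - e')
      = br m powr (\<kappa> - d + (1 + \<theta> - e) + (1 + \<theta> - e'))"
    by (simp only: diff_conv_add_uminus powr_add)
  also have "\<kappa> - d + (1 + \<theta> - e) + (1 + \<theta> - e') = 0" using sum by argo
  finally show ?thesis by (simp add: mult.assoc)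
qed

lemma ker_sq_le_dominant_output:
  assumes "\<bar>p\<bar> \<le> \<bar>l\<bar>" "\<bar>q\<bar> \<le> \<bar>l\<bar>" "0 \<le> W"
    and "W * (br x powr (2 * \<rho>) * br y powr (2 * \<rho>)) \<le> B * br l powr \<kappa>"
  shows "ker_sq W x y l p q \<le> B * w p * w q"
  using decay_le_dominant[OF assms(1) b_le assms(2) b_le _ _ assms(4), of "2 * a"] assms(3)
  by (simp add: ker_sq_def \<kappa>_def)

lemma ker_sq_le_dominant_input:
  assumes "\<bar>l\<bar> \<le> \<bar>p\<bar>" "\<bar>q\<bar> \<le> \<bar>p\<bar>" "0 \<le> W"
    and "W * (br x powr (2 * \<rho>) * br y powr (2 * \<rho>)) \<le> B * br p powr \<kappa>"
  shows "ker_sq W x y l p q \<le> B * w l * w q"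
  using decay_le_dominant[OF assms(1) a_le assms(2) b_le _ _ assms(4), of "2 * b"] assms(3)
  by (simp add: ker_sq_def \<kappa>_def mult.left_commute mult.commute[of "br l powr _"])

lemma bracket_product_le:
  assumes "1 \<le> \<bar>x\<bar>" "1 \<le> \<bar>y\<bar>"
  shows "br x * br y \<le> 4 * \<bar>x * y\<bar>"
  using mult_mono[OF br_le_double[OF assms(1)] br_le_double[OF assms(2)]] by (simp add: abs_mult)

text \<open>If the largest modulation \<open>L\<close> controls the resonance \<open>x * y\<close>, then the square root of the
  resonance and a power of \<open>L\<close> absorb the frequency weights.\<close>

lemma resonance_absorbs:
  assumes "1 \<le> \<bar>x\<bar>" "1 \<le> \<bar>y\<bar>" "\<bar>x * y\<bar> \<le> 2 * L" "4 * \<bar>x * y\<bar> \<le> d\<^sup>2" "0 \<le> d"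
  shows "br x powr (2 * \<rho>) * br y powr (2 * \<rho>) \<le> d * (8 powr \<kappa> * L powr \<kappa>)"
proof -
  let ?m = "4 * \<bar>x * y\<bar>"
  have xy: "1 \<le> br x * br y" by (metis br_ge_1 mult_mono' mult_1 zero_le_one)
  have m: "br x * br y \<le> ?m" by (rule bracket_product_le) fact+
  have L: "0 \<le> L" using assms(3) abs_ge_zero[of "x * y"] by linarith
  have "br x powr (2 * \<rho>) * br y powr (2 * \<rho>) = (br x * br y) powr (2 * \<rho>)"
    by (simp add: powr_mult)
  also have "\<dots> \<le> (br x * br y) powr (1 / 2 + \<kappa>)"
    using xy \<kappa>_ge_2\<rho> by (intro powr_mono) auto
  also have "\<dots> \<le> ?m powr (1 / 2 + \<kappa>)"
    using m \<kappa>_pos by (intro powr_mono2) auto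
  \<comment> \<open>The half power is charged to \<open>d\<close>, in the applications a multiple of
    the Jacobian, and the power \<open>\<kappa>\<close> to \<open>L\<close>; the 8 comes from
    \<open>4 * \<bar>x * y\<bar> \<le> 8 * L\<close>.\<close>
  also have "\<dots> = sqrt ?m * ?m powr \<kappa>"
    using powr_half_sqrt[of ?m] by (simp only: powr_add)
  also have "\<dots> \<le> d * (8 * L) powr \<kappa>"
  proof (rule mult_mono)
    show "sqrt ?m \<le> d" using assms by (intro real_le_lsqrt) auto
    show "?m powr \<kappa> \<le> (8 * L) powr \<kappa>"
      by (rule powr_mono2) (use assms \<kappa>_pos in auto)
  qed (use assms in auto)
  also have "\<dots> = d * (8 powr \<kappa> * L powr \<kappa>)"
    using L by (simp add: powr_mult)
  finally show ?thesis .
qed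

text \<open>The output weight at \<open>z\<close> cancels the weight of the larger frequency
  \<open>y\<close>. The smaller one satisfies x^2 <= |x y|, so its weight costs only the power
  \<open>\<rho>\<close> of \<open>L\<close> and not \<open>2 * \<rho>\<close>.\<close>

lemma comparable_output_absorbs:
  assumes "\<bar>x\<bar> \<le> \<bar>y\<bar>" "br y \<le> 2 * br z" "1 \<le> \<bar>x\<bar>" "\<bar>x * y\<bar> \<le> 2 * L" "\<rho> \<le> e"
  shows "br z powr (- 2 * \<rho>) * (br x powr (2 * \<rho>) * br y powr (2 * \<rho>))
    \<le> 2 powr (2 * \<rho>) * (8 powr e * L powr e)"
proof -
  have L: "0 \<le> L" using assms(4) abs_ge_zero[of "x * y"] by linarith
  have "br y powr (2 * \<rho>) \<le> (2 * br z) powr (2 * \<rho>)"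
    using assms \<rho>_pos by (intro powr_mono2) auto
  then have y: "br z powr (- 2 * \<rho>) * br y powr (2 * \<rho>)
      \<le> br z powr (- 2 * \<rho>) * (2 powr (2 * \<rho>) * br z powr (2 * \<rho>))"
    by (intro mult_left_mono) (auto simp: powr_mult)
  have y': "br z powr (- 2 * \<rho>) * br y powr (2 * \<rho>) \<le> 2 powr (2 * \<rho>)"
    using y by (simp add: powr_minus field_simps)
  have "(br x)\<^sup>2 \<le> (2 * \<bar>x\<bar>)\<^sup>2"
    using br_le_double[OF assms(3)] by (intro power_mono) auto
  also have "\<dots> = 4 * (\<bar>x\<bar> * \<bar>x\<bar>)" by (simp add: power2_eq_square)
  also have "\<dots> \<le> 4 * (\<bar>x\<bar> * \<bar>y\<bar>)"
    using assms(1) by (intro mult_left_mono) auto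
  also have "\<dots> = 4 * \<bar>x * y\<bar>" by (simp add: abs_mult)
  also have "\<dots> \<le> 8 * L" using assms(4) by simp
  finally have sq: "(br x)\<^sup>2 \<le> 8 * L" .
  have "br x powr (2 * \<rho>) \<le> br x powr (2 * e)"
    using assms(5) by (intro powr_mono) auto
  also have "\<dots> = ((br x)\<^sup>2) powr e"
    by (rule powr_square_base[symmetric]) simp
  also have "\<dots> \<le> (8 * L) powr e"
    using sq assms(5) \<rho>_pos by (intro powr_mono2) auto
  finally have x: "br x powr (2 * \<rho>) \<le> 8 powr e * L powr e"
    using L by (simp add: powr_mult)
  have "br z powr (- 2 * \<rho>) * (br x powr (2 * \<rho>) * br y powr (2 * \<rho>))
      = (br z powr (- 2 * \<rho>) * br y powr (2 * \<rho>)) * br x powr (2 * \<rho>)"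
    by (simp add: mult_ac)
  also have "\<dots> \<le> 2 powr (2 * \<rho>) * (8 powr e * L powr e)"
    using y' x by (intro mult_mono) auto
  finally show ?thesis .
qed

text \<open>\<open>x\<close> and \<open>t\<close> are the output frequency and time frequency.
  Either the weight has its full decay in frequency, or the time frequency is so low that the output
  modulation \<open>t + x^2\<close> is comparable with x^2; the case distinctions on the weight
  below use nothing else.\<close>

definition admissible :: "real \<Rightarrow> real \<Rightarrow> real \<Rightarrow> bool" where
  "admissible W x t \<longleftrightarrow> 0 \<le> W \<and> W \<le> 1 \<and> (\<bar>t\<bar> \<le> x\<^sup>2 / 4 \<or> W = br x powr (- 2 * \<rho>))"

section \<open>Kernel bounds region by region\<close>

lemma ker_sq_le_cut:
  assumes "W * (br x powr (2 * \<rho>) * br y powr (2 * \<rho>)) * br l powr (- 2 * a) \<le> B" "0 \<le> B" "\<bar>u\<bar> \<le> 1"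
  shows "ker_sq W x y l p q \<le> B * 2 powr (1 + \<theta>) * (w u * (w p + w q))"
proof -
  have "ker_sq W x y l p q = (W * (br x powr (2 * \<rho>) * br y powr (2 * \<rho>)) * br l powr (- 2 * a))
      * (br p powr (- 2 * b) * br q powr (- 2 * b))"
    by (simp add: ker_sq_def mult_ac)
  also have "\<dots> \<le> B * (w p + w q)"
    using assms decay_product_le[of p q] by (intro mult_mono) auto
  also have "\<dots> \<le> (B * (w p + w q)) * (2 powr (1 + \<theta>) * w u)"
    using one_le_w[OF assms(3)] mult_left_mono[of 1 "2 powr (1 + \<theta>) * w u" "B * (w p + w q)"] assms(2)
    by simp
  finally show ?thesis by (simp add: mult_ac)
qed

text \<open>Only the weight of \<open>x\<close> matters when \<open>y\<close> is bounded. It is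
  cancelled by \<open>W\<close>, because \<open>x\<close> and \<open>x + y\<close> differ by at most
  1, or else (br x)^2 is at most a multiple of \<open>br l\<close> and \<open>\<rho>_le\<close> lets
  the decay in \<open>l\<close> absorb it. No comparison of the modulations enters.\<close>

lemma low_frequency_bound:
  assumes W: "admissible W (x + y) t" and y: "\<bar>y\<bar> \<le> 1" and l: "l = t + (x + y)\<^sup>2"
  shows "ker_sq W x y l p q
    \<le> (2 powr (2 * \<rho>) * (2 powr (2 * \<rho>) + 8 powr (2 * a))) * 2 powr (1 + \<theta>) * (w y * (w p + w q))"
proof (rule ker_sq_le_cut)
  have W0: "0 \<le> W" "W \<le> 1" using W by (auto simp: admissible_def)
  have "br y powr (2 * \<rho>) \<le> 2 powr (2 * \<rho>)"
    using y \<rho>_pos by (intro powr_mono2) (auto simp: br_def)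
  moreover have "W * br x powr (2 * \<rho>) * br l powr (- 2 * a) \<le> 2 powr (2 * \<rho>) + 8 powr (2 * a)"
  proof (cases "W = br (x + y) powr (- 2 * \<rho>)")
    case True
    have "\<bar>x\<bar> \<le> \<bar>x + y\<bar> + \<bar>y\<bar>" by linarith
    then have "br x \<le> 2 * br (x + y)" using y unfolding br_def by (smt (verit))
    then have "br x powr (2 * \<rho>) \<le> (2 * br (x + y)) powr (2 * \<rho>)"
      using \<rho>_pos by (intro powr_mono2) auto
    then have "W * br x powr (2 * \<rho>) \<le> W * (2 powr (2 * \<rho>) * br (x + y) powr (2 * \<rho>))"
      using W0 by (intro mult_left_mono) (auto simp: powr_mult)
    also have "\<dots> = 2 powr (2 * \<rho>)" unfolding True by (simp add: powr_minus)
    finally have "W * br x powr (2 * \<rho>) \<le> 2 powr (2 * \<rho>)" .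
    moreover have "br l powr (- 2 * a) \<le> 1"
      using a_pos powr_mono[of "- 2 * a" 0 "br l"] by simp
    ultimately have "W * br x powr (2 * \<rho>) * br l powr (- 2 * a) \<le> 2 powr (2 * \<rho>) * 1"
      by (intro mult_mono) auto
    then show ?thesis using powr_ge_zero[of 8 "2 * a"] by linarith
  next
    case False
    then have t: "\<bar>t\<bar> \<le> (x + y)\<^sup>2 / 4" using W by (auto simp: admissible_def)
    have "\<bar>x\<bar> \<le> \<bar>x + y\<bar> + 1" using y by linarith
    then have "br x \<le> 2 + \<bar>x + y\<bar>" by (simp add: br_def)
    then have "(br x)\<^sup>2 \<le> (2 + \<bar>x + y\<bar>)\<^sup>2" by (intro power_mono) auto
    also have "\<dots> \<le> 8 + 2 * (x + y)\<^sup>2"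
      using zero_le_power2[of "2 - \<bar>x + y\<bar>"] by (simp add: power2_eq_square algebra_simps abs_mult_self_eq flip: abs_mult)
    also have "\<dots> \<le> 8 * br l"
      using br_low_time(1)[OF t] zero_le_power2[of "x + y"] unfolding l by linarith
    finally have sq: "(br x)\<^sup>2 \<le> 8 * br l" .
    have "W * br x powr (2 * \<rho>) \<le> 1 * br x powr (2 * (2 * a))"
      using \<rho>_le \<rho>_pos W0 by (intro mult_mono powr_mono) auto
    also have "\<dots> = ((br x)\<^sup>2) powr (2 * a)"
      using powr_square_base[of "br x" "2 * a"] by simp
    also have "\<dots> \<le> (8 * br l) powr (2 * a)"
      using sq a_pos by (intro powr_mono2) auto
    finally have "W * br x powr (2 * \<rho>) * br l powr (- 2 * a) \<le> (8 * br l) powr (2 * a) * br l powr (- 2 * a)"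
      by (intro mult_right_mono) auto
    also have "\<dots> = 8 powr (2 * a)" by (simp add: powr_mult powr_minus)
    finally show ?thesis using powr_ge_zero[of 2 "2 * \<rho>"] by linarith
  qed
  ultimately have "br y powr (2 * \<rho>) * (W * br x powr (2 * \<rho>) * br l powr (- 2 * a))
      \<le> 2 powr (2 * \<rho>) * (2 powr (2 * \<rho>) + 8 powr (2 * a))"
    using W0 by (intro mult_mono) auto
  then show "W * (br x powr (2 * \<rho>) * br y powr (2 * \<rho>)) * br l powr (- 2 * a)
      \<le> 2 powr (2 * \<rho>) * (2 powr (2 * \<rho>) + 8 powr (2 * a))"
    by (simp add: mult_ac)
qed (use y in auto)

text \<open>Nearly opposite frequencies: (x - y)^2 = (x + y)^2 - 4 x y forces \<open>x * y\<close>
  to be nonpositive with 4 |x y| <= (x - y)^2. Hence the Jacobian \<open>\<bar>x - y\<bar>\<close>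
  can serve as \<open>d\<close> in \<open>resonance_absorbs\<close>, and \<open>W \<le> 1\<close> is
  enough.\<close>

lemma output_region_noncomparable:
  assumes W: "admissible W (x + y) t" and x: "1 \<le> \<bar>x\<bar>" and y: "1 \<le> \<bar>y\<bar>"
    and p: "\<bar>p\<bar> \<le> \<bar>l\<bar>" and q: "\<bar>q\<bar> \<le> \<bar>l\<bar>" and l: "l = p + q + 2 * (x * y)"
    and d: "2 * \<bar>x + y\<bar> \<le> \<bar>x - y\<bar>"
  shows "ker_sq W x y l p q \<le> 8 powr \<kappa> * (\<bar>x - y\<bar> * w p * w q)"
proof -
  have W0: "0 \<le> W" "W \<le> 1" using W by (auto simp: admissible_def)
  have m: "\<bar>x * y\<bar> \<le> 2 * br l" using p q l unfolding br_def by (smt (verit))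
  have "(2 * \<bar>x + y\<bar>)\<^sup>2 \<le> \<bar>x - y\<bar>\<^sup>2" using d by (intro power_mono) auto
  then have "4 * (x + y)\<^sup>2 \<le> (x - y)\<^sup>2" by (simp add: power_mult_distrib)
  moreover have "(x - y)\<^sup>2 = (x + y)\<^sup>2 - 4 * (x * y)"
    by (simp add: power2_eq_square algebra_simps)
  moreover have "0 \<le> (x + y)\<^sup>2" by simp
  ultimately have "x * y \<le> 0" "4 * - (x * y) \<le> (x - y)\<^sup>2" by linarith+
  then have "4 * \<bar>x * y\<bar> \<le> \<bar>x - y\<bar>\<^sup>2" by (simp add: abs_of_nonpos)
  then have "br x powr (2 * \<rho>) * br y powr (2 * \<rho>) \<le> \<bar>x - y\<bar> * (8 powr \<kappa> * br l powr \<kappa>)"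
    using x y m by (intro resonance_absorbs) auto
  then have "W * (br x powr (2 * \<rho>) * br y powr (2 * \<rho>)) \<le> 1 * (\<bar>x - y\<bar> * (8 powr \<kappa> * br l powr \<kappa>))"
    using W0 by - (rule mult_mono, auto)
  then have "ker_sq W x y l p q \<le> (\<bar>x - y\<bar> * 8 powr \<kappa>) * w p * w q"
    using p q W0 by (intro ker_sq_le_dominant_output) (auto simp: mult_ac)
  then show ?thesis by (simp add: mult_ac)
qed

lemma comparable_frequencies:
  assumes "\<bar>x\<bar> \<le> \<bar>y\<bar>" "\<bar>x - y\<bar> \<le> max 1 (2 * \<bar>x + y\<bar>)"
  shows "br y \<le> 2 * br (x + y)"
proof -
  have "2 * \<bar>y\<bar> \<le> \<bar>x + y\<bar> + \<bar>x - y\<bar>" by linarith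
  moreover have "\<bar>x - y\<bar> \<le> 1 + 2 * \<bar>x + y\<bar>"
    by (rule order_trans[OF assms(2)]) simp
  moreover have "0 \<le> \<bar>x + y\<bar>" by simp
  ultimately show ?thesis unfolding br_def by argo
qed

text \<open>The output frequency controls the larger input frequency, but the Jacobian
  \<open>\<bar>x - y\<bar>\<close> may vanish. On the strip where it is at most 1, the decay in
  \<open>l\<close> alone absorbs the weights (\<open>absorb\<close> with \<open>e = 2 * a\<close>)
  and \<open>w (x - y)\<close> is inserted. Off the strip the Jacobian is at least 1 and may be
  inserted, and \<open>absorb\<close> is used with \<open>e = \<kappa>\<close>.\<close>

lemma output_region_comparable:
  assumes W: "W = br (x + y) powr (- 2 * \<rho>)" and x: "1 \<le> \<bar>x\<bar>" and y: "1 \<le> \<bar>y\<bar>"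
    and p: "\<bar>p\<bar> \<le> \<bar>l\<bar>" and q: "\<bar>q\<bar> \<le> \<bar>l\<bar>" and l: "l = p + q + 2 * (x * y)"
    and d: "\<bar>x - y\<bar> \<le> max 1 (2 * \<bar>x + y\<bar>)"
  shows "ker_sq W x y l p q \<le> 2 powr (2 * \<rho>) * (8 powr \<kappa> + 8 powr (2 * a) * 2 powr (1 + \<theta>))
    * (w (x - y) * (w p + w q) + \<bar>x - y\<bar> * w p * w q)" (is "_ \<le> ?C * ?R")
proof -
  have m: "\<bar>x * y\<bar> \<le> 2 * br l" using p q l unfolding br_def by (smt (verit))
  have absorb: "W * (br x powr (2 * \<rho>) * br y powr (2 * \<rho>)) \<le> 2 powr (2 * \<rho>) * (8 powr e * br l powr e)"
    if "\<rho> \<le> e" for e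
  proof (cases "\<bar>x\<bar> \<le> \<bar>y\<bar>")
    case True
    then show ?thesis unfolding W
      using x m d that by (intro comparable_output_absorbs comparable_frequencies)
  next
    case False
    have "br (y + x) powr (- 2 * \<rho>) * (br y powr (2 * \<rho>) * br x powr (2 * \<rho>))
        \<le> 2 powr (2 * \<rho>) * (8 powr e * br l powr e)"
      using False y m d that
      by (intro comparable_output_absorbs comparable_frequencies)
        (auto simp: abs_minus_commute add.commute mult.commute)
    then show ?thesis unfolding W by (simp add: add.commute mult.commute)
  qed
  have W0: "0 \<le> W" by (simp add: W)
  show ?thesis
  proof (cases "\<bar>x - y\<bar> \<le> 1")
    case True
    have "W * (br x powr (2 * \<rho>) * br y powr (2 * \<rho>)) * br l powr (- 2 * a)
        \<le> 2 powr (2 * \<rho>) * (8 powr (2 * a) * br l powr (2 * a)) * br l powr (- 2 * a)"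
      using absorb[OF \<rho>_le] by (intro mult_right_mono) auto
    also have "\<dots> = 2 powr (2 * \<rho>) * 8 powr (2 * a)" by (simp add: powr_minus)
    finally have "ker_sq W x y l p q
        \<le> 2 powr (2 * \<rho>) * 8 powr (2 * a) * 2 powr (1 + \<theta>) * (w (x - y) * (w p + w q))"
      using True by (intro ker_sq_le_cut) auto
    also have "\<dots> \<le> ?C * ?R"
      by (rule mult_mono) (auto simp: algebra_simps)
    finally show ?thesis .
  next
    case False
    have "W * (br x powr (2 * \<rho>) * br y powr (2 * \<rho>)) \<le> 2 powr (2 * \<rho>) * (8 powr \<kappa> * br l powr \<kappa>)"
      by (rule absorb[OF \<kappa>_ge_\<rho>])
    also have "\<dots> \<le> \<bar>x - y\<bar> * (2 powr (2 * \<rho>) * (8 powr \<kappa> * br l powr \<kappa>))"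
      using False mult_right_mono[of 1 "\<bar>x - y\<bar>" "2 powr (2 * \<rho>) * (8 powr \<kappa> * br l powr \<kappa>)"] by simp
    finally have "ker_sq W x y l p q \<le> (2 powr (2 * \<rho>) * 8 powr \<kappa> * \<bar>x - y\<bar>) * w p * w q"
      using p q W0 by (intro ker_sq_le_dominant_output) (auto simp: mult_ac)
    also have "\<dots> = (2 powr (2 * \<rho>) * 8 powr \<kappa>) * (\<bar>x - y\<bar> * w p * w q)" by (simp add: mult_ac)
    also have "\<dots> \<le> ?C * ?R"
      by (rule mult_mono) (auto simp: algebra_simps)
    finally show ?thesis .
  qed
qed

text \<open>The weight gives nothing here. Instead \<open>br l\<close> bounds br x * br y and (br
  x)^2 and is bounded by \<open>br p\<close>, up to constants, so all factors except that of
  \<open>q\<close> become powers of \<open>br l\<close>. The resulting exponent is negative enough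
  to leave \<open>w x\<close>, and one can integrate in the frequency \<open>x\<close> and the
  modulation \<open>q\<close> without a Jacobian.\<close>

lemma output_region_low_time_aux:
  assumes W: "0 \<le> W" "W \<le> 1" and t: "\<bar>t\<bar> \<le> (x + y)\<^sup>2 / 4" and l: "l = t + (x + y)\<^sup>2"
    and p: "(x + y)\<^sup>2 / 8 \<le> \<bar>p\<bar>" and q: "\<bar>q\<bar> \<le> \<bar>l\<bar>"
    and x: "1 \<le> \<bar>x\<bar>" and y: "1 \<le> \<bar>y\<bar>" and d: "\<bar>x - y\<bar> \<le> 2 * \<bar>x + y\<bar>"
  shows "ker_sq W x y l p q
    \<le> 4 powr (2 * \<rho>) * 10 powr (2 * b) * 6 powr ((1 + \<theta>) / 2) * (w x * w q)"
proof -
  have z: "0 \<le> (x + y)\<^sup>2" by simp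
  have "\<bar>x - y\<bar>\<^sup>2 \<le> (2 * \<bar>x + y\<bar>)\<^sup>2" using d by (intro power_mono) auto
  then have "(x - y)\<^sup>2 \<le> 4 * (x + y)\<^sup>2" by (simp add: power_mult_distrib)
  moreover have "(x - y)\<^sup>2 = (x + y)\<^sup>2 - 4 * (x * y)"
    by (simp add: power2_eq_square algebra_simps)
  moreover have "0 \<le> (x - y)\<^sup>2" by simp
  ultimately have "4 * \<bar>x * y\<bar> \<le> 3 * (x + y)\<^sup>2" by linarith
  then have m: "br x * br y \<le> 4 * br l"
    using bracket_product_le[OF x y] br_low_time(1)[OF t] unfolding l by linarith
  have "1 + (x + y)\<^sup>2 / 8 \<le> br p" using p by (simp add: br_def)
  \<comment> \<open>10 = (5/4) / (1/8), the quotient of the coefficients in the upper bound for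
    \<open>br l\<close> and the lower bound for \<open>br p\<close>.\<close>
  then have p': "br l / 10 \<le> br p" using br_low_time(2)[OF t] z unfolding l by linarith
  have "2 * \<bar>x\<bar> \<le> \<bar>x + y\<bar> + \<bar>x - y\<bar>" by linarith
  then have "2 * \<bar>x\<bar> \<le> 3 * \<bar>x + y\<bar>" using d by argo
  then have "(2 * \<bar>x\<bar>)\<^sup>2 \<le> (3 * \<bar>x + y\<bar>)\<^sup>2" by (intro power_mono) auto
  then have "4 * x\<^sup>2 \<le> 9 * (x + y)\<^sup>2" by (simp add: power_mult_distrib)
  \<comment> \<open>6 = (9/2) / (3/4), from 2 x^2 <= (9/2) (x + y)^2 and the lower bound for
    \<open>br l\<close>.\<close>
  then have x': "(br x)\<^sup>2 / 6 \<le> br l"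
    using br_square_le[of x] br_low_time(1)[OF t] z unfolding l by argo
  have "br x powr (2 * \<rho>) * br y powr (2 * \<rho>) = (br x * br y) powr (2 * \<rho>)"
    by (simp add: powr_mult)
  also have "\<dots> \<le> (4 * br l) powr (2 * \<rho>)"
    using m \<rho>_pos by (intro powr_mono2) auto
  finally have 1: "br x powr (2 * \<rho>) * br y powr (2 * \<rho>) \<le> 4 powr (2 * \<rho>) * br l powr (2 * \<rho>)"
    by (simp add: powr_mult)
  have "br p powr (- 2 * b) \<le> (br l / 10) powr (- 2 * b)"
    using p' b_pos by (intro powr_mono2') auto
  also have "\<dots> = 10 powr (2 * b) * br l powr (- 2 * b)"
    by (simp add: powr_divide powr_minus field_simps)
  finally have 2: "br p powr (- 2 * b) \<le> 10 powr (2 * b) * br l powr (- 2 * b)" .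
  have 3: "br q powr (- 2 * b) \<le> br l powr (1 + \<theta> - 2 * b) * w q"
    using decay_exchange[of q "br l" "2 * b"] q b_le by (simp add: br_mono)
  \<comment> \<open>The exponent is at most -1/2 - theta by \<open>\<kappa>_ge_2\<rho>\<close>. Half
    of the exponent of \<open>w\<close> suffices because (br x)^2 is compared with
    \<open>br l\<close>.\<close>
  have "br l powr (2 * \<rho> - \<kappa> - 1 - \<theta>) \<le> br l powr (- ((1 + \<theta>) / 2))"
    using \<kappa>_ge_2\<rho> \<theta>_pos by (intro powr_mono) (auto simp: field_simps)
  also have "\<dots> \<le> ((br x)\<^sup>2 / 6) powr (- ((1 + \<theta>) / 2))"
    using x' \<theta>_pos by (intro powr_mono2') auto
  also have "\<dots> = 6 powr ((1 + \<theta>) / 2) * ((br x)\<^sup>2) powr (- ((1 + \<theta>) / 2))"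
    by (simp add: powr_divide powr_minus field_simps)
  also have "((br x)\<^sup>2) powr (- ((1 + \<theta>) / 2)) = w x"
    by (subst powr_square_base) (simp_all add: w_def add_divide_distrib)
  finally have 4: "br l powr (2 * \<rho> - \<kappa> - 1 - \<theta>) \<le> 6 powr ((1 + \<theta>) / 2) * w x" .
  have "ker_sq W x y l p q \<le> 1 * (4 powr (2 * \<rho>) * br l powr (2 * \<rho>))
     * (br l powr (- 2 * a) * (10 powr (2 * b) * br l powr (- 2 * b)) * (br l powr (1 + \<theta> - 2 * b) * w q))"
    unfolding ker_sq_def
    by (rule mult_mono[OF mult_mono[OF W(2) 1] mult_mono[OF mult_mono[OF order_refl 2] 3]])
      (use W in auto)
  also have "\<dots> = 4 powr (2 * \<rho>) * 10 powr (2 * b) * (br l powr (2 * \<rho>) * br l powr (- 2 * a)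
      * br l powr (- 2 * b) * br l powr (1 + \<theta> - 2 * b)) * w q"
    by (simp add: mult_ac)
  also have "br l powr (2 * \<rho>) * br l powr (- 2 * a) * br l powr (- 2 * b) * br l powr (1 + \<theta> - 2 * b)
      = br l powr (2 * \<rho> - \<kappa> - 1 - \<theta>)"
    by (simp only: flip: powr_add) (simp add: \<kappa>_def algebra_simps)
  also have "4 powr (2 * \<rho>) * 10 powr (2 * b) * br l powr (2 * \<rho> - \<kappa> - 1 - \<theta>) * w q
      \<le> 4 powr (2 * \<rho>) * 10 powr (2 * b) * (6 powr ((1 + \<theta>) / 2) * w x) * w q"
    using 4 by (intro mult_left_mono mult_right_mono) auto
  finally show ?thesis by (simp add: mult_ac)
qed

text \<open>The sum of the input modulations is t + x^2 + y^2, and x^2 + y^2 >= (x + y)^2 / 2. At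
  low time frequency one of them therefore has the size of the output modulation.\<close>

lemma output_region_low_time:
  assumes W: "0 \<le> W" "W \<le> 1" and t: "\<bar>t\<bar> \<le> (x + y)\<^sup>2 / 4" and l: "l = t + (x + y)\<^sup>2"
    and p: "\<bar>p\<bar> \<le> \<bar>l\<bar>" and q: "\<bar>q\<bar> \<le> \<bar>l\<bar>" and l': "l = p + q + 2 * (x * y)"
    and x: "1 \<le> \<bar>x\<bar>" and y: "1 \<le> \<bar>y\<bar>" and d: "\<bar>x - y\<bar> \<le> 2 * \<bar>x + y\<bar>"
  shows "ker_sq W x y l p q
    \<le> 4 powr (2 * \<rho>) * 10 powr (2 * b) * 6 powr ((1 + \<theta>) / 2) * ((w x + w y) * (w p + w q))"
    (is "_ \<le> ?C * _")
proof -
  have "p + q = t + ((x + y)\<^sup>2 + (x - y)\<^sup>2) / 2"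
    using l l' by (simp add: power2_eq_square field_simps)
  moreover have "0 \<le> (x - y)\<^sup>2" by simp
  ultimately have "(x + y)\<^sup>2 / 4 \<le> p + q" using t by argo
  then consider "(x + y)\<^sup>2 / 8 \<le> \<bar>p\<bar>" | "(x + y)\<^sup>2 / 8 \<le> \<bar>q\<bar>" by linarith
  then have "ker_sq W x y l p q \<le> ?C * max (w x * w q) (w y * w p)"
  proof cases
    case 1
    have "ker_sq W x y l p q \<le> ?C * (w x * w q)"
      using W t l 1 q x y d by (rule output_region_low_time_aux)
    also have "\<dots> \<le> ?C * max (w x * w q) (w y * w p)" by (intro mult_left_mono) auto
    finally show ?thesis .
  next
    case 2
    have "ker_sq W y x l q p \<le> ?C * (w y * w p)"
      using W t l 2 p x y d
      by (intro output_region_low_time_aux[of _ t]) (auto simp: add.commute abs_minus_commute)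
    also have "\<dots> \<le> ?C * max (w x * w q) (w y * w p)" by (intro mult_left_mono) auto
    finally show ?thesis by (simp add: ker_sq_commute)
  qed
  also have "\<dots> \<le> ?C * ((w x + w y) * (w p + w q))"
    by (intro mult_left_mono) (auto simp: algebra_simps add_nonneg_nonneg)
  finally show ?thesis .
qed

text \<open>The dominant modulation belongs to the frequency \<open>x\<close>, and the Jacobian is a
  multiple of \<open>\<bar>x\<bar>\<close>. If \<open>y\<close> is not much larger than
  \<open>x\<close>, the Jacobian covers the square root of the resonance. If \<open>y\<close> is
  much larger, it is comparable with the output frequency: either \<open>W\<close> cancels its
  weight, or the time frequency is low and both \<open>br l\<close> and \<open>br p\<close> are
  bounded below by a multiple of (br y)^2, which leaves \<open>w y\<close>.\<close>

lemma input_region_bound: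
  assumes W: "admissible W (x + y) t" and l: "l = t + (x + y)\<^sup>2" and l': "l = p + q + 2 * (x * y)"
    and x: "1 \<le> \<bar>x\<bar>" and y: "1 \<le> \<bar>y\<bar>" and lp: "\<bar>l\<bar> \<le> \<bar>p\<bar>" and q: "\<bar>q\<bar> \<le> \<bar>p\<bar>"
  shows "ker_sq W x y l p q
    \<le> (3 * 8 powr \<kappa> + 2 powr (2 * \<rho>) * 8 powr \<kappa> + 11 powr (\<kappa> + 1 + \<theta>))
      * (w y * w q + \<bar>x\<bar> * w l * w q)" (is "_ \<le> (?C1 + ?C2 + ?C3) * (?R1 + ?R2)")
proof -
  have W0: "0 \<le> W" "W \<le> 1" using W by (auto simp: admissible_def)
  have m: "\<bar>x * y\<bar> \<le> 2 * br p" using lp q l' unfolding br_def by (smt (verit))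
  have R: "0 \<le> ?R1" "0 \<le> ?R2" by auto
  have C: "0 \<le> ?C1" "0 \<le> ?C2" "0 \<le> ?C3" by auto
  consider "\<bar>y\<bar> \<le> 2 * \<bar>x\<bar>" | "2 * \<bar>x\<bar> < \<bar>y\<bar>" "W = br (x + y) powr (- 2 * \<rho>)"
    | "2 * \<bar>x\<bar> < \<bar>y\<bar>" "\<bar>t\<bar> \<le> (x + y)\<^sup>2 / 4"
    using W unfolding admissible_def by (meson not_le)
  then show ?thesis
  proof cases
    case 1
    have "\<bar>x * y\<bar> \<le> \<bar>x\<bar> * (2 * \<bar>x\<bar>)"
      using 1 unfolding abs_mult by (intro mult_left_mono) auto
    also have "\<dots> = 2 * x\<^sup>2" by (simp add: power2_eq_square)
    finally have "4 * \<bar>x * y\<bar> \<le> (3 * \<bar>x\<bar>)\<^sup>2" by (simp add: power_mult_distrib)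
    then have "br x powr (2 * \<rho>) * br y powr (2 * \<rho>) \<le> 3 * \<bar>x\<bar> * (8 powr \<kappa> * br p powr \<kappa>)"
      using x y m by (intro resonance_absorbs) auto
    then have "W * (br x powr (2 * \<rho>) * br y powr (2 * \<rho>)) \<le> 1 * (3 * \<bar>x\<bar> * (8 powr \<kappa> * br p powr \<kappa>))"
      using W0 by - (rule mult_mono, auto)
    then have "ker_sq W x y l p q \<le> (3 * 8 powr \<kappa> * \<bar>x\<bar>) * w l * w q"
      using lp q W0 by (intro ker_sq_le_dominant_input) (auto simp: mult_ac)
    also have "\<dots> = ?C1 * ?R2" by (simp add: mult_ac)
    also have "\<dots> \<le> (?C1 + ?C2 + ?C3) * (?R1 + ?R2)"
      using R C by (intro mult_mono) auto
    finally show ?thesis .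
  next
    case 2
    have "\<bar>y\<bar> \<le> \<bar>x + y\<bar> + \<bar>x\<bar>" by linarith
    then have "br y \<le> 2 * br (x + y)" using 2(1) unfolding br_def by argo
    then have "W * (br x powr (2 * \<rho>) * br y powr (2 * \<rho>)) \<le> 2 powr (2 * \<rho>) * (8 powr \<kappa> * br p powr \<kappa>)"
      unfolding 2(2) using 2(1) x m \<kappa>_ge_\<rho> by (intro comparable_output_absorbs) auto
    also have "\<dots> \<le> \<bar>x\<bar> * (2 powr (2 * \<rho>) * (8 powr \<kappa> * br p powr \<kappa>))"
      using x mult_right_mono[of 1 "\<bar>x\<bar>" "2 powr (2 * \<rho>) * (8 powr \<kappa> * br p powr \<kappa>)"] by simp
    finally have "ker_sq W x y l p q \<le> (2 powr (2 * \<rho>) * 8 powr \<kappa> * \<bar>x\<bar>) * w l * w q"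
      using lp q W0 by (intro ker_sq_le_dominant_input) (auto simp: mult_ac)
    also have "\<dots> = ?C2 * ?R2" by (simp add: mult_ac)
    also have "\<dots> \<le> (?C1 + ?C2 + ?C3) * (?R1 + ?R2)"
      using R C by (intro mult_mono) auto
    finally show ?thesis .
  next
    case 3
    have "\<bar>y\<bar> \<le> \<bar>x + y\<bar> + \<bar>x\<bar>" by linarith
    then have "\<bar>y\<bar> \<le> 2 * \<bar>x + y\<bar>" using 3(1) by argo
    then have "\<bar>y\<bar>\<^sup>2 \<le> (2 * \<bar>x + y\<bar>)\<^sup>2" by (intro power_mono) auto
    then have "y\<^sup>2 \<le> 4 * (x + y)\<^sup>2" by (simp add: power_mult_distrib)
    \<comment> \<open>11 is an integer above 8 / (3/4), from 2 y^2 <= 8 (x + y)^2 and the lower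
      bound for \<open>br l\<close>.\<close>
    then have y': "(br y)\<^sup>2 / 11 \<le> br l"
      using br_square_le[of y] br_low_time(1)[OF 3(2)] zero_le_power2[of "x + y"] unfolding l by argo
    then have p': "(br y)\<^sup>2 / 11 \<le> br p" using br_mono[OF lp] by linarith
    have "br x powr (2 * \<rho>) * br y powr (2 * \<rho>) \<le> br y powr (2 * \<rho>) * br y powr (2 * \<rho>)"
      using 3(1) \<rho>_pos by (intro mult_right_mono powr_mono2 br_mono) auto
    also have "\<dots> = ((br y)\<^sup>2) powr (2 * \<rho>)"
      by (subst powr_square_base) (auto simp flip: powr_add)
    also have "\<dots> = 11 powr (2 * \<rho>) * ((br y)\<^sup>2 / 11) powr (2 * \<rho>)"
      by (simp add: powr_divide)
    finally have 1: "br x powr (2 * \<rho>) * br y powr (2 * \<rho>)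
        \<le> 11 powr (2 * \<rho>) * ((br y)\<^sup>2 / 11) powr (2 * \<rho>)" .
    have 2: "br l powr (- 2 * a) \<le> ((br y)\<^sup>2 / 11) powr (- 2 * a)"
      using y' a_pos by (intro powr_mono2') auto
    have "br p powr (- 2 * b) * br q powr (- 2 * b) \<le> br p powr (- 2 * b) * (br p powr (1 + \<theta> - 2 * b) * w q)"
      using decay_exchange[of q "br p" "2 * b"] q b_le by (intro mult_left_mono) (auto simp: br_mono)
    also have "\<dots> = br p powr (1 + \<theta> - 4 * b) * w q"
      by (simp flip: powr_add mult.assoc)
    also have "\<dots> \<le> ((br y)\<^sup>2 / 11) powr (1 + \<theta> - 4 * b) * w q"
      using p' \<theta>_le by (intro mult_right_mono powr_mono2') auto
    finally have 3: "br p powr (- 2 * b) * br q powr (- 2 * b)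
        \<le> ((br y)\<^sup>2 / 11) powr (1 + \<theta> - 4 * b) * w q" .
    have "ker_sq W x y l p q \<le> 1 * (11 powr (2 * \<rho>) * ((br y)\<^sup>2 / 11) powr (2 * \<rho>))
       * (((br y)\<^sup>2 / 11) powr (- 2 * a) * (((br y)\<^sup>2 / 11) powr (1 + \<theta> - 4 * b) * w q))"
      unfolding ker_sq_def mult.assoc[of "br l powr (- 2 * a)"]
      by (rule mult_mono[OF mult_mono[OF W0(2) 1] mult_mono[OF 2 3]]) (use W0 in auto)
    also have "\<dots> = 11 powr (2 * \<rho>) * (((br y)\<^sup>2 / 11) powr (2 * \<rho>) * ((br y)\<^sup>2 / 11) powr (- 2 * a)
        * ((br y)\<^sup>2 / 11) powr (1 + \<theta> - 4 * b)) * w q"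
      by (simp add: mult_ac)
    also have "((br y)\<^sup>2 / 11) powr (2 * \<rho>) * ((br y)\<^sup>2 / 11) powr (- 2 * a)
        * ((br y)\<^sup>2 / 11) powr (1 + \<theta> - 4 * b) = ((br y)\<^sup>2 / 11) powr (2 * \<rho> - \<kappa> - 1 - \<theta>)"
      by (simp only: flip: powr_add) (simp add: \<kappa>_def algebra_simps)
    also have "\<dots> = ((br y)\<^sup>2) powr (2 * \<rho> - \<kappa> - 1 - \<theta>) * 11 powr (\<kappa> + 1 + \<theta> - 2 * \<rho>)"
      by (simp add: powr_divide powr_diff powr_add field_simps)
    also have "((br y)\<^sup>2) powr (2 * \<rho> - \<kappa> - 1 - \<theta>) = br y powr (2 * (2 * \<rho> - \<kappa> - 1 - \<theta>))"
      by (rule powr_square_base) simp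
    also have "11 powr (2 * \<rho>) * (br y powr (2 * (2 * \<rho> - \<kappa> - 1 - \<theta>)) * 11 powr (\<kappa> + 1 + \<theta> - 2 * \<rho>)) * w q
       \<le> 11 powr (2 * \<rho>) * (w y * 11 powr (\<kappa> + 1 + \<theta> - 2 * \<rho>)) * w q"
      unfolding w_def[of y] using \<kappa>_ge_2\<rho> \<theta>_pos
      by (intro mult_left_mono mult_right_mono powr_mono) auto
    also have "\<dots> = 11 powr (\<kappa> + 1 + \<theta>) * ?R1"
      by (simp add: powr_diff)
    also have "\<dots> \<le> (?C1 + ?C2 + ?C3) * (?R1 + ?R2)"
      using R C by (intro mult_mono) auto
    finally show ?thesis .
  qed
qed

end

section \<open>Integral bounds for the kernel\<close>

lemma nn_integral_lborel_affine:
  fixes f :: "'a::euclidean_space \<Rightarrow> ennreal"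
  assumes [measurable]: "f \<in> borel_measurable borel" and "c \<noteq> 0"
  shows "(\<integral>\<^sup>+x. f x \<partial>lborel) = ennreal (\<bar>c\<bar> ^ DIM('a)) * (\<integral>\<^sup>+x. f (t + c *\<^sub>R x) \<partial>lborel)"
  by (subst lborel_affine[OF assms(2), of t])
    (simp add: nn_integral_density nn_integral_distr nn_integral_cmult)

lemma nn_integral_lborel_shift:
  fixes f :: "'a::euclidean_space \<Rightarrow> ennreal"
  assumes [measurable]: "f \<in> borel_measurable borel"
  shows "(\<integral>\<^sup>+x. f (x - t) \<partial>lborel) = (\<integral>\<^sup>+x. f x \<partial>lborel)"
  using nn_integral_lborel_affine[OF assms, of 1 "- t"] by simp

lemma nn_integral_lborel_reflect:
  fixes f :: "'a::euclidean_space \<Rightarrow> ennreal"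
  assumes [measurable]: "f \<in> borel_measurable borel"
  shows "(\<integral>\<^sup>+x. f (t - x) \<partial>lborel) = (\<integral>\<^sup>+x. f x \<partial>lborel)"
  using nn_integral_lborel_affine[OF assms, of "-1" t] by simp

lemma nn_integral_even_le:
  fixes f :: "real \<Rightarrow> ennreal"
  assumes [measurable]: "f \<in> borel_measurable borel" and even: "\<And>x. f (- x) = f x"
  shows "(\<integral>\<^sup>+x. f x \<partial>lborel) \<le> 2 * (\<integral>\<^sup>+x. f x * indicator {0..} x \<partial>lborel)"
proof -
  have "(\<integral>\<^sup>+x. f x \<partial>lborel) \<le> (\<integral>\<^sup>+x. f x * indicator {0..} x + f x * indicator {..0} x \<partial>lborel)"
    by (intro nn_integral_mono) (auto split: split_indicator)
  also have "\<dots> = (\<integral>\<^sup>+x. f x * indicator {0..} x \<partial>lborel) + (\<integral>\<^sup>+x. f x * indicator {..0} x \<partial>lborel)"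
    by (intro nn_integral_add) auto
  also have "(\<integral>\<^sup>+x. f x * indicator {..0} x \<partial>lborel) = (\<integral>\<^sup>+x. f x * indicator {0..} x \<partial>lborel)"
    by (subst nn_integral_lborel_reflect[where t = 0, symmetric])
      (auto simp: even intro!: nn_integral_cong split: split_indicator)
  finally show ?thesis by (simp add: mult_2)
qed

lemma nn_integral_decay_finite:
  fixes e :: real
  assumes "1 < e"
  shows "(\<integral>\<^sup>+y. ennreal (br y powr (- e)) \<partial>lborel) < \<infinity>"
proof -
  have [measurable]: "br \<in> borel_measurable borel" unfolding br_def by measurable
  define F where "F x = - ((1 + x) powr (1 - e) / (e - 1))" for x :: real
  have "(\<integral>\<^sup>+y. ennreal (br y powr (- e)) * indicator {0..} y \<partial>lborel) = ennreal (0 - F 0)"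
  proof (rule nn_integral_FTC_atLeast)
    fix x :: real assume "0 \<le> x"
    then have "DERIV F x :> - ((1 - e) * (1 + x) powr (1 - e - 1) / (e - 1))"
      unfolding F_def using assms by (auto intro!: derivative_eq_intros)
    moreover have "- ((1 - e) * c / (e - 1)) = c" for c
      using assms by (simp only: minus_divide_left minus_mult_left minus_diff_eq) simp
    ultimately show "DERIV F x :> br x powr (- e)"
      using \<open>0 \<le> x\<close> by (simp add: br_def)
  next
    have "((\<lambda>x::real. (1 + x) powr (1 - e)) \<longlongrightarrow> 0) at_top"
      using assms by (intro tendsto_neg_powr filterlim_tendsto_add_at_top[OF tendsto_const]) (auto intro: filterlim_ident)
    from tendsto_minus[OF tendsto_divide[OF this tendsto_const[of "e - 1"]]]
    show "(F \<longlongrightarrow> 0) at_top"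
      unfolding F_def using assms by simp
  qed auto
  moreover have "(\<integral>\<^sup>+y. ennreal (br y powr (- e)) \<partial>lborel)
      \<le> 2 * (\<integral>\<^sup>+y. ennreal (br y powr (- e)) * indicator {0..} y \<partial>lborel)"
    by (rule nn_integral_even_le) (auto simp: br_def)
  ultimately show ?thesis
    by (metis (no_types, lifting) ennreal_less_top ennreal_mult_less_top infinity_ennreal_def
        ennreal_numeral order_le_less_trans)
qed

text \<open>On each half-line x^2 + c is monotone and its Jacobian 2 |x| exceeds the weight |x|, so
  each half contributes at most the integral of \<open>f\<close>. The substitution is made on
  compact intervals and extended by monotone convergence.\<close>

lemma nn_integral_square_substitution_le:
  fixes f :: "real \<Rightarrow> ennreal"
  assumes f[measurable]: "f \<in> borel_measurable borel"
  shows "(\<integral>\<^sup>+x. ennreal \<bar>x\<bar> * f (x\<^sup>2 + c) \<partial>lborel) \<le> 2 * (\<integral>\<^sup>+x. f x \<partial>lborel)"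
proof -
  have fin: "(\<integral>\<^sup>+x. (ennreal \<bar>x\<bar> * f (x\<^sup>2 + c)) * indicator {0..real n} x \<partial>lborel) \<le> (\<integral>\<^sup>+x. f x \<partial>lborel)" for n
  proof (cases "n = 0")
    case True
    have "(\<integral>\<^sup>+x. (ennreal \<bar>x\<bar> * f (x\<^sup>2 + c)) * indicator {0..real n} x \<partial>lborel) = (\<integral>\<^sup>+x. 0 \<partial>(lborel :: real measure))"
      by (intro nn_integral_cong) (auto simp: True split: split_indicator)
    then show ?thesis by simp
  next
    case False
    have "(\<integral>\<^sup>+x. (ennreal \<bar>x\<bar> * f (x\<^sup>2 + c)) * indicator {0..real n} x \<partial>lborel)
        \<le> (\<integral>\<^sup>+x. f (x\<^sup>2 + c) * ennreal (2 * x) * indicator {0..real n} x \<partial>lborel)"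
      by (intro nn_integral_mono) (auto split: split_indicator simp: mult.commute intro!: mult_right_mono ennreal_leI)
    also have "\<dots> = (\<integral>\<^sup>+x. f x * indicator {0\<^sup>2 + c..(real n)\<^sup>2 + c} x \<partial>lborel)"
      using False
      by (intro nn_integral_substitution_aux[symmetric, where g = "\<lambda>x. x\<^sup>2 + c" and g' = "\<lambda>x. 2 * x"])
        (auto intro!: derivative_eq_intros continuous_intros)
    also have "\<dots> \<le> (\<integral>\<^sup>+x. f x \<partial>lborel)"
      by (intro nn_integral_mono) (auto split: split_indicator)
    finally show ?thesis .
  qed
  have "(\<integral>\<^sup>+x. (ennreal \<bar>x\<bar> * f (x\<^sup>2 + c)) * indicator {0..} x \<partial>lborel)
      = (\<integral>\<^sup>+x. (SUP n. (ennreal \<bar>x\<bar> * f (x\<^sup>2 + c)) * indicator {0..real n} x) \<partial>lborel)"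
  proof (rule nn_integral_cong)
    fix x :: real
    show "(ennreal \<bar>x\<bar> * f (x\<^sup>2 + c)) * indicator {0..} x
        = (SUP n. (ennreal \<bar>x\<bar> * f (x\<^sup>2 + c)) * indicator {0..real n} x)"
    proof (rule antisym)
      obtain n where "x \<le> real n" using real_arch_simple by blast
      then show "(ennreal \<bar>x\<bar> * f (x\<^sup>2 + c)) * indicator {0..} x
          \<le> (SUP n. (ennreal \<bar>x\<bar> * f (x\<^sup>2 + c)) * indicator {0..real n} x)"
        by (intro SUP_upper2[of n]) (auto split: split_indicator)
    qed (auto intro!: SUP_least split: split_indicator)
  qed
  also have "\<dots> = (SUP n. \<integral>\<^sup>+x. (ennreal \<bar>x\<bar> * f (x\<^sup>2 + c)) * indicator {0..real n} x \<partial>lborel)"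
    by (intro nn_integral_monotone_convergence_SUP)
      (auto simp: incseq_def le_fun_def split: split_indicator)
  also have "\<dots> \<le> (\<integral>\<^sup>+x. f x \<partial>lborel)"
    using fin by (intro SUP_least) auto
  finally have half: "(\<integral>\<^sup>+x. (ennreal \<bar>x\<bar> * f (x\<^sup>2 + c)) * indicator {0..} x \<partial>lborel) \<le> (\<integral>\<^sup>+x. f x \<partial>lborel)" .
  have "(\<integral>\<^sup>+x. ennreal \<bar>x\<bar> * f (x\<^sup>2 + c) \<partial>lborel)
      \<le> 2 * (\<integral>\<^sup>+x. (ennreal \<bar>x\<bar> * f (x\<^sup>2 + c)) * indicator {0..} x \<partial>lborel)"
    by (rule nn_integral_even_le) auto
  also have "\<dots> \<le> 2 * (\<integral>\<^sup>+x. f x \<partial>lborel)"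
    using half by (intro mult_left_mono) auto
  finally show ?thesis .
qed

section \<open>Cauchy-Schwarz estimates for trilinear forms\<close>

lemma Cauchy_Schwarz_iterated:
  fixes h :: "'a::euclidean_space \<Rightarrow> ennreal" and K F :: "'a \<Rightarrow> 'a \<Rightarrow> ennreal"
  assumes [measurable]: "h \<in> borel_measurable borel"
      "case_prod K \<in> borel_measurable (borel \<Otimes>\<^sub>M borel)" "case_prod F \<in> borel_measurable (borel \<Otimes>\<^sub>M borel)"
    and K: "\<And>x. (\<integral>\<^sup>+y. (K x y)\<^sup>2 \<partial>lborel) \<le> B"
  shows "(\<integral>\<^sup>+x. h x * (\<integral>\<^sup>+y. K x y * F x y \<partial>lborel) \<partial>lborel)\<^sup>2
    \<le> (\<integral>\<^sup>+x. (h x)\<^sup>2 \<partial>lborel) * (B * (\<integral>\<^sup>+x. (\<integral>\<^sup>+y. (F x y)\<^sup>2 \<partial>lborel) \<partial>lborel))"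
proof -
  have "(\<integral>\<^sup>+x. h x * (\<integral>\<^sup>+y. K x y * F x y \<partial>lborel) \<partial>lborel)\<^sup>2
      \<le> (\<integral>\<^sup>+x. (h x)\<^sup>2 \<partial>lborel) * (\<integral>\<^sup>+x. (\<integral>\<^sup>+y. K x y * F x y \<partial>lborel)\<^sup>2 \<partial>lborel)"
    by (rule Cauchy_Schwarz_nn_integral) measurable
  also have "(\<integral>\<^sup>+x. (\<integral>\<^sup>+y. K x y * F x y \<partial>lborel)\<^sup>2 \<partial>lborel)
      \<le> (\<integral>\<^sup>+x. B * (\<integral>\<^sup>+y. (F x y)\<^sup>2 \<partial>lborel) \<partial>lborel)"
  proof (rule nn_integral_mono)
    fix x
    have "(\<integral>\<^sup>+y. K x y * F x y \<partial>lborel)\<^sup>2 \<le> (\<integral>\<^sup>+y. (K x y)\<^sup>2 \<partial>lborel) * (\<integral>\<^sup>+y. (F x y)\<^sup>2 \<partial>lborel)"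
      by (rule Cauchy_Schwarz_nn_integral) measurable
    also have "\<dots> \<le> B * (\<integral>\<^sup>+y. (F x y)\<^sup>2 \<partial>lborel)"
      by (intro mult_right_mono K) auto
    finally show "(\<integral>\<^sup>+y. K x y * F x y \<partial>lborel)\<^sup>2 \<le> B * (\<integral>\<^sup>+y. (F x y)\<^sup>2 \<partial>lborel)" .
  qed
  also have "\<dots> = B * (\<integral>\<^sup>+x. (\<integral>\<^sup>+y. (F x y)\<^sup>2 \<partial>lborel) \<partial>lborel)"
    by (rule nn_integral_cmult) measurable
  finally show ?thesis by (simp add: mult_left_mono)
qed

text \<open>A bilinear integral operator tested against \<open>h\<close>. In this symmetric form any
  of the three functions can be made the outermost one.\<close>

definition trilinear ::
    "('a::euclidean_space \<Rightarrow> 'a \<Rightarrow> ennreal) \<Rightarrow> ('a \<Rightarrow> ennreal) \<Rightarrow> ('a \<Rightarrow> ennreal) \<Rightarrow> ('a \<Rightarrow> ennreal) \<Rightarrow> ennreal" where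
  "trilinear K h f g = (\<integral>\<^sup>+x. h x * (\<integral>\<^sup>+y. K x y * (f y * g (x - y)) \<partial>lborel) \<partial>lborel)"

lemma trilinear_le_output:
  fixes h f g :: "'a::euclidean_space \<Rightarrow> ennreal"
  assumes [measurable]: "h \<in> borel_measurable borel" "f \<in> borel_measurable borel" "g \<in> borel_measurable borel"
      "case_prod K \<in> borel_measurable (borel \<Otimes>\<^sub>M borel)"
    and K: "\<And>x. (\<integral>\<^sup>+y. (K x y)\<^sup>2 \<partial>lborel) \<le> B"
  shows "(trilinear K h f g)\<^sup>2
    \<le> B * ((\<integral>\<^sup>+x. (h x)\<^sup>2 \<partial>lborel) * (\<integral>\<^sup>+x. (f x)\<^sup>2 \<partial>lborel) * (\<integral>\<^sup>+x. (g x)\<^sup>2 \<partial>lborel))"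
proof -
  have "(trilinear K h f g)\<^sup>2 \<le> (\<integral>\<^sup>+x. (h x)\<^sup>2 \<partial>lborel)
      * (B * (\<integral>\<^sup>+x. (\<integral>\<^sup>+y. (f y * g (x - y))\<^sup>2 \<partial>lborel) \<partial>lborel))"
    unfolding trilinear_def using K by (intro Cauchy_Schwarz_iterated) measurable
  also have "(\<integral>\<^sup>+x. (\<integral>\<^sup>+y. (f y * g (x - y))\<^sup>2 \<partial>lborel) \<partial>lborel)
      = (\<integral>\<^sup>+y. (\<integral>\<^sup>+x. (f y * g (x - y))\<^sup>2 \<partial>lborel) \<partial>lborel)"
    by (rule lborel_pair.Fubini') measurable
  also have "\<dots> = (\<integral>\<^sup>+y. (f y)\<^sup>2 * (\<integral>\<^sup>+x. (g x)\<^sup>2 \<partial>lborel) \<partial>lborel)"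
    using nn_integral_lborel_shift[of "\<lambda>x. (g x)\<^sup>2"]
    by (simp add: power_mult_distrib nn_integral_cmult)
  also have "\<dots> = (\<integral>\<^sup>+x. (f x)\<^sup>2 \<partial>lborel) * (\<integral>\<^sup>+x. (g x)\<^sup>2 \<partial>lborel)"
    by (rule nn_integral_multc) measurable
  finally show ?thesis by (simp add: mult_ac)
qed

text \<open>Fubini exchanges the roles of \<open>h\<close> and \<open>f\<close>, so the square of
  the kernel is integrated over the output variable with the input variable fixed.\<close>

lemma trilinear_le_input:
  fixes h f g :: "'a::euclidean_space \<Rightarrow> ennreal"
  assumes [measurable]: "h \<in> borel_measurable borel" "f \<in> borel_measurable borel" "g \<in> borel_measurable borel"
      "case_prod K \<in> borel_measurable (borel \<Otimes>\<^sub>M borel)"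
    and K: "\<And>y. (\<integral>\<^sup>+x. (K x y)\<^sup>2 \<partial>lborel) \<le> B"
  shows "(trilinear K h f g)\<^sup>2
    \<le> B * ((\<integral>\<^sup>+x. (h x)\<^sup>2 \<partial>lborel) * (\<integral>\<^sup>+x. (f x)\<^sup>2 \<partial>lborel) * (\<integral>\<^sup>+x. (g x)\<^sup>2 \<partial>lborel))"
proof -
  have "trilinear K h f g = (\<integral>\<^sup>+x. (\<integral>\<^sup>+y. h x * (K x y * (f y * g (x - y))) \<partial>lborel) \<partial>lborel)"
    unfolding trilinear_def by (intro nn_integral_cong nn_integral_cmult[symmetric]) measurable
  also have "\<dots> = (\<integral>\<^sup>+y. (\<integral>\<^sup>+x. h x * (K x y * (f y * g (x - y))) \<partial>lborel) \<partial>lborel)"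
    by (rule lborel_pair.Fubini') measurable
  also have "\<dots> = (\<integral>\<^sup>+y. f y * (\<integral>\<^sup>+x. K x y * (h x * g (x - y)) \<partial>lborel) \<partial>lborel)"
    by (subst nn_integral_cmult[symmetric]) (auto simp: mult_ac)
  also have "\<dots>\<^sup>2 \<le> (\<integral>\<^sup>+x. (f x)\<^sup>2 \<partial>lborel)
      * (B * (\<integral>\<^sup>+y. (\<integral>\<^sup>+x. (h x * g (x - y))\<^sup>2 \<partial>lborel) \<partial>lborel))"
    using K by (intro Cauchy_Schwarz_iterated) measurable
  also have "(\<integral>\<^sup>+y. (\<integral>\<^sup>+x. (h x * g (x - y))\<^sup>2 \<partial>lborel) \<partial>lborel)
      = (\<integral>\<^sup>+x. (\<integral>\<^sup>+y. (h x * g (x - y))\<^sup>2 \<partial>lborel) \<partial>lborel)"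
    by (rule lborel_pair.Fubini') measurable
  also have "\<dots> = (\<integral>\<^sup>+x. (h x)\<^sup>2 * (\<integral>\<^sup>+x. (g x)\<^sup>2 \<partial>lborel) \<partial>lborel)"
    using nn_integral_lborel_reflect[of "\<lambda>x. (g x)\<^sup>2"]
    by (simp add: power_mult_distrib nn_integral_cmult)
  also have "\<dots> = (\<integral>\<^sup>+x. (h x)\<^sup>2 \<partial>lborel) * (\<integral>\<^sup>+x. (g x)\<^sup>2 \<partial>lborel)"
    by (rule nn_integral_multc) measurable
  finally show ?thesis by (simp add: mult_ac)
qed

text \<open>Reduces the region in which the modulation of the second factor dominates to the one for
  the first factor.\<close>

lemma trilinear_swap:
  fixes h f g :: "'a::euclidean_space \<Rightarrow> ennreal"
  assumes [measurable]: "h \<in> borel_measurable borel" "f \<in> borel_measurable borel" "g \<in> borel_measurable borel"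
      "case_prod K \<in> borel_measurable (borel \<Otimes>\<^sub>M borel)"
  shows "trilinear (\<lambda>x y. K x (x - y)) h f g = trilinear K h g f"
proof -
  have "(\<integral>\<^sup>+y. K x (x - y) * (f y * g (x - y)) \<partial>lborel) = (\<integral>\<^sup>+y. K x y * (g y * f (x - y)) \<partial>lborel)" for x
    using nn_integral_lborel_reflect[of "\<lambda>y. K x y * (g y * f (x - y))" x] by (simp add: mult_ac)
  then show ?thesis by (simp add: trilinear_def)
qed

text \<open>Testing against truncations of \<open>G\<close> itself avoids assuming that \<open>G\<close> is square integrable.\<close>

lemma square_integral_le_by_duality:
  fixes G :: "'a::euclidean_space \<Rightarrow> ennreal"
  assumes G[measurable]: "G \<in> borel_measurable borel"
    and dual: "\<And>h. h \<in> borel_measurable borel \<Longrightarrow> (\<integral>\<^sup>+x. h x * G x \<partial>lborel)\<^sup>2 \<le> D * (\<integral>\<^sup>+x. (h x)\<^sup>2 \<partial>lborel)"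
  shows "(\<integral>\<^sup>+x. (G x)\<^sup>2 \<partial>lborel) \<le> D"
proof -
  define h where "h n x = min (G x) (of_nat n) * indicator (ball 0 (real n)) x" for n :: nat and x
  have [measurable]: "ball (0 :: 'a) r \<in> sets borel" for r by simp
  have [measurable]: "h n \<in> borel_measurable borel" for n unfolding h_def by measurable
  have bound: "(\<integral>\<^sup>+x. (h n x)\<^sup>2 \<partial>lborel) \<le> D" for n
  proof -
    let ?S = "\<integral>\<^sup>+x. (h n x)\<^sup>2 \<partial>lborel"
    have "?S \<le> (\<integral>\<^sup>+x. (of_nat n)\<^sup>2 * indicator (ball (0::'a) (real n)) x \<partial>lborel)"
      by (intro nn_integral_mono) (auto simp: h_def split: split_indicator intro!: power_mono)
    also have "\<dots> = (of_nat n)\<^sup>2 * emeasure lborel (ball (0::'a) (real n))"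
      by (rule nn_integral_cmult_indicator) auto
    also have "\<dots> < \<infinity>"
      using emeasure_bounded_finite[OF bounded_ball, of "0::'a" "real n"]
      by (auto simp: ennreal_mult_less_top power_less_top_ennreal of_nat_less_top)
    finally have fin: "?S < \<infinity>" .
    have "?S \<le> (\<integral>\<^sup>+x. h n x * G x \<partial>lborel)"
      by (intro nn_integral_mono)
        (auto simp: h_def power2_eq_square split: split_indicator intro!: mult_left_mono)
    then have "?S\<^sup>2 \<le> (\<integral>\<^sup>+x. h n x * G x \<partial>lborel)\<^sup>2" by (intro power_mono) auto
    also have "\<dots> \<le> D * ?S" by (rule dual) measurable
    finally have le: "?S * ?S \<le> D * ?S" by (simp add: power2_eq_square)
    \<comment> \<open>Cancelling \<open>?S\<close> in the extended reals needs it to be finite and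
      nonzero; finiteness is what the truncation secures.\<close>
    show "?S \<le> D"
    proof (cases "?S = 0")
      case False
      then show ?thesis using le fin
        by (metis ennreal_mult_le_mult_iff infinity_ennreal_def less_irrefl mult.commute)
    qed simp
  qed
  have lim: "(SUP n. (h n x)\<^sup>2) = (G x)\<^sup>2" for x
  proof (rule antisym)
    show "(SUP n. (h n x)\<^sup>2) \<le> (G x)\<^sup>2"
      by (intro SUP_least) (auto simp: h_def split: split_indicator intro!: power_mono)
    obtain N where N: "norm x < real N" using reals_Archimedean2 by blast
    show "(G x)\<^sup>2 \<le> (SUP n. (h n x)\<^sup>2)"
    proof (cases "G x = \<infinity>")
      case False
      then obtain M where M: "G x \<le> of_nat M"
        by (metis ennreal_of_nat_eq_real_of_nat ennreal_cases ennreal_leI infinity_ennreal_def real_arch_simple)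
      have "h (max M N) x = G x"
        using M N by (auto simp: h_def min_def of_nat_max not_le intro: antisym order_trans)
      then show ?thesis by (metis SUP_upper UNIV_I)
    next
      case True
      have "of_nat k \<le> (SUP n. (h n x)\<^sup>2)" for k
      proof -
        have "h (max (Suc k) N) x = of_nat (max (Suc k) N)"
          using N True by (simp add: h_def min_absorb2 del: of_nat_Suc)
        moreover have "(of_nat k :: ennreal) \<le> (of_nat (max (Suc k) N))\<^sup>2"
        proof -
          have "k \<le> (max (Suc k) N)\<^sup>2"
            by (metis le_SucI max.cobounded1 le_trans power2_nat_le_imp_le self_le_power le_0_eq not_less_eq_eq
                nat_le_linear pos2 zero_less_Suc less_eq_Suc_le)
          then show ?thesis by (metis of_nat_le_iff of_nat_power)
        qed
        ultimately show ?thesis by (intro SUP_upper2[of "max (Suc k) N"]) auto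
      qed
      then have "(SUP n. (h n x)\<^sup>2) = \<infinity>"
        by (metis ennreal_SUP_of_nat_eq_top SUP_least infinity_ennreal_def top.extremum_unique)
      then show ?thesis by (metis infinity_ennreal_def top_greatest)
    qed
  qed
  have "incseq (\<lambda>n x. (h n x)\<^sup>2)"
    unfolding incseq_def le_fun_def h_def
    by (auto split: split_indicator intro!: power_mono min.mono)
  then have "(\<integral>\<^sup>+x. (SUP n. (h n x)\<^sup>2) \<partial>lborel) = (SUP n. \<integral>\<^sup>+x. (h n x)\<^sup>2 \<partial>lborel)"
    by (intro nn_integral_monotone_convergence_SUP) auto
  then show ?thesis using bound by (auto simp: lim intro!: SUP_least)
qed


text \<open>For the Borel sets of the product type, on which \<open>lborel\<close> on the plane
  lives, rather than for the product of two sigma-algebras.\<close>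

lemma borel_measurable_fst [measurable (raw)]:
  fixes f :: "'c \<Rightarrow> 'a::second_countable_topology \<times> 'b::second_countable_topology"
  shows "f \<in> borel_measurable M \<Longrightarrow> (\<lambda>x. fst (f x)) \<in> borel_measurable M"
  by (rule measurable_compose[OF _ borel_measurable_continuous_onI]) (auto intro: continuous_intros)

lemma borel_measurable_snd [measurable (raw)]:
  fixes f :: "'c \<Rightarrow> 'a::second_countable_topology \<times> 'b::second_countable_topology"
  shows "f \<in> borel_measurable M \<Longrightarrow> (\<lambda>x. snd (f x)) \<in> borel_measurable M"
  by (rule measurable_compose[OF _ borel_measurable_continuous_onI]) (auto intro: continuous_intros)

lemma nn_integral_lborel_plane:
  fixes f :: "real \<times> real \<Rightarrow> ennreal"
  assumes [measurable]: "f \<in> borel_measurable borel"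
  shows "(\<integral>\<^sup>+z. f z \<partial>lborel) = (\<integral>\<^sup>+x. (\<integral>\<^sup>+t. f (x, t) \<partial>lborel) \<partial>lborel)"
  by (subst lborel_prod[symmetric], subst lborel.nn_integral_fst) (simp_all add: lborel_prod)

section \<open>Integration in the modulation variables\<close>

definition md :: "real \<times> real \<Rightarrow> real" where
  "md \<zeta> = snd \<zeta> + (fst \<zeta>)\<^sup>2"

lemma md_diff:
  "md \<zeta> = md \<eta> + md (\<zeta> - \<eta>) + 2 * (fst \<eta> * (fst \<zeta> - fst \<eta>))"
  by (simp add: md_def power2_eq_square algebra_simps)

lemma measurable_md [measurable]: "md \<in> borel_measurable borel"
  unfolding md_def by measurable

lemma measurable_br [measurable]: "br \<in> borel_measurable borel"
  unfolding br_def by measurable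

context exponents
begin

lemma measurable_w [measurable]: "w \<in> borel_measurable borel"
  unfolding w_def by measurable

definition I :: ennreal where
  "I = (\<integral>\<^sup>+y. w y \<partial>lborel)"

lemma I_finite: "I < \<infinity>"
proof -
  have "- (1 + \<theta>) = - 1 - \<theta>" by simp
  then show ?thesis
    using nn_integral_decay_finite[of "1 + \<theta>"] \<theta>_pos by (simp only: I_def w_def)
qed

lemma nn_integral_w_shift: "(\<integral>\<^sup>+y. w (y - c) \<partial>lborel) = I" "(\<integral>\<^sup>+y. w (y + c) \<partial>lborel) = I"
    "(\<integral>\<^sup>+y. w (c + y) \<partial>lborel) = I"
  using nn_integral_lborel_shift[of "\<lambda>y. ennreal (w y)" c] nn_integral_lborel_shift[of "\<lambda>y. ennreal (w y)" "- c"]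
  by (simp_all add: I_def add.commute)

lemma nn_integral_w_reflect: "(\<integral>\<^sup>+y. w (c - y) \<partial>lborel) = I"
  using nn_integral_lborel_reflect[of "\<lambda>y. ennreal (w y)" c] by (simp add: I_def)

lemma nn_integral_w_affine: "(\<integral>\<^sup>+y. \<bar>k\<bar> * w (c + k * y) \<partial>lborel) \<le> I"
proof (cases "k = 0")
  case False
  then have "I = ennreal \<bar>k\<bar> * (\<integral>\<^sup>+y. w (c + k * y) \<partial>lborel)"
    using nn_integral_real_affine[of "\<lambda>y. ennreal (w y)" k c] by (simp add: I_def)
  also have "\<dots> = (\<integral>\<^sup>+y. \<bar>k\<bar> * w (c + k * y) \<partial>lborel)"
    by (subst nn_integral_cmult[symmetric]) (auto simp: ennreal_mult)
  finally show ?thesis by simp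
qed simp

text \<open>Since x^2 + (z - x)^2 = ((2 x - z)^2 + z^2) / 2, the variable 2 x - z reduces this to
  \<open>nn_integral_square_substitution_le\<close>, whose weight is precisely
  \<open>\<bar>2 * x - z\<bar>\<close>.\<close>

lemma nn_integral_w_parabola:
  "(\<integral>\<^sup>+x. \<bar>2 * x - z\<bar> * w (c + (x\<^sup>2 + (z - x)\<^sup>2)) \<partial>lborel) \<le> 4 * I"
proof -
  define f where "f y = ennreal (w (y / 2))" for y
  have [measurable]: "f \<in> borel_measurable borel" unfolding f_def by measurable
  have "(\<integral>\<^sup>+x. \<bar>2 * x - z\<bar> * w (c + (x\<^sup>2 + (z - x)\<^sup>2)) \<partial>lborel)
      = (\<integral>\<^sup>+x. ennreal \<bar>- z + 2 * x\<bar> * f ((- z + 2 * x)\<^sup>2 + (2 * c + z\<^sup>2)) \<partial>lborel)"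
  proof (rule nn_integral_cong)
    fix x
    have "(- z + 2 * x)\<^sup>2 + (2 * c + z\<^sup>2) = 2 * (c + (x\<^sup>2 + (z - x)\<^sup>2))"
      by (simp add: power2_eq_square algebra_simps)
    then have eq: "((- z + 2 * x)\<^sup>2 + (2 * c + z\<^sup>2)) / 2 = c + (x\<^sup>2 + (z - x)\<^sup>2)"
      by (metis nonzero_mult_div_cancel_left zero_neq_numeral)
    have "\<bar>2 * x - z\<bar> = \<bar>- z + 2 * x\<bar>" by simp
    then show "ennreal (\<bar>2 * x - z\<bar> * w (c + (x\<^sup>2 + (z - x)\<^sup>2)))
        = ennreal \<bar>- z + 2 * x\<bar> * f ((- z + 2 * x)\<^sup>2 + (2 * c + z\<^sup>2))"
      by (metis f_def eq ennreal_mult abs_ge_zero w_nonneg)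
  qed
  \<comment> \<open>The 2 is the Jacobian of the affine change of variable in the next step;
    doubling loses a harmless factor.\<close>
  also have "\<dots> \<le> 2 * (\<integral>\<^sup>+x. ennreal \<bar>- z + 2 * x\<bar> * f ((- z + 2 * x)\<^sup>2 + (2 * c + z\<^sup>2)) \<partial>lborel)"
    unfolding mult_2 by (rule add_increasing[OF zero_le order_refl])
  also have "\<dots> = (\<integral>\<^sup>+x. ennreal \<bar>x\<bar> * f (x\<^sup>2 + (2 * c + z\<^sup>2)) \<partial>lborel)"
    using nn_integral_real_affine[of "\<lambda>x. ennreal \<bar>x\<bar> * f (x\<^sup>2 + (2 * c + z\<^sup>2))" 2 "- z"] by simp
  also have "\<dots> \<le> 2 * (\<integral>\<^sup>+x. f x \<partial>lborel)"
    by (rule nn_integral_square_substitution_le) measurable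
  also have "(\<integral>\<^sup>+x. f x \<partial>lborel) = 2 * I"
    using nn_integral_real_affine[of f 2 0] by (simp add: f_def I_def)
  finally show ?thesis by (simp flip: mult.assoc)
qed

text \<open>For the regions without a usable Jacobian: at a fixed frequency each modulation is a
  translate or a reflection of the time frequency, so integrating in time first leaves only the
  integral of \<open>v\<close>.\<close>

lemma nn_integral_w_md_fst:
  assumes [measurable]: "v \<in> borel_measurable borel" and v: "(\<integral>\<^sup>+x. ennreal (v x) \<partial>lborel) \<le> I" "\<And>x. 0 \<le> v x"
  shows "(\<integral>\<^sup>+\<eta>. v (fst \<eta>) * w (md \<eta>) \<partial>lborel) \<le> I\<^sup>2"
    and "(\<integral>\<^sup>+\<eta>. v (fst \<eta>) * w (md (\<zeta> - \<eta>)) \<partial>lborel) \<le> I\<^sup>2"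
proof -
  have "(\<integral>\<^sup>+\<eta>. v (fst \<eta>) * w (md \<eta>) \<partial>lborel) = (\<integral>\<^sup>+x. (\<integral>\<^sup>+t. v x * w (t + x\<^sup>2) \<partial>lborel) \<partial>lborel)"
    by (subst nn_integral_lborel_plane) (auto simp: md_def)
  also have "\<dots> = (\<integral>\<^sup>+x. v x * I \<partial>lborel)"
    using v(2) by (simp add: ennreal_mult nn_integral_cmult nn_integral_w_shift)
  also have "\<dots> = (\<integral>\<^sup>+x. v x \<partial>lborel) * I" by (rule nn_integral_multc) measurable
  also have "\<dots> \<le> I\<^sup>2" using v(1) by (simp add: power2_eq_square mult_right_mono)
  finally show "(\<integral>\<^sup>+\<eta>. v (fst \<eta>) * w (md \<eta>) \<partial>lborel) \<le> I\<^sup>2" .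
  have "(\<integral>\<^sup>+\<eta>. v (fst \<eta>) * w (md (\<zeta> - \<eta>)) \<partial>lborel)
      = (\<integral>\<^sup>+x. (\<integral>\<^sup>+t. v x * w ((snd \<zeta> + (fst \<zeta> - x)\<^sup>2) - t) \<partial>lborel) \<partial>lborel)"
    by (subst nn_integral_lborel_plane) (auto simp: md_def algebra_simps)
  also have "\<dots> = (\<integral>\<^sup>+x. v x * I \<partial>lborel)"
    using v(2) by (simp add: ennreal_mult nn_integral_cmult nn_integral_w_reflect)
  also have "\<dots> = (\<integral>\<^sup>+x. v x \<partial>lborel) * I" by (rule nn_integral_multc) measurable
  also have "\<dots> \<le> I\<^sup>2" using v(1) by (simp add: power2_eq_square mult_right_mono)
  finally show "(\<integral>\<^sup>+\<eta>. v (fst \<eta>) * w (md (\<zeta> - \<eta>)) \<partial>lborel) \<le> I\<^sup>2" .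
qed

text \<open>The two modulations are taken as new variables; the Jacobian of this change of variables is
  the weight \<open>2 * fst \<eta> - fst \<zeta>\<close>, respectively \<open>fst \<eta>\<close>.\<close>

lemma nn_integral_modulations_output:
  "(\<integral>\<^sup>+\<eta>. \<bar>2 * fst \<eta> - fst \<zeta>\<bar> * w (md \<eta>) * w (md (\<zeta> - \<eta>)) \<partial>lborel) \<le> 4 * I\<^sup>2"
proof -
  obtain z t where \<zeta>: "\<zeta> = (z, t)" by (cases \<zeta>)
  have "(\<integral>\<^sup>+\<eta>. \<bar>2 * fst \<eta> - fst \<zeta>\<bar> * w (md \<eta>) * w (md (\<zeta> - \<eta>)) \<partial>lborel)
      = (\<integral>\<^sup>+x. (\<integral>\<^sup>+r. \<bar>2 * x - z\<bar> * w (r + x\<^sup>2) * w (t - r + (z - x)\<^sup>2) \<partial>lborel) \<partial>lborel)"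
    by (subst nn_integral_lborel_plane) (auto simp: md_def \<zeta>)
  \<comment> \<open>\<open>y\<close> is the modulation at \<open>\<eta>\<close>; with
    \<open>y\<close> fixed, the other modulation is \<open>t - y\<close> plus a parabola in
    \<open>x\<close>.\<close>
  also have "\<dots> = (\<integral>\<^sup>+x. (\<integral>\<^sup>+y. \<bar>2 * x - z\<bar> * w y * w ((t - y) + (x\<^sup>2 + (z - x)\<^sup>2)) \<partial>lborel) \<partial>lborel)"
  proof (rule nn_integral_cong)
    fix x
    show "(\<integral>\<^sup>+r. \<bar>2 * x - z\<bar> * w (r + x\<^sup>2) * w (t - r + (z - x)\<^sup>2) \<partial>lborel)
        = (\<integral>\<^sup>+y. \<bar>2 * x - z\<bar> * w y * w ((t - y) + (x\<^sup>2 + (z - x)\<^sup>2)) \<partial>lborel)"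
      using nn_integral_lborel_shift[of "\<lambda>y. ennreal (\<bar>2 * x - z\<bar> * w y * w ((t - y) + (x\<^sup>2 + (z - x)\<^sup>2)))" "- x\<^sup>2"]
      by (simp add: algebra_simps)
  qed
  also have "\<dots> = (\<integral>\<^sup>+y. (\<integral>\<^sup>+x. \<bar>2 * x - z\<bar> * w y * w ((t - y) + (x\<^sup>2 + (z - x)\<^sup>2)) \<partial>lborel) \<partial>lborel)"
    by (rule lborel_pair.Fubini') measurable
  also have "\<dots> = (\<integral>\<^sup>+y. w y * (\<integral>\<^sup>+x. \<bar>2 * x - z\<bar> * w ((t - y) + (x\<^sup>2 + (z - x)\<^sup>2)) \<partial>lborel) \<partial>lborel)"
    by (subst nn_integral_cmult[symmetric]) (auto simp: ennreal_mult[symmetric] mult_ac)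
  also have "\<dots> \<le> (\<integral>\<^sup>+y. w y * (4 * I) \<partial>lborel)"
    by (intro nn_integral_mono mult_left_mono nn_integral_w_parabola) auto
  also have "\<dots> = (\<integral>\<^sup>+y. w y \<partial>lborel) * (4 * I)"
    by (rule nn_integral_multc) measurable
  also have "\<dots> = 4 * I\<^sup>2"
    by (simp add: power2_eq_square mult_ac flip: I_def)
  finally show ?thesis .
qed

lemma nn_integral_modulations_input:
  "(\<integral>\<^sup>+\<zeta>. \<bar>fst \<eta>\<bar> * w (md \<zeta>) * w (md (\<zeta> - \<eta>)) \<partial>lborel) \<le> I\<^sup>2"
proof -
  obtain x r where \<eta>: "\<eta> = (x, r)" by (cases \<eta>)
  have "(\<integral>\<^sup>+\<zeta>. \<bar>fst \<eta>\<bar> * w (md \<zeta>) * w (md (\<zeta> - \<eta>)) \<partial>lborel)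
      = (\<integral>\<^sup>+z. (\<integral>\<^sup>+t. \<bar>x\<bar> * w (t + z\<^sup>2) * w (t - r + (z - x)\<^sup>2) \<partial>lborel) \<partial>lborel)"
    by (subst nn_integral_lborel_plane) (auto simp: md_def \<eta>)
  \<comment> \<open>\<open>y\<close> is the modulation at \<open>\<zeta>\<close>; with
    \<open>y\<close> fixed, the quadratic terms in \<open>z\<close> cancel and the other modulation
    is affine in \<open>z\<close> with slope \<open>- 2 * x\<close>.\<close>
  also have "\<dots> = (\<integral>\<^sup>+z. (\<integral>\<^sup>+y. \<bar>x\<bar> * w y * w ((y - r + x\<^sup>2) + (- 2 * x) * z) \<partial>lborel) \<partial>lborel)"
  proof (rule nn_integral_cong)
    fix z
    show "(\<integral>\<^sup>+t. \<bar>x\<bar> * w (t + z\<^sup>2) * w (t - r + (z - x)\<^sup>2) \<partial>lborel)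
        = (\<integral>\<^sup>+y. \<bar>x\<bar> * w y * w ((y - r + x\<^sup>2) + (- 2 * x) * z) \<partial>lborel)"
      using nn_integral_lborel_shift[of "\<lambda>y. ennreal (\<bar>x\<bar> * w y * w ((y - r + x\<^sup>2) + (- 2 * x) * z))" "- z\<^sup>2"]
      by (simp add: power2_eq_square algebra_simps)
  qed
  also have "\<dots> = (\<integral>\<^sup>+y. (\<integral>\<^sup>+z. \<bar>x\<bar> * w y * w ((y - r + x\<^sup>2) + (- 2 * x) * z) \<partial>lborel) \<partial>lborel)"
    by (rule lborel_pair.Fubini') measurable
  also have "\<dots> = (\<integral>\<^sup>+y. w y * (\<integral>\<^sup>+z. \<bar>x\<bar> * w ((y - r + x\<^sup>2) + (- 2 * x) * z) \<partial>lborel) \<partial>lborel)"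
    by (subst nn_integral_cmult[symmetric]) (auto simp: ennreal_mult[symmetric] mult_ac)
  also have "\<dots> \<le> (\<integral>\<^sup>+y. w y * (\<integral>\<^sup>+z. \<bar>- 2 * x\<bar> * w ((y - r + x\<^sup>2) + (- 2 * x) * z) \<partial>lborel) \<partial>lborel)"
    by (intro nn_integral_mono mult_left_mono ennreal_leI mult_right_mono) auto
  also have "\<dots> \<le> (\<integral>\<^sup>+y. w y * I \<partial>lborel)"
    by (intro nn_integral_mono mult_left_mono nn_integral_w_affine) auto
  also have "\<dots> = I\<^sup>2"
    by (simp add: nn_integral_multc power2_eq_square flip: I_def)
  finally show ?thesis .
qed

text \<open>Up to a constant, \<open>sqrt weight_sq\<close> dominates both \<open>\<langle>\<xi>\<rangle>\<^sup>-\<^sup>\<rho>\<close> and \<open>\<langle>\<tau>\<rangle>\<^sup>-\<^sup>\<rho>\<^sup>/\<^sup>2\<close>, so a single kernel serves both norms.\<close>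

definition weight_sq :: "real \<times> real \<Rightarrow> real" where
  "weight_sq \<zeta> = (if \<bar>snd \<zeta>\<bar> \<le> (fst \<zeta>)\<^sup>2 / 4 then 1 else br (fst \<zeta>) powr (- 2 * \<rho>))"

lemma admissible_weight_sq: "admissible (weight_sq \<zeta>) (fst \<zeta>) (snd \<zeta>)"
  using \<rho>_pos powr_mono[of "- 2 * \<rho>" 0 "br (fst \<zeta>)"] by (auto simp: admissible_def weight_sq_def)

lemma weight_sq_nonneg [simp]: "0 \<le> weight_sq \<zeta>"
  using admissible_weight_sq[of \<zeta>] by (simp add: admissible_def)

lemma measurable_weight_sq [measurable]: "weight_sq \<in> borel_measurable borel"
  unfolding weight_sq_def by measurable

text \<open>The multiplier that remains when the output weight is included and the input weights are
  divided out of the two transforms. It is a square root because the Cauchy-Schwarz estimates ask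
  for integrals of its square.\<close>

definition kernel :: "real \<times> real \<Rightarrow> real \<times> real \<Rightarrow> real" where
  "kernel \<zeta> \<eta> = sqrt (ker_sq (weight_sq \<zeta>) (fst \<eta>) (fst (\<zeta> - \<eta>)) (md \<zeta>) (md \<eta>) (md (\<zeta> - \<eta>)))"

lemma ker_sq_nonneg: "0 \<le> W \<Longrightarrow> 0 \<le> ker_sq W x y l p q"
  by (simp add: ker_sq_def)

lemma kernel_power2:
  "(kernel \<zeta> \<eta>)\<^sup>2 = ker_sq (weight_sq \<zeta>) (fst \<eta>) (fst (\<zeta> - \<eta>)) (md \<zeta>) (md \<eta>) (md (\<zeta> - \<eta>))"
  by (simp add: kernel_def ker_sq_nonneg)

lemma kernel_nonneg [simp]: "0 \<le> kernel \<zeta> \<eta>"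
  by (simp add: kernel_def ker_sq_nonneg)

lemma kernel_reflect: "kernel \<zeta> (\<zeta> - \<eta>) = kernel \<zeta> \<eta>"
  unfolding kernel_def by (subst ker_sq_commute) simp

lemma measurable_kernel [measurable]: "case_prod kernel \<in> borel_measurable (borel \<Otimes>\<^sub>M borel)"
  unfolding kernel_def ker_sq_def by measurable

text \<open>Dominance of the factor at \<open>\<eta>\<close>. Replacing \<open>\<eta>\<close> by
  \<open>\<zeta> - \<eta>\<close> gives the region for the other factor, and
  \<open>kernel_reflect\<close> carries the estimate over.\<close>

definition input_region :: "real \<times> real \<Rightarrow> real \<times> real \<Rightarrow> bool" where
  "input_region \<zeta> \<eta> \<longleftrightarrow> 1 \<le> \<bar>fst \<eta>\<bar> \<and> 1 \<le> \<bar>fst (\<zeta> - \<eta>)\<bar> \<and>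
     \<bar>md \<zeta>\<bar> \<le> \<bar>md \<eta>\<bar> \<and> \<bar>md (\<zeta> - \<eta>)\<bar> \<le> \<bar>md \<eta>\<bar>"

text \<open>Low frequencies are put here whatever the modulations are:
  \<open>low_frequency_bound\<close> produces factors that are integrable in
  \<open>\<eta>\<close>.\<close>

definition output_region :: "real \<times> real \<Rightarrow> real \<times> real \<Rightarrow> bool" where
  "output_region \<zeta> \<eta> \<longleftrightarrow> \<bar>fst \<eta>\<bar> \<le> 1 \<or> \<bar>fst (\<zeta> - \<eta>)\<bar> \<le> 1 \<or>
     \<bar>md \<eta>\<bar> \<le> \<bar>md \<zeta>\<bar> \<and> \<bar>md (\<zeta> - \<eta>)\<bar> \<le> \<bar>md \<zeta>\<bar>"

lemma region_cases: "output_region \<zeta> \<eta> \<or> input_region \<zeta> \<eta> \<or> input_region \<zeta> (\<zeta> - \<eta>)"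
  unfolding output_region_def input_region_def by (simp add: not_le) linarith

lemma kernel_input_pointwise:
  obtains C where "0 \<le> C" "\<And>\<zeta> \<eta>. input_region \<zeta> \<eta> \<Longrightarrow> (kernel \<zeta> \<eta>)\<^sup>2
    \<le> C * (w (fst (\<zeta> - \<eta>)) * w (md (\<zeta> - \<eta>)) + \<bar>fst \<eta>\<bar> * w (md \<zeta>) * w (md (\<zeta> - \<eta>)))"
proof
  let ?C = "3 * 8 powr \<kappa> + 2 powr (2 * \<rho>) * 8 powr \<kappa> + 11 powr (\<kappa> + 1 + \<theta>)"
  show "0 \<le> ?C" by simp
  fix \<zeta> \<eta> assume r: "input_region \<zeta> \<eta>"
  have f: "fst \<eta> + fst (\<zeta> - \<eta>) = fst \<zeta>" by simp
  show "(kernel \<zeta> \<eta>)\<^sup>2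
      \<le> ?C * (w (fst (\<zeta> - \<eta>)) * w (md (\<zeta> - \<eta>)) + \<bar>fst \<eta>\<bar> * w (md \<zeta>) * w (md (\<zeta> - \<eta>)))"
    unfolding kernel_power2
  proof (rule input_region_bound[of _ _ _ "snd \<zeta>"], unfold f)
    show "admissible (weight_sq \<zeta>) (fst \<zeta>) (snd \<zeta>)" by (rule admissible_weight_sq)
    show "md \<zeta> = snd \<zeta> + (fst \<zeta>)\<^sup>2" by (rule md_def)
    show "md \<zeta> = md \<eta> + md (\<zeta> - \<eta>) + 2 * (fst \<eta> * fst (\<zeta> - \<eta>))"
      using md_diff[of \<zeta> \<eta>] by simp
  qed (use r in \<open>auto simp: input_region_def\<close>)
qed

text \<open>The three frequency factors serve the regions without a Jacobian: the first two serve
  low input frequencies and low time frequency, the third the strip around the zero of the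
  Jacobian.\<close>

lemma kernel_output_pointwise:
  obtains C where "0 \<le> C" "\<And>\<zeta> \<eta>. output_region \<zeta> \<eta> \<Longrightarrow> (kernel \<zeta> \<eta>)\<^sup>2
    \<le> C * ((w (fst \<eta>) + w (fst \<zeta> - fst \<eta>) + w (2 * fst \<eta> - fst \<zeta>)) * (w (md \<eta>) + w (md (\<zeta> - \<eta>)))
      + \<bar>2 * fst \<eta> - fst \<zeta>\<bar> * w (md \<eta>) * w (md (\<zeta> - \<eta>)))"
proof
  let ?C1 = "(2 powr (2 * \<rho>) * (2 powr (2 * \<rho>) + 8 powr (2 * a))) * 2 powr (1 + \<theta>)"
  let ?C2 = "8 powr \<kappa>"
  let ?C3 = "2 powr (2 * \<rho>) * (8 powr \<kappa> + 8 powr (2 * a) * 2 powr (1 + \<theta>))"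
  let ?C4 = "4 powr (2 * \<rho>) * 10 powr (2 * b) * 6 powr ((1 + \<theta>) / 2)"
  let ?C = "?C1 + ?C2 + ?C3 + ?C4"
  have C: "0 \<le> ?C1" "0 \<le> ?C2" "0 \<le> ?C3" "0 \<le> ?C4" by auto
  then show "0 \<le> ?C" by linarith
  fix \<zeta> \<eta> assume r: "output_region \<zeta> \<eta>"
  define x y where "x = fst \<eta>" and "y = fst (\<zeta> - \<eta>)"
  define l p q where "l = md \<zeta>" and "p = md \<eta>" and "q = md (\<zeta> - \<eta>)"
  define W t where "W = weight_sq \<zeta>" and "t = snd \<zeta>"
  have fst_\<zeta>: "fst \<zeta> = x + y" by (simp add: x_def y_def)
  have W: "admissible W (x + y) t"
    using admissible_weight_sq[of \<zeta>] by (simp add: W_def t_def fst_\<zeta>)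
  then have W0: "0 \<le> W" "W \<le> 1" by (auto simp: admissible_def)
  have l: "l = t + (x + y)\<^sup>2" by (simp add: l_def t_def md_def fst_\<zeta>)
  have l': "l = p + q + 2 * (x * y)"
    using md_diff[of \<zeta> \<eta>] by (simp add: l_def p_def q_def x_def y_def)
  let ?R = "(w x + w y + w (x - y)) * (w p + w q) + \<bar>x - y\<bar> * w p * w q"
  have R: "\<bar>x - y\<bar> * w p * w q \<le> ?R" "w (x - y) * (w p + w q) + \<bar>x - y\<bar> * w p * w q \<le> ?R"
      "(w x + w y) * (w p + w q) \<le> ?R" "w x * (w p + w q) \<le> ?R" "w y * (w p + w q) \<le> ?R"
    by (auto simp: algebra_simps intro!: add_nonneg_nonneg)
  \<comment> \<open>Each region supplies its own constant \<open>D\<close> and its own part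
    \<open>S\<close> of the right-hand side.\<close>
  have step: "ker_sq W x y l p q \<le> ?C * ?R" if "ker_sq W x y l p q \<le> D * S" "D \<le> ?C" "S \<le> ?R" "0 \<le> S" for D S
    using that(1) mult_mono[OF that(2,3) _ that(4)] C by linarith
  have "ker_sq W x y l p q \<le> ?C * ?R"
  proof (cases "\<bar>x\<bar> \<le> 1 \<or> \<bar>y\<bar> \<le> 1")
    case True
    have "ker_sq W x y l p q \<le> ?C1 * (w y * (w p + w q))" if "\<bar>y\<bar> \<le> 1"
      using W that l by (rule low_frequency_bound)
    moreover have "ker_sq W y x l q p \<le> ?C1 * (w x * (w q + w p))" if "\<bar>x\<bar> \<le> 1"
      using W that l by (intro low_frequency_bound[of _ _ _ t]) (simp_all add: add.commute)
    ultimately show ?thesis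
      using True step[of ?C1 "w y * (w p + w q)"] step[of ?C1 "w x * (w p + w q)"] R C
      by (auto simp: ker_sq_commute[of W y x] add.commute[of "w q"])
  next
    case False
    then have x: "1 \<le> \<bar>x\<bar>" and y: "1 \<le> \<bar>y\<bar>" by auto
    have p: "\<bar>p\<bar> \<le> \<bar>l\<bar>" and q: "\<bar>q\<bar> \<le> \<bar>l\<bar>"
      using r False by (auto simp: output_region_def x_def y_def l_def p_def q_def)
    consider "2 * \<bar>x + y\<bar> \<le> \<bar>x - y\<bar>" | "\<bar>x - y\<bar> \<le> 2 * \<bar>x + y\<bar>" "W = br (x + y) powr (- 2 * \<rho>)"
      | "\<bar>x - y\<bar> \<le> 2 * \<bar>x + y\<bar>" "\<bar>t\<bar> \<le> (x + y)\<^sup>2 / 4"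
      using W unfolding admissible_def by (meson nle_le)
    then show ?thesis
    proof cases
      case 1
      show ?thesis
        by (rule step[OF output_region_noncomparable[OF W x y p q l' 1]]) (use R C in auto)
    next
      case 2
      show ?thesis
        by (rule step[OF output_region_comparable[OF 2(2) x y p q l']]) (use R C 2 in auto)
    next
      case 3
      show ?thesis
        by (rule step[OF output_region_low_time[OF W0 3(2) l p q l' x y 3(1)]]) (use R C in auto)
    qed
  qed
  moreover have "fst \<zeta> - fst \<eta> = y" "2 * fst \<eta> - fst \<zeta> = x - y"
    by (simp_all add: x_def y_def)
  ultimately show "(kernel \<zeta> \<eta>)\<^sup>2
    \<le> ?C * ((w (fst \<eta>) + w (fst \<zeta> - fst \<eta>) + w (2 * fst \<eta> - fst \<zeta>)) * (w (md \<eta>) + w (md (\<zeta> - \<eta>)))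
      + \<bar>2 * fst \<eta> - fst \<zeta>\<bar> * w (md \<eta>) * w (md (\<zeta> - \<eta>)))"
    by (simp only: kernel_power2 flip: x_def y_def l_def p_def q_def W_def)
qed

lemma measurable_input_region [measurable]:
  "Measurable.pred (borel \<Otimes>\<^sub>M borel) (case_prod input_region)"
  unfolding input_region_def by measurable

lemma measurable_output_region [measurable]:
  "Measurable.pred (borel \<Otimes>\<^sub>M borel) (case_prod output_region)"
  unfolding output_region_def by measurable

lemma kernel_output_integral:
  obtains B where "B < \<infinity>"
    "\<And>\<zeta>. (\<integral>\<^sup>+\<eta>. (ennreal (if output_region \<zeta> \<eta> then kernel \<zeta> \<eta> else 0))\<^sup>2 \<partial>lborel) \<le> B"
proof -
  obtain C where C: "0 \<le> C" and le: "\<And>\<zeta> \<eta>. output_region \<zeta> \<eta> \<Longrightarrow> (kernel \<zeta> \<eta>)\<^sup>2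
    \<le> C * ((w (fst \<eta>) + w (fst \<zeta> - fst \<eta>) + w (2 * fst \<eta> - fst \<zeta>)) * (w (md \<eta>) + w (md (\<zeta> - \<eta>)))
      + \<bar>2 * fst \<eta> - fst \<zeta>\<bar> * w (md \<eta>) * w (md (\<zeta> - \<eta>)))"
    using kernel_output_pointwise by blast
  show ?thesis
  proof
    show "ennreal C * (I\<^sup>2 + I\<^sup>2 + (I\<^sup>2 + I\<^sup>2) + (I\<^sup>2 + I\<^sup>2) + 4 * I\<^sup>2) < \<infinity>"
      using I_finite by (simp add: ennreal_mult_less_top power2_eq_square)
    fix \<zeta> :: "real \<times> real"
    let ?J = "\<integral>\<^sup>+\<eta>. (ennreal (if output_region \<zeta> \<eta> then kernel \<zeta> \<eta> else 0))\<^sup>2 \<partial>lborel"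
    \<comment> \<open>\<open>P v\<close> pairs one frequency factor with each of the two input
      modulations; it is used for the three factors \<open>v\<^sub>1\<close>,
      \<open>v\<^sub>2\<close>, \<open>v\<^sub>3\<close>.\<close>
    define P where "P v \<eta> = ennreal (v (fst \<eta>) * w (md \<eta>)) + ennreal (v (fst \<eta>) * w (md (\<zeta> - \<eta>)))"
      for v :: "real \<Rightarrow> real" and \<eta>
    have P: "(\<integral>\<^sup>+\<eta>. P v \<eta> \<partial>lborel) \<le> I\<^sup>2 + I\<^sup>2"
      if [measurable]: "v \<in> borel_measurable borel" and v: "(\<integral>\<^sup>+x. ennreal (v x) \<partial>lborel) \<le> I" "\<And>x. 0 \<le> v x" for v
    proof -
      have "(\<integral>\<^sup>+\<eta>. P v \<eta> \<partial>lborel)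
          = (\<integral>\<^sup>+\<eta>. v (fst \<eta>) * w (md \<eta>) \<partial>lborel) + (\<integral>\<^sup>+\<eta>. v (fst \<eta>) * w (md (\<zeta> - \<eta>)) \<partial>lborel)"
        unfolding P_def by (rule nn_integral_add) measurable
      also have "\<dots> \<le> I\<^sup>2 + I\<^sup>2"
        by (intro add_mono nn_integral_w_md_fst that)
      finally show ?thesis .
    qed
    have meas_P [measurable]: "P v \<in> borel_measurable borel"
      if [measurable]: "v \<in> borel_measurable borel" for v
      unfolding P_def by measurable
    define v\<^sub>1 v\<^sub>2 v\<^sub>3 where "v\<^sub>1 x = w x" and "v\<^sub>2 x = w (fst \<zeta> - x)" and "v\<^sub>3 x = w (2 * x - fst \<zeta>)" for x
    have [measurable]: "v\<^sub>1 \<in> borel_measurable borel" "v\<^sub>2 \<in> borel_measurable borel" "v\<^sub>3 \<in> borel_measurable borel"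
      unfolding v\<^sub>1_def v\<^sub>2_def v\<^sub>3_def by measurable
    have v_nonneg: "0 \<le> v\<^sub>1 x" "0 \<le> v\<^sub>2 x" "0 \<le> v\<^sub>3 x" for x by (auto simp: v\<^sub>1_def v\<^sub>2_def v\<^sub>3_def)
    have I1: "(\<integral>\<^sup>+x. v\<^sub>1 x \<partial>lborel) \<le> I" by (simp add: v\<^sub>1_def I_def)
    have I2: "(\<integral>\<^sup>+x. v\<^sub>2 x \<partial>lborel) \<le> I" by (simp add: v\<^sub>2_def nn_integral_w_reflect)
    have "(\<integral>\<^sup>+x. v\<^sub>3 x \<partial>lborel) \<le> (\<integral>\<^sup>+x. \<bar>2\<bar> * w (- fst \<zeta> + 2 * x) \<partial>lborel)"
      by (intro nn_integral_mono ennreal_leI) (simp add: v\<^sub>3_def)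
    then have I3: "(\<integral>\<^sup>+x. v\<^sub>3 x \<partial>lborel) \<le> I" using nn_integral_w_affine[of 2 "- fst \<zeta>"] by (rule order_trans)
    define J where "J \<eta> = ennreal (\<bar>2 * fst \<eta> - fst \<zeta>\<bar> * w (md \<eta>) * w (md (\<zeta> - \<eta>)))" for \<eta>
    have [measurable]: "J \<in> borel_measurable borel" unfolding J_def by measurable
    have "?J
        \<le> (\<integral>\<^sup>+\<eta>. ennreal C * (P v\<^sub>1 \<eta> + P v\<^sub>2 \<eta> + P v\<^sub>3 \<eta> + J \<eta>) \<partial>lborel)"
    proof (rule nn_integral_mono)
      fix \<eta>
      have eq: "P v\<^sub>1 \<eta> + P v\<^sub>2 \<eta> + P v\<^sub>3 \<eta> + J \<eta> = ennreal
          ((w (fst \<eta>) + w (fst \<zeta> - fst \<eta>) + w (2 * fst \<eta> - fst \<zeta>)) * (w (md \<eta>) + w (md (\<zeta> - \<eta>)))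
            + \<bar>2 * fst \<eta> - fst \<zeta>\<bar> * w (md \<eta>) * w (md (\<zeta> - \<eta>)))"
        unfolding P_def J_def v\<^sub>1_def v\<^sub>2_def v\<^sub>3_def
        by (simp add: algebra_simps flip: ennreal_plus)
      show "(ennreal (if output_region \<zeta> \<eta> then kernel \<zeta> \<eta> else 0))\<^sup>2
          \<le> ennreal C * (P v\<^sub>1 \<eta> + P v\<^sub>2 \<eta> + P v\<^sub>3 \<eta> + J \<eta>)"
        unfolding eq ennreal_mult'[OF C, symmetric]
        using le[of \<zeta> \<eta>] by (cases "output_region \<zeta> \<eta>") (simp_all add: ennreal_power ennreal_leI)
    qed
    also have "\<dots> = ennreal C * ((\<integral>\<^sup>+\<eta>. P v\<^sub>1 \<eta> \<partial>lborel) + (\<integral>\<^sup>+\<eta>. P v\<^sub>2 \<eta> \<partial>lborel)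
        + (\<integral>\<^sup>+\<eta>. P v\<^sub>3 \<eta> \<partial>lborel) + (\<integral>\<^sup>+\<eta>. J \<eta> \<partial>lborel))"
      by (simp add: nn_integral_cmult nn_integral_add)
    also have "\<dots> \<le> ennreal C * (I\<^sup>2 + I\<^sup>2 + (I\<^sup>2 + I\<^sup>2) + (I\<^sup>2 + I\<^sup>2) + 4 * I\<^sup>2)"
      using nn_integral_modulations_output[of \<zeta>] v_nonneg I1 I2 I3 unfolding J_def
      by (intro mult_left_mono add_mono[OF add_mono[OF add_mono]] P) auto
    finally show "?J
        \<le> ennreal C * (I\<^sup>2 + I\<^sup>2 + (I\<^sup>2 + I\<^sup>2) + (I\<^sup>2 + I\<^sup>2) + 4 * I\<^sup>2)" .
  qed
qed

lemma kernel_input_integral: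
  obtains B where "B < \<infinity>"
    "\<And>\<eta>. (\<integral>\<^sup>+\<zeta>. (ennreal (if input_region \<zeta> \<eta> then kernel \<zeta> \<eta> else 0))\<^sup>2 \<partial>lborel) \<le> B"
proof -
  obtain C where C: "0 \<le> C" and le: "\<And>\<zeta> \<eta>. input_region \<zeta> \<eta> \<Longrightarrow> (kernel \<zeta> \<eta>)\<^sup>2
    \<le> C * (w (fst (\<zeta> - \<eta>)) * w (md (\<zeta> - \<eta>)) + \<bar>fst \<eta>\<bar> * w (md \<zeta>) * w (md (\<zeta> - \<eta>)))"
    using kernel_input_pointwise by blast
  show ?thesis
  proof
    show "ennreal C * (I\<^sup>2 + I\<^sup>2) < \<infinity>"
      using I_finite by (simp add: ennreal_mult_less_top power2_eq_square)
    fix \<eta> :: "real \<times> real"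
    let ?J = "\<integral>\<^sup>+\<zeta>. (ennreal (if input_region \<zeta> \<eta> then kernel \<zeta> \<eta> else 0))\<^sup>2 \<partial>lborel"
    have "?J
        \<le> (\<integral>\<^sup>+\<zeta>. ennreal C * (ennreal (w (fst (\<zeta> - \<eta>)) * w (md (\<zeta> - \<eta>)))
          + ennreal (\<bar>fst \<eta>\<bar> * w (md \<zeta>) * w (md (\<zeta> - \<eta>)))) \<partial>lborel)"
    proof (rule nn_integral_mono)
      fix \<zeta>
      show "(ennreal (if input_region \<zeta> \<eta> then kernel \<zeta> \<eta> else 0))\<^sup>2
          \<le> ennreal C * (ennreal (w (fst (\<zeta> - \<eta>)) * w (md (\<zeta> - \<eta>)))
          + ennreal (\<bar>fst \<eta>\<bar> * w (md \<zeta>) * w (md (\<zeta> - \<eta>))))"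
        using le[of \<zeta> \<eta>] C
        by (auto simp: ennreal_power simp flip: ennreal_mult' ennreal_plus intro!: ennreal_leI)
    qed
    also have "\<dots> = ennreal C * ((\<integral>\<^sup>+\<zeta>. w (fst (\<zeta> - \<eta>)) * w (md (\<zeta> - \<eta>)) \<partial>lborel)
        + (\<integral>\<^sup>+\<zeta>. \<bar>fst \<eta>\<bar> * w (md \<zeta>) * w (md (\<zeta> - \<eta>)) \<partial>lborel))"
      by (simp add: nn_integral_cmult nn_integral_add del: ennreal_plus fst_diff)
    also have "(\<integral>\<^sup>+\<zeta>. w (fst (\<zeta> - \<eta>)) * w (md (\<zeta> - \<eta>)) \<partial>lborel)
        = (\<integral>\<^sup>+\<zeta>. w (fst \<zeta>) * w (md \<zeta>) \<partial>lborel)"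
      by (rule nn_integral_lborel_shift) measurable
    also have "ennreal C * (\<dots> + (\<integral>\<^sup>+\<zeta>. \<bar>fst \<eta>\<bar> * w (md \<zeta>) * w (md (\<zeta> - \<eta>)) \<partial>lborel))
        \<le> ennreal C * (I\<^sup>2 + I\<^sup>2)"
      by (intro mult_left_mono add_mono nn_integral_w_md_fst nn_integral_modulations_input) (auto simp: I_def)
    finally show "?J
        \<le> ennreal C * (I\<^sup>2 + I\<^sup>2)" .
  qed
qed

text \<open>Duality converts the square integral into a trilinear form, so that each of the three
  regions can use its own order of integration. The 9 is the square of the number of
  regions.\<close>

theorem kernel_bilinear_bound:
  obtains D :: ennreal where "D < \<infinity>" "\<And>f g :: real \<times> real \<Rightarrow> ennreal.
    f \<in> borel_measurable borel \<Longrightarrow> g \<in> borel_measurable borel \<Longrightarrow>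
    (\<integral>\<^sup>+\<zeta>. (\<integral>\<^sup>+\<eta>. kernel \<zeta> \<eta> * (f \<eta> * g (\<zeta> - \<eta>)) \<partial>lborel)\<^sup>2 \<partial>lborel)
      \<le> D * ((\<integral>\<^sup>+\<zeta>. (f \<zeta>)\<^sup>2 \<partial>lborel) * (\<integral>\<^sup>+\<zeta>. (g \<zeta>)\<^sup>2 \<partial>lborel))"
proof -
  define K\<^sub>1 where "K\<^sub>1 \<zeta> \<eta> = ennreal (if output_region \<zeta> \<eta> then kernel \<zeta> \<eta> else 0)" for \<zeta> \<eta>
  define K\<^sub>2 where "K\<^sub>2 \<zeta> \<eta> = ennreal (if input_region \<zeta> \<eta> then kernel \<zeta> \<eta> else 0)" for \<zeta> \<eta>
  have [measurable]: "case_prod K\<^sub>1 \<in> borel_measurable (borel \<Otimes>\<^sub>M borel)"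
      "case_prod K\<^sub>2 \<in> borel_measurable (borel \<Otimes>\<^sub>M borel)"
    unfolding K\<^sub>1_def K\<^sub>2_def by measurable
  obtain B\<^sub>1 where B\<^sub>1: "B\<^sub>1 < \<infinity>" "\<And>\<zeta>. (\<integral>\<^sup>+\<eta>. (K\<^sub>1 \<zeta> \<eta>)\<^sup>2 \<partial>lborel) \<le> B\<^sub>1"
    unfolding K\<^sub>1_def using kernel_output_integral by blast
  obtain B\<^sub>2 where B\<^sub>2: "B\<^sub>2 < \<infinity>" "\<And>\<eta>. (\<integral>\<^sup>+\<zeta>. (K\<^sub>2 \<zeta> \<eta>)\<^sup>2 \<partial>lborel) \<le> B\<^sub>2"
    unfolding K\<^sub>2_def using kernel_input_integral by blast
  show ?thesis
  proof
    show "9 * (B\<^sub>1 + B\<^sub>2) < \<infinity>" using B\<^sub>1 B\<^sub>2 by (simp add: ennreal_mult_less_top)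
    fix f g :: "real \<times> real \<Rightarrow> ennreal"
    assume [measurable]: "f \<in> borel_measurable borel" "g \<in> borel_measurable borel"
    let ?F = "\<integral>\<^sup>+\<zeta>. (f \<zeta>)\<^sup>2 \<partial>lborel" and ?G = "\<integral>\<^sup>+\<zeta>. (g \<zeta>)\<^sup>2 \<partial>lborel"
    let ?D = "9 * (B\<^sub>1 + B\<^sub>2) * (?F * ?G)"
    show "(\<integral>\<^sup>+\<zeta>. (\<integral>\<^sup>+\<eta>. kernel \<zeta> \<eta> * (f \<eta> * g (\<zeta> - \<eta>)) \<partial>lborel)\<^sup>2 \<partial>lborel) \<le> ?D"
    proof (rule square_integral_le_by_duality)
      show "(\<lambda>\<zeta>. \<integral>\<^sup>+\<eta>. kernel \<zeta> \<eta> * (f \<eta> * g (\<zeta> - \<eta>)) \<partial>lborel) \<in> borel_measurable borel"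
        by measurable
      fix h :: "real \<times> real \<Rightarrow> ennreal"
      assume [measurable]: "h \<in> borel_measurable borel"
      let ?T = "\<integral>\<^sup>+\<zeta>. h \<zeta> * (\<integral>\<^sup>+\<eta>. kernel \<zeta> \<eta> * (f \<eta> * g (\<zeta> - \<eta>)) \<partial>lborel) \<partial>lborel"
      let ?I = "\<lambda>K \<zeta>. \<integral>\<^sup>+\<eta>. K \<zeta> \<eta> * (f \<eta> * g (\<zeta> - \<eta>)) \<partial>lborel"
        and ?K\<^sub>3 = "\<lambda>\<zeta> \<eta>. K\<^sub>2 \<zeta> (\<zeta> - \<eta>)"
      let ?H = "\<integral>\<^sup>+\<zeta>. (h \<zeta>)\<^sup>2 \<partial>lborel"
      let ?E = "(B\<^sub>1 + B\<^sub>2) * (?H * ?F * ?G)"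
      let ?T\<^sub>1 = "trilinear K\<^sub>1 h f g" and ?T\<^sub>2 = "trilinear K\<^sub>2 h f g"
        and ?T\<^sub>3 = "trilinear (\<lambda>\<zeta> \<eta>. K\<^sub>2 \<zeta> (\<zeta> - \<eta>)) h f g"
      have "?T\<^sub>1\<^sup>2 \<le> B\<^sub>1 * (?H * ?F * ?G)"
        by (rule trilinear_le_output) (auto intro: B\<^sub>1)
      also have "\<dots> \<le> ?E" by (intro mult_right_mono) auto
      finally have T\<^sub>1: "?T\<^sub>1\<^sup>2 \<le> ?E" .
      have "?T\<^sub>2\<^sup>2 \<le> B\<^sub>2 * (?H * ?F * ?G)"
        by (rule trilinear_le_input) (auto intro: B\<^sub>2)
      also have "\<dots> \<le> ?E" by (intro mult_right_mono) auto
      finally have T\<^sub>2: "?T\<^sub>2\<^sup>2 \<le> ?E" .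
      have "?T\<^sub>3 = trilinear K\<^sub>2 h g f"
        by (rule trilinear_swap) measurable
      also have "\<dots>\<^sup>2 \<le> B\<^sub>2 * (?H * ?G * ?F)"
        by (rule trilinear_le_input) (auto intro: B\<^sub>2)
      also have "\<dots> = B\<^sub>2 * (?H * ?F * ?G)" by (simp add: mult_ac)
      also have "\<dots> \<le> ?E" by (intro mult_right_mono) auto
      finally have T\<^sub>3: "?T\<^sub>3\<^sup>2 \<le> ?E" .
      have "?T
          \<le> (\<integral>\<^sup>+\<zeta>. h \<zeta> * ?I K\<^sub>1 \<zeta>
            + h \<zeta> * ?I K\<^sub>2 \<zeta>
            + h \<zeta> * ?I ?K\<^sub>3 \<zeta> \<partial>lborel)"
      proof (rule nn_integral_mono)
        fix \<zeta>
        have "(\<integral>\<^sup>+\<eta>. kernel \<zeta> \<eta> * (f \<eta> * g (\<zeta> - \<eta>)) \<partial>lborel)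
            \<le> (\<integral>\<^sup>+\<eta>. K\<^sub>1 \<zeta> \<eta> * (f \<eta> * g (\<zeta> - \<eta>)) + K\<^sub>2 \<zeta> \<eta> * (f \<eta> * g (\<zeta> - \<eta>))
              + K\<^sub>2 \<zeta> (\<zeta> - \<eta>) * (f \<eta> * g (\<zeta> - \<eta>)) \<partial>lborel)"
        proof (rule nn_integral_mono)
          fix \<eta>
          have "ennreal (kernel \<zeta> \<eta>) \<le> K\<^sub>1 \<zeta> \<eta> + K\<^sub>2 \<zeta> \<eta> + K\<^sub>2 \<zeta> (\<zeta> - \<eta>)"
            using region_cases[of \<zeta> \<eta>] unfolding K\<^sub>1_def K\<^sub>2_def kernel_reflect
            by (auto simp: add_increasing add_increasing2)
          then show "kernel \<zeta> \<eta> * (f \<eta> * g (\<zeta> - \<eta>)) \<le> K\<^sub>1 \<zeta> \<eta> * (f \<eta> * g (\<zeta> - \<eta>))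
              + K\<^sub>2 \<zeta> \<eta> * (f \<eta> * g (\<zeta> - \<eta>)) + K\<^sub>2 \<zeta> (\<zeta> - \<eta>) * (f \<eta> * g (\<zeta> - \<eta>))"
            unfolding distrib_right[symmetric] by (intro mult_right_mono) auto
        qed
        also have "\<dots> = ?I K\<^sub>1 \<zeta>
            + ?I K\<^sub>2 \<zeta>
            + ?I ?K\<^sub>3 \<zeta>"
          by (simp add: nn_integral_add)
        finally show "h \<zeta> * (\<integral>\<^sup>+\<eta>. kernel \<zeta> \<eta> * (f \<eta> * g (\<zeta> - \<eta>)) \<partial>lborel)
            \<le> h \<zeta> * ?I K\<^sub>1 \<zeta>
              + h \<zeta> * ?I K\<^sub>2 \<zeta>
              + h \<zeta> * ?I ?K\<^sub>3 \<zeta>"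
          unfolding distrib_left[symmetric] by (intro mult_left_mono) auto
      qed
      also have "\<dots> = ?T\<^sub>1 + ?T\<^sub>2 + ?T\<^sub>3"
        unfolding trilinear_def by (simp add: nn_integral_add)
      also have "\<dots> \<le> 3 * max ?T\<^sub>1 (max ?T\<^sub>2 ?T\<^sub>3)" (is "_ \<le> 3 * ?M")
      proof -
        have "?T\<^sub>1 + ?T\<^sub>2 + ?T\<^sub>3 \<le> ?M + ?M + ?M"
          by (intro add_mono) (auto simp: le_max_iff_disj)
        also have "\<dots> = (1 + 1 + 1) * ?M" by (simp only: distrib_right mult_1)
        also have "(1 + 1 + 1 :: ennreal) = 3" by simp
        finally show ?thesis .
      qed
      finally have "?T\<^sup>2 \<le> (3 * ?M)\<^sup>2"
        by (intro power_mono) auto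
      also have "\<dots> = 9 * ?M\<^sup>2" by (simp add: power_mult_distrib)
      also have "\<dots> \<le> 9 * ?E"
        using T\<^sub>1 T\<^sub>2 T\<^sub>3 by (intro mult_left_mono) (auto simp: max_def)
      also have "\<dots> = ?D * ?H" by (simp only: mult_ac)
      finally show "?T\<^sup>2 \<le> ?D * ?H" .
    qed
  qed
qed

end

section \<open>The Fourier transform on the plane\<close>

type_synonym plane = "real \<times> real"

text \<open>(1 + |z|)^4 dominates (1 + |x|)^2 (1 + |t|)^2, a product of two functions with
  integrable reciprocals on the line.\<close>

lemma integrable_plane_decay: "integrable lborel (\<lambda>z::plane. 1 / (1 + norm z) ^ 4)"
proof (rule integrableI_bounded)
  define J where "J = (\<integral>\<^sup>+y. ennreal ((1 + \<bar>y\<bar>) powr (- 2)) \<partial>(lborel :: real measure))"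
  have "(\<integral>\<^sup>+z. ennreal (norm (1 / (1 + norm z) ^ 4)) \<partial>(lborel :: plane measure))
      \<le> (\<integral>\<^sup>+z. ennreal ((1 + \<bar>fst z\<bar>) powr (- 2)) * ennreal ((1 + \<bar>snd z\<bar>) powr (- 2)) \<partial>(lborel :: plane measure))"
  proof (rule nn_integral_mono)
    fix z :: plane
    have "\<bar>fst z\<bar> \<le> norm z" "\<bar>snd z\<bar> \<le> norm z"
      by (metis norm_fst_le prod.collapse real_norm_def, metis norm_snd_le prod.collapse real_norm_def)
    then have "((1 + \<bar>fst z\<bar>) * (1 + \<bar>snd z\<bar>))\<^sup>2 \<le> ((1 + norm z) * (1 + norm z))\<^sup>2"
      by (intro power_mono mult_mono) auto
    also have "\<dots> = (1 + norm z) ^ 4" by (simp add: power2_eq_square power4_eq_xxxx mult_ac)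
    finally have "1 / (1 + norm z) ^ 4 \<le> 1 / ((1 + \<bar>fst z\<bar>) * (1 + \<bar>snd z\<bar>))\<^sup>2"
      by (intro divide_left_mono) (auto intro!: mult_pos_pos zero_less_power add_pos_nonneg)
    also have "\<dots> = (1 + \<bar>fst z\<bar>) powr (- 2) * (1 + \<bar>snd z\<bar>) powr (- 2)"
      by (simp add: powr_minus_divide power_mult_distrib)
    finally show "ennreal (norm (1 / (1 + norm z) ^ 4))
        \<le> ennreal ((1 + \<bar>fst z\<bar>) powr (- 2)) * ennreal ((1 + \<bar>snd z\<bar>) powr (- 2))"
      by (simp add: ennreal_leI flip: ennreal_mult)
  qed
  also have "\<dots> = (\<integral>\<^sup>+x. ennreal ((1 + \<bar>x\<bar>) powr (- 2)) * J \<partial>lborel)"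
    by (subst nn_integral_lborel_plane) (simp_all add: nn_integral_cmult J_def)
  also have "\<dots> = J * J" by (simp add: nn_integral_multc J_def)
  also have "\<dots> < \<infinity>"
    using nn_integral_decay_finite[of 2] by (simp add: J_def br_def ennreal_mult_less_top)
  finally show "(\<integral>\<^sup>+z. ennreal (norm (1 / (1 + norm z) ^ 4)) \<partial>(lborel :: plane measure)) < \<infinity>" .
qed measurable

lemma le_plane_decay:
  assumes "(1 + norm z) ^ 4 * c \<le> C"
  shows "c \<le> C * (1 / (1 + norm z) ^ 4)"
proof -
  have "0 < (1 + norm z) ^ 4" by (intro zero_less_power add_pos_nonneg) auto
  then show ?thesis using assms by (simp add: field_simps)
qed

lemma integrable_of_decay:
  fixes f :: "plane \<Rightarrow> 'b::{banach, second_countable_topology}"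
  assumes [measurable]: "f \<in> borel_measurable borel"
    and le: "\<And>z. (1 + norm z) ^ 4 * norm (f z) \<le> C"
  shows "integrable lborel f"
proof (rule Bochner_Integration.integrable_bound)
  show "integrable lborel (\<lambda>z::plane. C * (1 / (1 + norm z) ^ 4))"
    by (intro integrable_mult_right integrable_plane_decay)
  show "AE z in lborel. norm (f z) \<le> norm (C * (1 / (1 + norm z) ^ 4))"
  proof (rule AE_I2)
    fix z
    show "norm (f z) \<le> norm (C * (1 / (1 + norm z) ^ 4))"
      using le_plane_decay[OF le[of z]] unfolding real_norm_def by linarith
  qed
qed measurable

lemma schwartz_measurable: "f \<in> schwartz \<Longrightarrow> f \<in> borel_measurable borel"
  by (intro borel_measurable_continuous_onI schwartz_continuous_on)

lemma schwartz_integrable: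
  fixes f :: "plane \<Rightarrow> complex"
  assumes "f \<in> schwartz"
  shows "integrable lborel f"
  using schwartz_decay[OF assms, of 4] integrable_of_decay schwartz_measurable[OF assms] by metis

lemma norm_phase [simp]: "norm (exp (- \<i> * of_real r)) = 1" "norm (exp (- (\<i> * of_real r))) = 1"
    "norm (exp (\<i> * of_real r)) = 1"
  by (simp_all add: norm_exp_eq_Re)

lemma integrable_phase:
  fixes f :: "'a::euclidean_space \<Rightarrow> complex"
  assumes f: "integrable lborel f"
  shows "integrable lborel (\<lambda>z. exp (- \<i> * of_real (\<zeta> \<bullet> z)) * f z)"
    "integrable lborel (\<lambda>z. exp (\<i> * of_real (\<zeta> \<bullet> z)) * f z)"
proof -
  have [measurable]: "f \<in> borel_measurable borel" using borel_measurable_integrable[OF f] by simp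
  show "integrable lborel (\<lambda>z. exp (- \<i> * of_real (\<zeta> \<bullet> z)) * f z)"
    by (rule Bochner_Integration.integrable_bound[OF f]) (auto simp: norm_mult)
  show "integrable lborel (\<lambda>z. exp (\<i> * of_real (\<zeta> \<bullet> z)) * f z)"
    by (rule Bochner_Integration.integrable_bound[OF f]) (auto simp: norm_mult)
qed

lemma fourier_zero [simp]: "fourier (\<lambda>z. 0) \<zeta> = 0"
  by (simp add: fourier_def)

lemma fourier_minus: "fourier (\<lambda>z. - f z) \<zeta> = - fourier f \<zeta>"
  by (simp add: fourier_def)

lemma fourier_add:
  assumes "integrable lborel f" "integrable lborel g"
  shows "fourier (\<lambda>z. f z + g z) \<zeta> = fourier f \<zeta> + fourier g \<zeta>"
  using integrable_phase[OF assms(1)] integrable_phase[OF assms(2)] by (simp add: fourier_def distrib_left)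

lemma norm_fourier_le:
  assumes "integrable lborel f"
  shows "norm (fourier f \<zeta>) \<le> (LINT z|lborel. norm (f z))"
  unfolding fourier_def
  by (rule order_trans[OF integral_norm_bound]) (simp add: norm_mult)

lemma measurable_fourier:
  assumes [measurable]: "f \<in> borel_measurable borel"
  shows "fourier f \<in> borel_measurable borel"
  unfolding fourier_def by measurable

lemma integral_lborel_affine:
  fixes f :: "'a::euclidean_space \<Rightarrow> 'b::{banach, second_countable_topology}"
  assumes [measurable]: "f \<in> borel_measurable borel" and "c \<noteq> 0"
  shows "(LINT x|lborel. f x) = (\<bar>c\<bar> ^ DIM('a)) *\<^sub>R (LINT x|lborel. f (t + c *\<^sub>R x))"
proof -
  have "(LINT x|lborel. f x) = (LINT x|density (distr lborel borel (\<lambda>x. t + c *\<^sub>R x)) (\<lambda>_. ennreal (\<bar>c\<bar> ^ DIM('a))). f x)"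
    using lborel_affine[OF assms(2), of t] by simp
  also have "\<dots> = (LINT x|distr lborel borel (\<lambda>x. t + c *\<^sub>R x). (\<bar>c\<bar> ^ DIM('a)) *\<^sub>R f x)"
    by (rule integral_density) auto
  also have "\<dots> = (LINT x|lborel. (\<bar>c\<bar> ^ DIM('a)) *\<^sub>R f (t + c *\<^sub>R x))"
    by (rule integral_distr) auto
  finally show ?thesis by simp
qed

lemma has_vector_derivative_quotient:
  fixes g :: "real \<Rightarrow> 'a::real_normed_vector"
  assumes "(g has_vector_derivative D) (at 0)"
  shows "((\<lambda>h. (g h - g 0) /\<^sub>R h) \<longlongrightarrow> D) (at 0)"
proof -
  have "((\<lambda>h. norm (g (0 + h) - g 0 - h *\<^sub>R D) / norm h) \<longlongrightarrow> 0) (at 0)"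
    using assms unfolding has_vector_derivative_def has_derivative_at by blast
  then have "((\<lambda>h. norm ((g h - g 0) /\<^sub>R h - D)) \<longlongrightarrow> 0) (at 0)"
  proof (rule Lim_transform_eventually)
    show "\<forall>\<^sub>F h in at 0. norm (g (0 + h) - g 0 - h *\<^sub>R D) / norm h = norm ((g h - g 0) /\<^sub>R h - D)"
      unfolding eventually_at_filter
    proof (intro always_eventually allI impI)
      fix h :: real assume "h \<noteq> 0"
      then have "(g h - g 0) /\<^sub>R h - D = (g (0 + h) - g 0 - h *\<^sub>R D) /\<^sub>R h"
        by (simp add: scaleR_diff_right)
      then show "norm (g (0 + h) - g 0 - h *\<^sub>R D) / norm h = norm ((g h - g 0) /\<^sub>R h - D)"
        by (simp add: divide_inverse mult.commute)
    qed
  qed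
  then show ?thesis
    using Lim_null tendsto_norm_zero_iff by blast
qed

lemma phase_derivative: "((\<lambda>s. exp (\<i> * of_real (s * c))) has_vector_derivative \<i> * of_real c) (at 0)"
proof -
  have "((\<lambda>z. exp (\<i> * (z * of_real c))) has_field_derivative (\<i> * of_real c)) (at (of_real 0))"
    by (auto intro!: derivative_eq_intros)
  from has_vector_derivative_real_field[OF this] show ?thesis by simp
qed

lemma integrable_shift:
  fixes f :: "'a::euclidean_space \<Rightarrow> 'b::{banach, second_countable_topology}"
  assumes "integrable lborel f"
  shows "integrable lborel (\<lambda>x. f (x + y))"
proof -
  have "integrable (distr lborel borel ((+) y)) f" using assms by (simp add: lborel_distr_plus)
  then show ?thesis
    by (subst (asm) integrable_distr_eq) (use borel_measurable_integrable[OF assms] in \<open>auto simp: add.commute\<close>)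
qed

lemma fourier_shift:
  fixes f :: "'a::euclidean_space \<Rightarrow> complex"
  assumes [measurable]: "f \<in> borel_measurable borel"
  shows "fourier (\<lambda>z. f (z + y)) \<zeta> = exp (\<i> * of_real (\<zeta> \<bullet> y)) * fourier f \<zeta>"
proof -
  have "fourier (\<lambda>z. f (z + y)) \<zeta> = (LINT z|lborel. exp (\<i> * of_real (\<zeta> \<bullet> y)) * (exp (- \<i> * of_real (\<zeta> \<bullet> (y + z))) * f (y + z)))"
    unfolding fourier_def
    by (intro Bochner_Integration.integral_cong)
      (auto simp: inner_add_right algebra_simps simp flip: exp_add)
  also have "\<dots> = exp (\<i> * of_real (\<zeta> \<bullet> y)) * (LINT z|lborel. exp (- \<i> * of_real (\<zeta> \<bullet> (y + z))) * f (y + z))"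
    by simp
  also have "(LINT z|lborel. exp (- \<i> * of_real (\<zeta> \<bullet> (y + z))) * f (y + z)) = fourier f \<zeta>"
    unfolding fourier_def
    using integral_lborel_affine[of "\<lambda>z. exp (- \<i> * of_real (\<zeta> \<bullet> z)) * f z" 1 y] by simp
  finally show ?thesis .
qed

section \<open>Derivatives and the decay of the transform\<close>

lemma schwartz_has_vector_derivative_line:
  fixes f :: "'a::euclidean_space \<Rightarrow> complex"
  assumes "f \<in> schwartz"
  shows "((\<lambda>s. f (z + s *\<^sub>R e)) has_vector_derivative frechet_derivative f (at (z + s *\<^sub>R e)) e) (at s)"
proof -
  interpret D: bounded_linear "frechet_derivative f (at (z + s *\<^sub>R e))"
    using schwartz_has_derivative[OF assms] by (rule has_derivative_bounded_linear)
  have "((\<lambda>s. f (z + s *\<^sub>R e)) has_derivative (\<lambda>h. frechet_derivative f (at (z + s *\<^sub>R e)) (h *\<^sub>R e))) (at s)"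
    by (rule has_derivative_compose[of "\<lambda>s. z + s *\<^sub>R e", OF _ schwartz_has_derivative[OF assms]])
      (auto intro!: derivative_eq_intros)
  then show ?thesis by (simp add: has_vector_derivative_def D.scaleR)
qed

text \<open>Uniformity in \<open>t\<close> makes this a dominating function for the difference
  quotients. The mean value theorem evaluates the derivative at a point at distance at most 1 from
  \<open>z\<close>, which costs a factor \<open>2 ^ n\<close> in the weight.\<close>

lemma schwartz_difference_bound:
  fixes f :: "'a::euclidean_space \<Rightarrow> complex"
  assumes f: "f \<in> schwartz" and e: "e \<in> Basis"
  obtains C where "\<And>t z. 0 < t \<Longrightarrow> t \<le> 1 \<Longrightarrow> (1 + norm z) ^ n * norm (f (z + t *\<^sub>R e) - f z) \<le> C * t"
proof -
  obtain C where C: "\<And>z. (1 + norm z) ^ n * norm (frechet_derivative f (at z) e) \<le> C"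
    using schwartz_decay[OF schwartz_frechet_derivative[OF f e]] by blast
  show ?thesis
  proof
    fix t :: real and z :: 'a
    assume t: "0 < t" "t \<le> 1"
    have "\<exists>x\<in>{0<..<t}. norm (f (z + t *\<^sub>R e) - f (z + 0 *\<^sub>R e))
        \<le> norm ((t - 0) *\<^sub>R frechet_derivative f (at (z + x *\<^sub>R e)) e)"
      using t schwartz_has_vector_derivative_line[OF f]
      by (intro mvt_general continuous_at_imp_continuous_on ballI)
        (auto simp: has_vector_derivative_def intro: has_derivative_continuous)
    then obtain x where x: "0 < x" "x < t"
      and le: "norm (f (z + t *\<^sub>R e) - f z) \<le> t * norm (frechet_derivative f (at (z + x *\<^sub>R e)) e)"
      using t by auto
    have "norm z \<le> norm (z + x *\<^sub>R e) + norm (x *\<^sub>R e)"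
      by (metis add_diff_cancel_right' norm_triangle_ineq4)
    moreover have "norm (x *\<^sub>R e) \<le> 1" using x t e by simp
    moreover have "0 \<le> norm (z + x *\<^sub>R e)" by simp
    ultimately have "1 + norm z \<le> 2 * (1 + norm (z + x *\<^sub>R e))" by argo
    then have "(1 + norm z) ^ n \<le> (2 * (1 + norm (z + x *\<^sub>R e))) ^ n"
      by (intro power_mono) auto
    then have "(1 + norm z) ^ n * norm (f (z + t *\<^sub>R e) - f z)
        \<le> (2 * (1 + norm (z + x *\<^sub>R e))) ^ n * (t * norm (frechet_derivative f (at (z + x *\<^sub>R e)) e))"
      using le by (intro mult_mono) auto
    also have "\<dots> = 2 ^ n * t * ((1 + norm (z + x *\<^sub>R e)) ^ n * norm (frechet_derivative f (at (z + x *\<^sub>R e)) e))"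
      by (simp only: power_mult_distrib mult_ac)
    also have "\<dots> \<le> 2 ^ n * t * C" using C t by (intro mult_left_mono) auto
    finally show "(1 + norm z) ^ n * norm (f (z + t *\<^sub>R e) - f z) \<le> 2 ^ n * C * t" by (simp add: mult_ac)
  qed
qed

text \<open>Both sides are limits of the transform of the same difference quotient, one by dominated
  convergence and the other by \<open>fourier_shift\<close> and the derivative of the phase. Thus no
  boundary terms arise.\<close>

lemma fourier_frechet_derivative:
  fixes f :: "plane \<Rightarrow> complex"
  assumes f: "f \<in> schwartz" and e: "e \<in> Basis"
  shows "fourier (\<lambda>z. frechet_derivative f (at z) e) \<zeta> = \<i> * of_real (\<zeta> \<bullet> e) * fourier f \<zeta>"
proof (rule LIMSEQ_unique)
  define t where "t k = inverse (real (Suc k))" for k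
  have t: "0 < t k" "t k \<le> 1" for k by (auto simp: t_def inverse_le_1_iff)
  have t0: "t \<longlonglongrightarrow> 0" unfolding t_def by (rule LIMSEQ_inverse_real_of_nat) 
  then have t_at: "filterlim t (at 0) sequentially"
    unfolding filterlim_at by (simp add: t_def)
  note [measurable] = schwartz_measurable[OF f] schwartz_measurable[OF schwartz_frechet_derivative[OF f e]]
  have quot: "(\<lambda>k. (f (z + t k *\<^sub>R e) - f z) / of_real (t k)) \<longlonglongrightarrow> frechet_derivative f (at z) e" for z
  proof -
    have "((\<lambda>s. f (z + s *\<^sub>R e)) has_vector_derivative frechet_derivative f (at z) e) (at 0)"
      using schwartz_has_vector_derivative_line[OF f, of z e 0] by simp
    from filterlim_compose[OF has_vector_derivative_quotient[OF this] t_at] show ?thesis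
      by (simp add: scaleR_conv_of_real divide_inverse mult.commute)
  qed
  obtain C where C: "\<And>s z. 0 < s \<Longrightarrow> s \<le> 1 \<Longrightarrow> (1 + norm z) ^ 4 * norm (f (z + s *\<^sub>R e) - f z) \<le> C * s"
    using schwartz_difference_bound[OF f e] by blast
  show "(\<lambda>k. fourier (\<lambda>z. (f (z + t k *\<^sub>R e) - f z) / of_real (t k)) \<zeta>)
      \<longlonglongrightarrow> fourier (\<lambda>z. frechet_derivative f (at z) e) \<zeta>"
    unfolding fourier_def
  proof (rule integral_dominated_convergence)
    show "integrable lborel (\<lambda>z::plane. C * (1 / (1 + norm z) ^ 4))"
      by (intro integrable_mult_right integrable_plane_decay)
    show "AE z in lborel. (\<lambda>k. exp (- \<i> * of_real (\<zeta> \<bullet> z)) * ((f (z + t k *\<^sub>R e) - f z) / of_real (t k)))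
        \<longlonglongrightarrow> exp (- \<i> * of_real (\<zeta> \<bullet> z)) * frechet_derivative f (at z) e"
      by (intro AE_I2 tendsto_mult tendsto_const quot)
    show "AE z in lborel. norm (exp (- \<i> * of_real (\<zeta> \<bullet> z)) * ((f (z + t k *\<^sub>R e) - f z) / of_real (t k)))
        \<le> C * (1 / (1 + norm z) ^ 4)" for k
    proof (rule AE_I2)
      fix z
      have "(1 + norm z) ^ 4 * norm ((f (z + t k *\<^sub>R e) - f z) / of_real (t k)) \<le> C"
        using C[OF t(1)[of k] t(2)[of k], of z] t[of k] by (simp add: norm_divide field_simps)
      then show "norm (exp (- \<i> * of_real (\<zeta> \<bullet> z)) * ((f (z + t k *\<^sub>R e) - f z) / of_real (t k)))
          \<le> C * (1 / (1 + norm z) ^ 4)"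
        unfolding norm_mult norm_phase mult_1 by (rule le_plane_decay)
    qed
  qed measurable
  have "fourier (\<lambda>z. (f (z + t k *\<^sub>R e) - f z) / of_real (t k)) \<zeta>
      = (exp (\<i> * of_real (t k * (\<zeta> \<bullet> e))) - 1) / of_real (t k) * fourier f \<zeta>" for k
  proof -
    have int: "integrable lborel f" by (rule schwartz_integrable[OF f])
    then have int': "integrable lborel (\<lambda>z. f (z + t k *\<^sub>R e))"
      by (rule integrable_shift)
    have "fourier (\<lambda>z. (f (z + t k *\<^sub>R e) - f z) / of_real (t k)) \<zeta>
        = (fourier (\<lambda>z. f (z + t k *\<^sub>R e)) \<zeta> - fourier f \<zeta>) / of_real (t k)"
      using integrable_phase(1)[OF int, of \<zeta>] integrable_phase(1)[OF int', of \<zeta>]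
      by (simp add: fourier_def right_diff_distrib)
    then show ?thesis
      by (subst (asm) fourier_shift) (simp_all add: field_simps)
  qed
  moreover have "(\<lambda>k. (exp (\<i> * of_real (t k * (\<zeta> \<bullet> e))) - 1) / of_real (t k) * fourier f \<zeta>)
      \<longlonglongrightarrow> \<i> * of_real (\<zeta> \<bullet> e) * fourier f \<zeta>"
  proof -
    have "(\<lambda>k. (exp (\<i> * of_real (t k * (\<zeta> \<bullet> e))) - 1) / of_real (t k)) \<longlonglongrightarrow> \<i> * of_real (\<zeta> \<bullet> e)"
      using filterlim_compose[OF has_vector_derivative_quotient[OF phase_derivative] t_at, of "\<zeta> \<bullet> e"]
      by (simp add: scaleR_conv_of_real divide_inverse mult.commute)
    then show ?thesis by (intro tendsto_intros)
  qed
  ultimately show "(\<lambda>k. fourier (\<lambda>z. (f (z + t k *\<^sub>R e) - f z) / of_real (t k)) \<zeta>)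
      \<longlonglongrightarrow> \<i> * of_real (\<zeta> \<bullet> e) * fourier f \<zeta>" by simp
qed

text \<open>Each further power of |zeta| is bought with one derivative, through |zeta| <= sum of
  |zeta . e|. The induction generalizes over \<open>f\<close> because it is applied to the
  derivatives.\<close>

lemma fourier_decay:
  fixes f :: "plane \<Rightarrow> complex"
  assumes "f \<in> schwartz"
  shows "\<exists>C. \<forall>\<zeta>. (1 + norm \<zeta>) ^ n * norm (fourier f \<zeta>) \<le> C"
  using assms
proof (induction n arbitrary: f)
  case 0
  then show ?case using norm_fourier_le[OF schwartz_integrable[OF 0]] by auto
next
  case (Suc n)
  obtain A where A: "\<And>\<zeta>. (1 + norm \<zeta>) ^ n * norm (fourier f \<zeta>) \<le> A"
    using Suc by blast
  have "\<forall>e\<in>Basis. \<exists>C. \<forall>\<zeta>. (1 + norm \<zeta>) ^ n * norm (fourier (\<lambda>z. frechet_derivative f (at z) e) \<zeta>) \<le> C"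
    using Suc schwartz_frechet_derivative by blast
  then obtain B where B: "\<And>e \<zeta>. e \<in> Basis \<Longrightarrow>
      (1 + norm \<zeta>) ^ n * norm (fourier (\<lambda>z. frechet_derivative f (at z) e) \<zeta>) \<le> B e"
    by metis
  have "(1 + norm \<zeta>) ^ Suc n * norm (fourier f \<zeta>) \<le> A + (\<Sum>e\<in>Basis. B e)" for \<zeta>
  proof -
    have "norm \<zeta> * norm (fourier f \<zeta>) \<le> (\<Sum>e\<in>Basis. \<bar>\<zeta> \<bullet> e\<bar>) * norm (fourier f \<zeta>)"
      by (intro mult_right_mono norm_le_l1) auto
    also have "\<dots> = (\<Sum>e\<in>Basis. norm (fourier (\<lambda>z. frechet_derivative f (at z) e) \<zeta>))"
      by (simp add: fourier_frechet_derivative[OF Suc.prems] norm_mult sum_distrib_right)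
    finally have "(1 + norm \<zeta>) ^ n * (norm \<zeta> * norm (fourier f \<zeta>))
        \<le> (1 + norm \<zeta>) ^ n * (\<Sum>e\<in>Basis. norm (fourier (\<lambda>z. frechet_derivative f (at z) e) \<zeta>))"
      by (intro mult_left_mono) auto
    also have "\<dots> \<le> (\<Sum>e\<in>Basis. B e)"
      unfolding sum_distrib_left by (intro sum_mono B)
    finally show ?thesis using A[of \<zeta>] by (simp add: algebra_simps)
  qed
  then show ?case by blast
qed


lemma fourier_integrable:
  fixes f :: "plane \<Rightarrow> complex"
  assumes "f \<in> schwartz"
  shows "integrable lborel (fourier f)"
  using fourier_decay[OF assms, of 4] integrable_of_decay measurable_fourier[OF schwartz_measurable[OF assms]]
  by metis

section \<open>Fourier inversion and the transform of a product\<close>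

lemma integrable_pair_mult:
  fixes f :: "'a::euclidean_space \<Rightarrow> complex" and g :: "'b::euclidean_space \<Rightarrow> complex"
  assumes f: "integrable lborel f" and g: "integrable lborel g"
  shows "integrable (lborel \<Otimes>\<^sub>M lborel) (\<lambda>(x, y). f x * g y)"
proof (rule lborel_pair.Fubini_integrable)
  have [measurable]: "f \<in> borel_measurable borel" "g \<in> borel_measurable borel"
    using borel_measurable_integrable[OF f] borel_measurable_integrable[OF g] by simp_all
  show "(\<lambda>(x, y). f x * g y) \<in> borel_measurable (lborel \<Otimes>\<^sub>M lborel)" by measurable
  show "integrable lborel (\<lambda>x. LINT y|lborel. norm (case (x, y) of (x, y) \<Rightarrow> f x * g y))"
    using f by (simp add: norm_mult)
  show "AE x in lborel. integrable lborel (\<lambda>y. case (x, y) of (x, y) \<Rightarrow> f x * g y)"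
    using g by simp
qed

lemma integrable_scale:
  fixes f :: "'a::euclidean_space \<Rightarrow> 'b::{banach, second_countable_topology}"
  assumes f: "integrable lborel f" and c: "c \<noteq> 0"
  shows "integrable lborel (\<lambda>x. f (c *\<^sub>R x))"
proof (rule integrableI_bounded)
  have [measurable]: "f \<in> borel_measurable borel" using borel_measurable_integrable[OF f] by simp
  show "(\<lambda>x. f (c *\<^sub>R x)) \<in> borel_measurable lborel" by measurable
  have "ennreal (\<bar>c\<bar> ^ DIM('a)) * (\<integral>\<^sup>+x. ennreal (norm (f (0 + c *\<^sub>R x))) \<partial>lborel)
      = (\<integral>\<^sup>+x. ennreal (norm (f x)) \<partial>lborel)"
    by (rule nn_integral_lborel_affine[symmetric]) (use c in auto)
  also have "\<dots> < \<infinity>" using f by (simp add: integrable_iff_bounded)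
  finally show "(\<integral>\<^sup>+x. ennreal (norm (f (c *\<^sub>R x))) \<partial>lborel) < \<infinity>"
    using c by (auto simp: ennreal_mult_less_top)
qed

section \<open>The Gaussian and its transform\<close>

definition gauss :: "plane \<Rightarrow> real" where
  "gauss z = exp (- (norm z)\<^sup>2 / 2)"

lemma gauss_le_1: "gauss z \<le> 1" and gauss_nonneg: "0 \<le> gauss z" and gauss_zero: "gauss 0 = 1"
  by (simp_all add: gauss_def)

lemma measurable_gauss [measurable]: "gauss \<in> borel_measurable borel"
  unfolding gauss_def by measurable

lemma gauss_eq: "gauss (x, t) = 2 * pi * (std_normal_density x * std_normal_density t)"
proof -
  have "gauss (x, t) = exp (- x\<^sup>2 / 2) * exp (- t\<^sup>2 / 2)"
    by (simp add: gauss_def norm_Pair add_divide_distrib flip: exp_add)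
  \<comment> \<open>\<open>s\<close> stands for the normalizing constant sqrt(2 pi) of the
    density.\<close>
  moreover have "2 * pi * (1 / s * A * (1 / s * B)) = A * B" if "s * s = 2 * pi" for s A B :: real
    using that pi_gt_zero by (auto simp: field_simps)
  ultimately show ?thesis
    unfolding std_normal_density_def by (metis abs_of_nonneg pi_ge_zero real_sqrt_mult_self
        mult_nonneg_nonneg zero_le_numeral)
qed

lemma std_normal_char:
  "(LINT y|lborel. exp (\<i> * of_real (t * y)) * of_real (std_normal_density y)) = of_real (exp (- t\<^sup>2 / 2))"
proof -
  have "of_real (exp (- t\<^sup>2 / 2)) = char std_normal_distribution t"
    by (simp add: char_std_normal_distribution)
  also have "\<dots> = (LINT y|lborel. std_normal_density y *\<^sub>R exp (\<i> * of_real (t * y)))"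
    unfolding char_def by (rule integral_density) auto
  finally show ?thesis by (simp add: scaleR_conv_of_real mult.commute)
qed

lemma integrable_std_normal_phase:
  "integrable lborel (\<lambda>y. exp (\<i> * of_real (t * y)) * of_real (std_normal_density y) :: complex)"
proof (rule Bochner_Integration.integrable_bound)
  show "integrable lborel std_normal_density" by simp
qed (auto simp: norm_mult)

lemma gauss_phase_integral:
  "integrable lborel (\<lambda>z. exp (\<i> * of_real (\<zeta> \<bullet> z)) * of_real (gauss z) :: complex)"
  "(LINT z|lborel. exp (\<i> * of_real (\<zeta> \<bullet> z)) * of_real (gauss z)) = of_real (2 * pi * gauss \<zeta>)"
proof -
  define F where "F t y = exp (\<i> * of_real (t * y)) * of_real (std_normal_density y)" for t y :: real
  have int: "integrable lborel (F t)" for t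
    unfolding F_def by (rule integrable_std_normal_phase)
  have eq: "exp (\<i> * of_real (\<zeta> \<bullet> z)) * of_real (gauss z)
      = of_real (2 * pi) * (case z of (x, t) \<Rightarrow> F (fst \<zeta>) x * F (snd \<zeta>) t)" for z
    by (cases z, cases \<zeta>) (simp add: F_def gauss_eq exp_add distrib_left)
  have int2: "integrable (lborel \<Otimes>\<^sub>M lborel) (\<lambda>(x, t). F (fst \<zeta>) x * F (snd \<zeta>) t)"
    by (rule integrable_pair_mult[OF int int])
  then show "integrable lborel (\<lambda>z. exp (\<i> * of_real (\<zeta> \<bullet> z)) * of_real (gauss z) :: complex)"
    unfolding eq by (intro integrable_mult_right) (simp add: lborel_prod)
  have "(LINT z|lborel. exp (\<i> * of_real (\<zeta> \<bullet> z)) * of_real (gauss z))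
      = of_real (2 * pi) * (LINT z|(lborel \<Otimes>\<^sub>M lborel). (case z of (x, t) \<Rightarrow> F (fst \<zeta>) x * F (snd \<zeta>) t))"
    unfolding eq by (simp add: lborel_prod)
  also have "(LINT z|(lborel \<Otimes>\<^sub>M lborel). (case z of (x, t) \<Rightarrow> F (fst \<zeta>) x * F (snd \<zeta>) t))
      = (LINT x|lborel. LINT t|lborel. F (fst \<zeta>) x * F (snd \<zeta>) t)"
    by (rule lborel_pair.integral_fst[OF int2, symmetric])
  also have "\<dots> = (LINT x|lborel. F (fst \<zeta>) x) * (LINT t|lborel. F (snd \<zeta>) t)"
    by simp
  also have "\<dots> = of_real (exp (- (fst \<zeta>)\<^sup>2 / 2) * exp (- (snd \<zeta>)\<^sup>2 / 2))"
    unfolding F_def std_normal_char by simp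
  also have "exp (- (fst \<zeta>)\<^sup>2 / 2) * exp (- (snd \<zeta>)\<^sup>2 / 2) = gauss \<zeta>"
    by (cases \<zeta>) (simp add: gauss_def norm_Pair add_divide_distrib flip: exp_add)
  finally show "(LINT z|lborel. exp (\<i> * of_real (\<zeta> \<bullet> z)) * of_real (gauss z)) = of_real (2 * pi * gauss \<zeta>)"
    by simp
qed

lemma integrable_gauss: "integrable lborel (\<lambda>z. of_real (gauss z) :: complex)"
  using gauss_phase_integral(1)[of 0] by simp

lemma gauss_integral: "(LINT z|lborel. complex_of_real (gauss z)) = of_real (2 * pi)"
  using gauss_phase_integral(2)[of 0] by (simp add: gauss_zero)

text \<open>The Gaussian cutoff makes the double integral absolutely convergent, so Fubini applies
  even though the phase alone is not integrable. The inner integral is then a Gaussian around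
  \<open>z\<close> at scale \<open>\<epsilon>\<close>, and rescaling it produces the right-hand
  side.\<close>

lemma fourier_inversion_gauss:
  fixes f :: "plane \<Rightarrow> complex"
  assumes f: "integrable lborel f" and \<epsilon>: "0 < \<epsilon>"
  shows "(LINT \<zeta>|lborel. of_real (gauss (\<epsilon> *\<^sub>R \<zeta>)) * (exp (\<i> * of_real (\<zeta> \<bullet> z)) * fourier f \<zeta>))
    = of_real (2 * pi) * (LINT w|lborel. f (z + \<epsilon> *\<^sub>R w) * of_real (gauss w))"
proof -
  have [measurable]: "f \<in> borel_measurable borel" using borel_measurable_integrable[OF f] by simp
  define H where "H \<zeta> y = of_real (gauss (\<epsilon> *\<^sub>R \<zeta>)) * (exp (\<i> * of_real (\<zeta> \<bullet> z))
      * (exp (- \<i> * of_real (\<zeta> \<bullet> y)) * f y))" for \<zeta> y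
  have int: "integrable (lborel \<Otimes>\<^sub>M lborel) (case_prod H)"
  proof (rule Bochner_Integration.integrable_bound)
    show "integrable (lborel \<Otimes>\<^sub>M lborel) (\<lambda>(\<zeta>, y). of_real (gauss (\<epsilon> *\<^sub>R \<zeta>)) * f y)"
      using \<epsilon> by (intro integrable_pair_mult f integrable_scale[OF integrable_gauss]) auto
    show "case_prod H \<in> borel_measurable (lborel \<Otimes>\<^sub>M lborel)"
      unfolding H_def by measurable
  qed (auto simp: H_def norm_mult)
  have "(LINT \<zeta>|lborel. of_real (gauss (\<epsilon> *\<^sub>R \<zeta>)) * (exp (\<i> * of_real (\<zeta> \<bullet> z)) * fourier f \<zeta>))
      = (LINT \<zeta>|lborel. LINT y|lborel. H \<zeta> y)"
    unfolding H_def fourier_def by simp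
  also have "\<dots> = (LINT y|lborel. LINT \<zeta>|lborel. H \<zeta> y)"
    by (rule lborel_pair.Fubini_integral[OF int, symmetric])
  also have "\<dots> = (LINT y|lborel. f y * of_real (2 * pi / \<epsilon>\<^sup>2 * gauss ((1 / \<epsilon>) *\<^sub>R (z - y))))"
  proof (rule Bochner_Integration.integral_cong)
    fix y
    let ?x = "(1 / \<epsilon>) *\<^sub>R (z - y)"
    have "of_real (2 * pi * gauss ?x)
        = (LINT w|lborel. exp (\<i> * of_real (?x \<bullet> w)) * complex_of_real (gauss w))"
      by (rule gauss_phase_integral(2)[symmetric])
    also have "\<dots> = (\<bar>\<epsilon>\<bar> ^ DIM(plane)) *\<^sub>R (LINT \<zeta>|lborel. exp (\<i> * of_real (?x \<bullet> (0 + \<epsilon> *\<^sub>R \<zeta>))) * complex_of_real (gauss (0 + \<epsilon> *\<^sub>R \<zeta>)))"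
      using \<epsilon> by (intro integral_lborel_affine) auto
    also have "\<dots> = of_real (\<epsilon>\<^sup>2) * (LINT \<zeta>|lborel. exp (\<i> * of_real (\<zeta> \<bullet> (z - y))) * complex_of_real (gauss (\<epsilon> *\<^sub>R \<zeta>)))"
      using \<epsilon> by (simp add: scaleR_conv_of_real inner_commute power2_eq_square)
    finally have *: "(LINT \<zeta>|lborel. exp (\<i> * of_real (\<zeta> \<bullet> (z - y))) * complex_of_real (gauss (\<epsilon> *\<^sub>R \<zeta>)))
        = of_real (2 * pi / \<epsilon>\<^sup>2 * gauss ?x)"
      using \<epsilon> by (simp add: field_simps)
    have "(LINT \<zeta>|lborel. H \<zeta> y)
        = (LINT \<zeta>|lborel. f y * (exp (\<i> * of_real (\<zeta> \<bullet> (z - y))) * complex_of_real (gauss (\<epsilon> *\<^sub>R \<zeta>))))"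
      by (intro Bochner_Integration.integral_cong)
        (auto simp: H_def inner_diff_right right_diff_distrib exp_diff exp_minus field_simps)
    also have "\<dots> = f y * of_real (2 * pi / \<epsilon>\<^sup>2 * gauss ?x)"
      using * by simp
    finally show "(LINT \<zeta>|lborel. H \<zeta> y) = f y * of_real (2 * pi / \<epsilon>\<^sup>2 * gauss ?x)" .
  qed simp
  also have "\<dots> = (\<bar>\<epsilon>\<bar> ^ DIM(plane)) *\<^sub>R (LINT w|lborel. f (z + \<epsilon> *\<^sub>R w)
      * of_real (2 * pi / \<epsilon>\<^sup>2 * gauss ((1 / \<epsilon>) *\<^sub>R (z - (z + \<epsilon> *\<^sub>R w)))))"
    using \<epsilon> by (intro integral_lborel_affine) auto
  also have "(\<lambda>w. f (z + \<epsilon> *\<^sub>R w) * of_real (2 * pi / \<epsilon>\<^sup>2 * gauss ((1 / \<epsilon>) *\<^sub>R (z - (z + \<epsilon> *\<^sub>R w)))))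
      = (\<lambda>w. of_real (2 * pi / \<epsilon>\<^sup>2) * (f (z + \<epsilon> *\<^sub>R w) * of_real (gauss w)))"
    using \<epsilon> by (auto simp: gauss_def)
  also have "(\<bar>\<epsilon>\<bar> ^ DIM(plane)) *\<^sub>R (LINT w|lborel. of_real (2 * pi / \<epsilon>\<^sup>2) * (f (z + \<epsilon> *\<^sub>R w) * of_real (gauss w)))
      = of_real (2 * pi) * (LINT w|lborel. f (z + \<epsilon> *\<^sub>R w) * of_real (gauss w))"
    using \<epsilon> by (simp add: scaleR_conv_of_real power2_eq_square)
  finally show ?thesis .
qed

text \<open>The cutoff is removed by dominated convergence on both sides, dominated by the transform
  of \<open>f\<close> on one side and by a multiple of \<open>gauss\<close> on the other. One factor
  2 pi is that of the cutoff formula, the second the total mass of \<open>gauss\<close>.\<close>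

theorem fourier_inversion:
  fixes f :: "plane \<Rightarrow> complex"
  assumes f: "f \<in> schwartz"
  shows "(LINT \<zeta>|lborel. exp (\<i> * of_real (\<zeta> \<bullet> z)) * fourier f \<zeta>) = of_real ((2 * pi)\<^sup>2) * f z"
proof (rule LIMSEQ_unique)
  define \<epsilon> where "\<epsilon> k = inverse (real (Suc k))" for k
  have \<epsilon>: "0 < \<epsilon> k" for k by (simp add: \<epsilon>_def)
  have \<epsilon>0: "\<epsilon> \<longlonglongrightarrow> 0" unfolding \<epsilon>_def by (rule LIMSEQ_inverse_real_of_nat)
  note [measurable] = schwartz_measurable[OF f] measurable_fourier[OF schwartz_measurable[OF f]]
  have gauss_cont: "isCont gauss x" for x
    unfolding gauss_def by (intro continuous_intros) auto
  show "(\<lambda>k. LINT \<zeta>|lborel. of_real (gauss (\<epsilon> k *\<^sub>R \<zeta>)) * (exp (\<i> * of_real (\<zeta> \<bullet> z)) * fourier f \<zeta>))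
      \<longlonglongrightarrow> (LINT \<zeta>|lborel. exp (\<i> * of_real (\<zeta> \<bullet> z)) * fourier f \<zeta>)"
  proof (rule integral_dominated_convergence)
    show "integrable lborel (\<lambda>\<zeta>. norm (fourier f \<zeta>))"
      using fourier_integrable[OF f] by simp
    show "AE \<zeta> in lborel. (\<lambda>k. of_real (gauss (\<epsilon> k *\<^sub>R \<zeta>)) * (exp (\<i> * of_real (\<zeta> \<bullet> z)) * fourier f \<zeta>))
        \<longlonglongrightarrow> exp (\<i> * of_real (\<zeta> \<bullet> z)) * fourier f \<zeta>"
    proof (rule AE_I2)
      fix \<zeta> :: plane
      have "(\<lambda>k. \<epsilon> k *\<^sub>R \<zeta>) \<longlonglongrightarrow> 0 *\<^sub>R \<zeta>" by (intro tendsto_intros \<epsilon>0)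
      then have "(\<lambda>k. gauss (\<epsilon> k *\<^sub>R \<zeta>)) \<longlonglongrightarrow> 1"
        using isCont_tendsto_compose[OF gauss_cont[of 0]] by (simp add: gauss_zero)
      then have "(\<lambda>k. of_real (gauss (\<epsilon> k *\<^sub>R \<zeta>)) * (exp (\<i> * of_real (\<zeta> \<bullet> z)) * fourier f \<zeta>))
          \<longlonglongrightarrow> of_real 1 * (exp (\<i> * of_real (\<zeta> \<bullet> z)) * fourier f \<zeta>)"
        by (intro tendsto_intros)
      then show "(\<lambda>k. of_real (gauss (\<epsilon> k *\<^sub>R \<zeta>)) * (exp (\<i> * of_real (\<zeta> \<bullet> z)) * fourier f \<zeta>))
          \<longlonglongrightarrow> exp (\<i> * of_real (\<zeta> \<bullet> z)) * fourier f \<zeta>" by simp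
    qed
    show "AE \<zeta> in lborel. norm (of_real (gauss (\<epsilon> k *\<^sub>R \<zeta>)) * (exp (\<i> * of_real (\<zeta> \<bullet> z)) * fourier f \<zeta>))
        \<le> norm (fourier f \<zeta>)" for k
      using gauss_le_1 gauss_nonneg by (auto simp: norm_mult intro!: mult_left_le_one_le)
  qed measurable
  obtain C where C: "\<And>z. norm (f z) \<le> C" using schwartz_decay[OF f, of 0] by (metis mult_1 power_0)
  have "(\<lambda>k. LINT w|lborel. f (z + \<epsilon> k *\<^sub>R w) * of_real (gauss w)) \<longlonglongrightarrow> (LINT w|lborel. f z * of_real (gauss w))"
  proof (rule integral_dominated_convergence)
    show "integrable lborel (\<lambda>w. C * norm (complex_of_real (gauss w)))"
      by (intro integrable_mult_right integrable_norm integrable_gauss)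
    show "AE w in lborel. (\<lambda>k. f (z + \<epsilon> k *\<^sub>R w) * of_real (gauss w)) \<longlonglongrightarrow> f z * of_real (gauss w)"
    proof (rule AE_I2)
      fix w :: plane
      have "(\<lambda>k. z + \<epsilon> k *\<^sub>R w) \<longlonglongrightarrow> z + 0 *\<^sub>R w" by (intro tendsto_intros \<epsilon>0)
      moreover have "isCont f z"
        using schwartz_differentiable[OF f] by (rule differentiable_imp_continuous_within)
      ultimately have "(\<lambda>k. f (z + \<epsilon> k *\<^sub>R w)) \<longlonglongrightarrow> f z"
        by (intro isCont_tendsto_compose[of z f]) simp_all
      then show "(\<lambda>k. f (z + \<epsilon> k *\<^sub>R w) * of_real (gauss w)) \<longlonglongrightarrow> f z * of_real (gauss w)"
        by (intro tendsto_intros)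
    qed
    show "AE w in lborel. norm (f (z + \<epsilon> k *\<^sub>R w) * of_real (gauss w)) \<le> C * norm (complex_of_real (gauss w))" for k
      by (intro AE_I2) (simp add: norm_mult mult_right_mono C)
  qed measurable
  then have "(\<lambda>k. of_real (2 * pi) * (LINT w|lborel. f (z + \<epsilon> k *\<^sub>R w) * of_real (gauss w)))
      \<longlonglongrightarrow> of_real (2 * pi) * (f z * of_real (2 * pi))"
    unfolding integral_mult_right_zero gauss_integral by (intro tendsto_intros)
  then show "(\<lambda>k. LINT \<zeta>|lborel. of_real (gauss (\<epsilon> k *\<^sub>R \<zeta>)) * (exp (\<i> * of_real (\<zeta> \<bullet> z)) * fourier f \<zeta>))
      \<longlonglongrightarrow> of_real ((2 * pi)\<^sup>2) * f z"
    unfolding fourier_inversion_gauss[OF schwartz_integrable[OF f] \<epsilon>]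
    by (simp add: power2_eq_square mult_ac)
qed

text \<open>Only \<open>f\<close> is replaced by its inversion formula, so the double integral is
  dominated by the tensor product of the transform of \<open>f\<close> with \<open>g\<close>. The
  constant reflects that \<open>fourier\<close> carries no normalization.\<close>

theorem fourier_mult:
  fixes f g :: "plane \<Rightarrow> complex"
  assumes f: "f \<in> schwartz" and g: "g \<in> schwartz"
  shows "of_real ((2 * pi)\<^sup>2) * fourier (\<lambda>z. f z * g z) \<zeta> = (LINT \<eta>|lborel. fourier f \<eta> * fourier g (\<zeta> - \<eta>))"
proof -
  note [measurable] = schwartz_measurable[OF f] schwartz_measurable[OF g]
    measurable_fourier[OF schwartz_measurable[OF f]]
  define H where "H \<eta> z = fourier f \<eta> * (exp (- \<i> * of_real ((\<zeta> - \<eta>) \<bullet> z)) * g z)" for \<eta> z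
  have int: "integrable (lborel \<Otimes>\<^sub>M lborel) (case_prod H)"
  proof (rule Bochner_Integration.integrable_bound)
    show "integrable (lborel \<Otimes>\<^sub>M lborel) (\<lambda>(\<eta>, z). fourier f \<eta> * g z)"
      by (intro integrable_pair_mult fourier_integrable f schwartz_integrable g)
    show "case_prod H \<in> borel_measurable (lborel \<Otimes>\<^sub>M lborel)"
      unfolding H_def by measurable
  qed (auto simp: H_def norm_mult)
  have "of_real ((2 * pi)\<^sup>2) * fourier (\<lambda>z. f z * g z) \<zeta>
      = (LINT z|lborel. (of_real ((2 * pi)\<^sup>2) * f z) * (exp (- \<i> * of_real (\<zeta> \<bullet> z)) * g z))"
    unfolding fourier_def by (subst integral_mult_right_zero[symmetric]) (simp add: mult_ac)
  also have "\<dots> = (LINT z|lborel. LINT \<eta>|lborel. H \<eta> z)"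
  proof (rule Bochner_Integration.integral_cong)
    fix z
    have "(of_real ((2 * pi)\<^sup>2) * f z) * (exp (- \<i> * of_real (\<zeta> \<bullet> z)) * g z)
        = (LINT \<eta>|lborel. exp (\<i> * of_real (\<eta> \<bullet> z)) * fourier f \<eta> * (exp (- \<i> * of_real (\<zeta> \<bullet> z)) * g z))"
      unfolding fourier_inversion[OF f, symmetric] by simp
    also have "\<dots> = (LINT \<eta>|lborel. H \<eta> z)"
      by (intro Bochner_Integration.integral_cong)
        (auto simp: H_def inner_diff_left right_diff_distrib exp_diff exp_minus field_simps)
    finally show "(of_real ((2 * pi)\<^sup>2) * f z) * (exp (- \<i> * of_real (\<zeta> \<bullet> z)) * g z) = (LINT \<eta>|lborel. H \<eta> z)" .
  qed simp
  also have "\<dots> = (LINT \<eta>|lborel. LINT z|lborel. H \<eta> z)"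
    by (rule lborel_pair.Fubini_integral[OF int])
  also have "\<dots> = (LINT \<eta>|lborel. fourier f \<eta> * fourier g (\<zeta> - \<eta>))"
    unfolding H_def fourier_def by simp
  finally show ?thesis .
qed

lemma norm_fourier_mult_le:
  fixes f g :: "plane \<Rightarrow> complex"
  assumes f: "f \<in> schwartz" and g: "g \<in> schwartz"
  shows "ennreal (norm (fourier (\<lambda>z. f z * g z) \<zeta>))
    \<le> (\<integral>\<^sup>+\<eta>. ennreal (norm (fourier f \<eta>)) * ennreal (norm (fourier g (\<zeta> - \<eta>))) \<partial>lborel)"
proof (cases "integrable lborel (\<lambda>\<eta>. fourier f \<eta> * fourier g (\<zeta> - \<eta>))")
  case True
  have "1 \<le> (2 * pi)\<^sup>2" using pi_ge_two by (intro one_le_power) auto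
  then have "norm (fourier (\<lambda>z. f z * g z) \<zeta>) \<le> (2 * pi)\<^sup>2 * norm (fourier (\<lambda>z. f z * g z) \<zeta>)"
    using mult_right_mono[of 1 "(2 * pi)\<^sup>2" "norm (fourier (\<lambda>z. f z * g z) \<zeta>)"] by simp
  also have "\<dots> = norm (of_real ((2 * pi)\<^sup>2) * fourier (\<lambda>z. f z * g z) \<zeta>)"
    by (simp add: norm_mult norm_power)
  also have "\<dots> = norm (LINT \<eta>|lborel. fourier f \<eta> * fourier g (\<zeta> - \<eta>))"
    unfolding fourier_mult[OF f g] ..
  finally have "ennreal (norm (fourier (\<lambda>z. f z * g z) \<zeta>)) \<le> ennreal (norm (LINT \<eta>|lborel. fourier f \<eta> * fourier g (\<zeta> - \<eta>)))"
    by (rule ennreal_leI)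
  also have "\<dots> \<le> (\<integral>\<^sup>+\<eta>. ennreal (norm (fourier f \<eta> * fourier g (\<zeta> - \<eta>))) \<partial>lborel)"
    by (rule integral_norm_bound_ennreal[OF True])
  finally show ?thesis by (simp add: norm_mult ennreal_mult)
next
  \<comment> \<open>A Bochner integral that does not converge has the value 0, so
    \<open>fourier_mult\<close> makes the transform of the product vanish at
    \<open>\<zeta>\<close>.\<close>
  case False
  then have "of_real ((2 * pi)\<^sup>2) * fourier (\<lambda>z. f z * g z) \<zeta> = 0"
    unfolding fourier_mult[OF f g] by (rule not_integrable_integral_eq)
  then show ?thesis by simp
qed

section \<open>Weighted norms\<close>

definition weighted_norm :: "(plane \<Rightarrow> real) \<Rightarrow> (plane \<Rightarrow> complex) \<Rightarrow> real" where
  "weighted_norm \<omega> f = sqrt (LINT \<zeta>|lborel. (\<omega> \<zeta> * norm (fourier f \<zeta>))\<^sup>2)"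

lemma integral_mult_le_L2:
  fixes F G :: "'a \<Rightarrow> real"
  assumes [measurable]: "F \<in> borel_measurable M" "G \<in> borel_measurable M"
    and F: "integrable M (\<lambda>x. (F x)\<^sup>2)" and G: "integrable M (\<lambda>x. (G x)\<^sup>2)"
    and nonneg: "\<And>x. 0 \<le> F x" "\<And>x. 0 \<le> G x"
  shows "integrable M (\<lambda>x. F x * G x)"
    and "(LINT x|M. F x * G x) \<le> sqrt (LINT x|M. (F x)\<^sup>2) * sqrt (LINT x|M. (G x)\<^sup>2)"
proof -
  show int: "integrable M (\<lambda>x. F x * G x)"
  proof (rule Bochner_Integration.integrable_bound)
    show "integrable M (\<lambda>x. (F x)\<^sup>2 + (G x)\<^sup>2)" using F G by simp
    show "AE x in M. norm (F x * G x) \<le> norm ((F x)\<^sup>2 + (G x)\<^sup>2)"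
    proof (rule AE_I2)
      fix x
      have "0 \<le> F x * G x" using nonneg by simp
      then have "F x * G x \<le> 2 * F x * G x" by simp
      also have "\<dots> \<le> (F x)\<^sup>2 + (G x)\<^sup>2" by (rule sum_squares_bound)
      finally show "norm (F x * G x) \<le> norm ((F x)\<^sup>2 + (G x)\<^sup>2)" using nonneg by simp
    qed
  qed measurable
  have "ennreal ((LINT x|M. F x * G x)\<^sup>2) = (\<integral>\<^sup>+x. ennreal (F x) * ennreal (G x) \<partial>M)\<^sup>2"
    using nonneg nn_integral_eq_integral[OF int]
    by (simp add: ennreal_mult[symmetric] ennreal_power integral_nonneg)
  also have "\<dots> \<le> (\<integral>\<^sup>+x. (ennreal (F x))\<^sup>2 \<partial>M) * (\<integral>\<^sup>+x. (ennreal (G x))\<^sup>2 \<partial>M)"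
    by (rule Cauchy_Schwarz_nn_integral) measurable
  also have "\<dots> = ennreal ((LINT x|M. (F x)\<^sup>2) * (LINT x|M. (G x)\<^sup>2))"
    using nonneg nn_integral_eq_integral[OF F] nn_integral_eq_integral[OF G]
    by (simp add: ennreal_mult ennreal_power integral_nonneg)
  finally have "(LINT x|M. F x * G x)\<^sup>2 \<le> (LINT x|M. (F x)\<^sup>2) * (LINT x|M. (G x)\<^sup>2)"
    by (subst (asm) ennreal_le_iff) (auto intro!: mult_nonneg_nonneg integral_nonneg)
  then have "(LINT x|M. F x * G x) \<le> sqrt ((LINT x|M. (F x)\<^sup>2) * (LINT x|M. (G x)\<^sup>2))"
    by (rule real_le_rsqrt)
  then show "(LINT x|M. F x * G x) \<le> sqrt (LINT x|M. (F x)\<^sup>2) * sqrt (LINT x|M. (G x)\<^sup>2)"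
    by (simp add: real_sqrt_mult)
qed

text \<open>Minkowski's inequality in L2, with the cross term bounded by Cauchy-Schwarz. It is
  stated for Bochner integrals because the norms are defined by them.\<close>

lemma sqrt_integral_add_square_le:
  fixes F G :: "'a \<Rightarrow> real"
  assumes [measurable]: "F \<in> borel_measurable M" "G \<in> borel_measurable M"
    and F: "integrable M (\<lambda>x. (F x)\<^sup>2)" and G: "integrable M (\<lambda>x. (G x)\<^sup>2)"
    and nonneg: "\<And>x. 0 \<le> F x" "\<And>x. 0 \<le> G x"
  shows "integrable M (\<lambda>x. (F x + G x)\<^sup>2)"
    and "sqrt (LINT x|M. (F x + G x)\<^sup>2) \<le> sqrt (LINT x|M. (F x)\<^sup>2) + sqrt (LINT x|M. (G x)\<^sup>2)"
proof -
  note FG = integral_mult_le_L2[OF assms]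
  have eq: "(\<lambda>x. (F x + G x)\<^sup>2) = (\<lambda>x. (F x)\<^sup>2 + (G x)\<^sup>2 + 2 * (F x * G x))"
    by (simp add: power2_sum mult_ac)
  show "integrable M (\<lambda>x. (F x + G x)\<^sup>2)" unfolding eq using F G FG(1) by simp
  have "(LINT x|M. (F x + G x)\<^sup>2) = (LINT x|M. (F x)\<^sup>2) + (LINT x|M. (G x)\<^sup>2) + 2 * (LINT x|M. F x * G x)"
    unfolding eq using F G FG(1) by simp
  also have "\<dots> \<le> (sqrt (LINT x|M. (F x)\<^sup>2) + sqrt (LINT x|M. (G x)\<^sup>2))\<^sup>2"
    using FG(2) by (simp add: power2_sum integral_nonneg)
  finally show "sqrt (LINT x|M. (F x + G x)\<^sup>2) \<le> sqrt (LINT x|M. (F x)\<^sup>2) + sqrt (LINT x|M. (G x)\<^sup>2)"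
    by (intro real_le_lsqrt) (auto intro!: add_nonneg_nonneg integral_nonneg)
qed

text \<open>Quadratic growth is that of the modulation, which is quadratic in the frequency.
  Transforms of Schwartz functions decay faster than any power, so the weighted norms are given by
  convergent integrals.\<close>

locale moderate_weight =
  fixes \<omega> :: "plane \<Rightarrow> real"
  assumes measurable_weight [measurable]: "\<omega> \<in> borel_measurable borel"
    and weight_nonneg: "0 \<le> \<omega> \<zeta>"
    and weight_growth: "\<omega> \<zeta> \<le> (1 + norm \<zeta>)\<^sup>2"
begin

lemma weighted_integrable:
  assumes f: "f \<in> schwartz"
  shows "integrable lborel (\<lambda>\<zeta>. (\<omega> \<zeta> * norm (fourier f \<zeta>))\<^sup>2)"
proof -
  note [measurable] = measurable_fourier[OF schwartz_measurable[OF f]]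
  obtain C where C: "\<And>\<zeta>. (1 + norm \<zeta>) ^ 4 * norm (fourier f \<zeta>) \<le> C"
    using fourier_decay[OF f] by blast
  show ?thesis
  proof (rule integrable_of_decay)
    fix \<zeta>
    have "(\<omega> \<zeta> * norm (fourier f \<zeta>))\<^sup>2 \<le> ((1 + norm \<zeta>)\<^sup>2 * norm (fourier f \<zeta>))\<^sup>2"
      using weight_nonneg weight_growth by (intro power_mono mult_right_mono) auto
    then have "(1 + norm \<zeta>) ^ 4 * norm ((\<omega> \<zeta> * norm (fourier f \<zeta>))\<^sup>2)
        \<le> (1 + norm \<zeta>) ^ 4 * ((1 + norm \<zeta>)\<^sup>2 * norm (fourier f \<zeta>))\<^sup>2"
      by (intro mult_left_mono) auto
    also have "\<dots> = ((1 + norm \<zeta>) ^ 4 * norm (fourier f \<zeta>))\<^sup>2"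
      by (simp add: power2_eq_square power4_eq_xxxx mult_ac)
    also have "\<dots> \<le> C\<^sup>2" using C by (intro power_mono) auto
    finally show "(1 + norm \<zeta>) ^ 4 * norm ((\<omega> \<zeta> * norm (fourier f \<zeta>))\<^sup>2) \<le> C\<^sup>2" .
  qed measurable
qed

text \<open>The passage between the real-valued norms and the extended nonnegative integrals of the
  kernel estimate.\<close>

lemma nn_integral_weighted:
  assumes f: "f \<in> schwartz"
  shows "(\<integral>\<^sup>+\<zeta>. (ennreal (\<omega> \<zeta> * norm (fourier f \<zeta>)))\<^sup>2 \<partial>lborel) = (ennreal (weighted_norm \<omega> f))\<^sup>2"
  using nn_integral_eq_integral[OF weighted_integrable[OF f]] weight_nonneg
  by (simp add: weighted_norm_def ennreal_power integral_nonneg)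

lemma weighted_norm_seminorm: "schwartz_seminorm (weighted_norm \<omega>)"
proof
  fix f g :: "plane \<Rightarrow> complex"
  show "0 \<le> weighted_norm \<omega> f" by (simp add: weighted_norm_def integral_nonneg)
  show "weighted_norm \<omega> (\<lambda>z. 0) = 0" by (simp add: weighted_norm_def)
  show "weighted_norm \<omega> (\<lambda>z. - f z) = weighted_norm \<omega> f"
    by (simp add: weighted_norm_def fourier_minus)
  assume f: "f \<in> schwartz" and g: "g \<in> schwartz"
  note [measurable] = measurable_fourier[OF schwartz_measurable[OF f]] measurable_fourier[OF schwartz_measurable[OF g]]
  let ?F = "\<lambda>\<zeta>. \<omega> \<zeta> * norm (fourier f \<zeta>)" and ?G = "\<lambda>\<zeta>. \<omega> \<zeta> * norm (fourier g \<zeta>)"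
  have nonneg: "0 \<le> ?F \<zeta>" "0 \<le> ?G \<zeta>" for \<zeta> using weight_nonneg by auto
  note sum = sqrt_integral_add_square_le[OF _ _ weighted_integrable[OF f] weighted_integrable[OF g] nonneg]
  have "(LINT \<zeta>|lborel. (\<omega> \<zeta> * norm (fourier (\<lambda>z. f z + g z) \<zeta>))\<^sup>2) \<le> (LINT \<zeta>|lborel. (?F \<zeta> + ?G \<zeta>)\<^sup>2)"
  proof (rule integral_mono)
    show "integrable lborel (\<lambda>\<zeta>. (\<omega> \<zeta> * norm (fourier (\<lambda>z. f z + g z) \<zeta>))\<^sup>2)"
      by (intro weighted_integrable schwartz_add f g)
    show "integrable lborel (\<lambda>\<zeta>. (?F \<zeta> + ?G \<zeta>)\<^sup>2)" by (rule sum(1)) measurable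
    fix \<zeta>
    have "\<omega> \<zeta> * norm (fourier (\<lambda>z. f z + g z) \<zeta>) \<le> \<omega> \<zeta> * (norm (fourier f \<zeta>) + norm (fourier g \<zeta>))"
      unfolding fourier_add[OF schwartz_integrable[OF f] schwartz_integrable[OF g]]
      by (intro mult_left_mono norm_triangle_ineq weight_nonneg)
    then show "(\<omega> \<zeta> * norm (fourier (\<lambda>z. f z + g z) \<zeta>))\<^sup>2 \<le> (?F \<zeta> + ?G \<zeta>)\<^sup>2"
      using weight_nonneg by (intro power_mono) (auto simp: distrib_left)
  qed
  then have "weighted_norm \<omega> (\<lambda>z. f z + g z) \<le> sqrt (LINT \<zeta>|lborel. (?F \<zeta> + ?G \<zeta>)\<^sup>2)"
    by (simp add: weighted_norm_def)
  also have "\<dots> \<le> weighted_norm \<omega> f + weighted_norm \<omega> g"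
    unfolding weighted_norm_def by (rule sum(2)) measurable
  finally show "weighted_norm \<omega> (\<lambda>z. f z + g z) \<le> weighted_norm \<omega> f + weighted_norm \<omega> g" .
qed

end

section \<open>Comparison of brackets and the weights of the two norms\<close>

lemma jbracket_le_br: "jbracket y \<le> br y" and br_le_jbracket: "br y \<le> 2 * jbracket y"
  and jbracket_ge_1: "1 \<le> jbracket y"
proof -
  have eq: "jbracket y = sqrt (1 + y\<^sup>2)" by (simp add: jbracket_def powr_half_sqrt)
  show "jbracket y \<le> br y"
    unfolding eq by (rule real_le_lsqrt) (auto simp: br_def power2_sum)
  show "1 \<le> jbracket y" unfolding eq by simp
  have "br y \<le> sqrt (4 * (1 + y\<^sup>2))"
    using br_square_le[of y] by (intro real_le_rsqrt) (auto intro: order_trans)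
  also have "\<dots> = 2 * sqrt (1 + y\<^sup>2)" unfolding real_sqrt_mult by simp
  finally show "br y \<le> 2 * jbracket y" unfolding eq .
qed

lemma br_powr_neg_le_jbracket: "e \<le> 0 \<Longrightarrow> br y powr e \<le> jbracket y powr e"
  using jbracket_le_br[of y] jbracket_ge_1[of y] by (intro powr_mono2') auto

lemma br_powr_le_jbracket: "0 \<le> e \<Longrightarrow> br y powr e \<le> 2 powr e * jbracket y powr e"
  using powr_mono2[of e "br y" "2 * jbracket y"] br_le_jbracket[of y] jbracket_ge_1[of y]
  by (simp add: powr_mult)

lemma jbracket_powr_neg_le_br: "0 \<le> e \<Longrightarrow> jbracket y powr (- e) \<le> 2 powr e * br y powr (- e)"
proof -
  assume e: "0 \<le> e"
  have "jbracket y powr (- e) \<le> (br y / 2) powr (- e)"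
    using br_le_jbracket[of y] e by (intro powr_mono2') auto
  also have "\<dots> = 2 powr e * br y powr (- e)" by (simp add: powr_divide powr_minus field_simps)
  finally show ?thesis .
qed

lemma measurable_jbracket [measurable]: "jbracket \<in> borel_measurable borel"
  unfolding jbracket_def by measurable

definition X_weight :: "real \<Rightarrow> real \<Rightarrow> plane \<Rightarrow> real" where
  "X_weight s b \<zeta> = jbracket (fst \<zeta>) powr s * jbracket (md \<zeta>) powr b"

definition Z_weight :: "real \<Rightarrow> real \<Rightarrow> plane \<Rightarrow> real" where
  "Z_weight s b \<zeta> = jbracket (snd \<zeta>) powr (s / 2) * jbracket (md \<zeta>) powr b"

lemma X_norm_eq: "X_norm s b = weighted_norm (X_weight s b)"
  unfolding X_norm_def weighted_norm_def X_weight_def md_def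
  by (intro ext arg_cong[where f = sqrt] Bochner_Integration.integral_cong) auto

lemma Z_norm_eq: "Z_norm s b = weighted_norm (Z_weight s b)"
  unfolding Z_norm_def weighted_norm_def Z_weight_def md_def
  by (intro ext arg_cong[where f = sqrt] Bochner_Integration.integral_cong) auto

lemma jbracket_powr_le_1: "e \<le> 0 \<Longrightarrow> jbracket y powr e \<le> 1"
  using powr_mono[of e 0 "jbracket y"] jbracket_ge_1[of y] by simp

lemma jbracket_md_powr_le: "b \<le> 1 \<Longrightarrow> jbracket (md \<zeta>) powr b \<le> (1 + norm \<zeta>)\<^sup>2"
proof -
  assume b: "b \<le> 1"
  have n: "\<bar>fst \<zeta>\<bar> \<le> norm \<zeta>" "\<bar>snd \<zeta>\<bar> \<le> norm \<zeta>"
    by (metis norm_fst_le prod.collapse real_norm_def, metis norm_snd_le prod.collapse real_norm_def)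
  have "(fst \<zeta>)\<^sup>2 \<le> (norm \<zeta>)\<^sup>2" using power_mono[OF n(1), of 2] by simp
  moreover have "\<bar>md \<zeta>\<bar> \<le> \<bar>snd \<zeta>\<bar> + (fst \<zeta>)\<^sup>2"
    unfolding md_def by (metis abs_triangle_ineq abs_power2)
  ultimately have "br (md \<zeta>) \<le> 1 + norm \<zeta> + (norm \<zeta>)\<^sup>2" using n by (simp add: br_def)
  also have "\<dots> \<le> (1 + norm \<zeta>)\<^sup>2" by (simp add: power2_sum)
  finally have "br (md \<zeta>) \<le> (1 + norm \<zeta>)\<^sup>2" .
  moreover have "jbracket (md \<zeta>) powr b \<le> jbracket (md \<zeta>)"
    using powr_mono[OF b, of "jbracket (md \<zeta>)"] jbracket_ge_1[of "md \<zeta>"] by simp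
  ultimately show ?thesis using jbracket_le_br[of "md \<zeta>"] by linarith
qed

lemma moderate_X_weight: "s \<le> 0 \<Longrightarrow> b \<le> 1 \<Longrightarrow> moderate_weight (X_weight s b)"
proof
  fix \<zeta> assume "s \<le> 0" "b \<le> 1"
  then have "jbracket (fst \<zeta>) powr s * jbracket (md \<zeta>) powr b \<le> 1 * (1 + norm \<zeta>)\<^sup>2"
    by (intro mult_mono jbracket_powr_le_1 jbracket_md_powr_le) auto
  then show "X_weight s b \<zeta> \<le> (1 + norm \<zeta>)\<^sup>2" by (simp add: X_weight_def)
  show "0 \<le> X_weight s b \<zeta>" by (simp add: X_weight_def)
next
  show "X_weight s b \<in> borel_measurable borel" unfolding X_weight_def by measurable
qed

lemma moderate_Z_weight: "s \<le> 0 \<Longrightarrow> b \<le> 1 \<Longrightarrow> moderate_weight (Z_weight s b)"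
proof
  fix \<zeta> assume "s \<le> 0" "b \<le> 1"
  then have "jbracket (snd \<zeta>) powr (s / 2) * jbracket (md \<zeta>) powr b \<le> 1 * (1 + norm \<zeta>)\<^sup>2"
    by (intro mult_mono jbracket_powr_le_1 jbracket_md_powr_le) auto
  then show "Z_weight s b \<zeta> \<le> (1 + norm \<zeta>)\<^sup>2" by (simp add: Z_weight_def)
  show "0 \<le> Z_weight s b \<zeta>" by (simp add: Z_weight_def)
next
  show "Z_weight s b \<in> borel_measurable borel" unfolding Z_weight_def by measurable
qed

context exponents
begin

lemma X_weight_le: "X_weight (- \<rho>) (- a) \<zeta> \<le> 2 powr \<rho> * 2 powr a * (sqrt (weight_sq \<zeta>) * br (md \<zeta>) powr (- a))"
proof -
  have "br (fst \<zeta>) powr (- \<rho>) \<le> sqrt (weight_sq \<zeta>)"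
  proof (rule real_le_rsqrt)
    have "(br (fst \<zeta>) powr (- \<rho>))\<^sup>2 = br (fst \<zeta>) powr (- 2 * \<rho>)"
      by (simp add: power2_eq_square flip: powr_add)
    then show "(br (fst \<zeta>) powr (- \<rho>))\<^sup>2 \<le> weight_sq \<zeta>"
      using \<rho>_pos powr_mono[of "- 2 * \<rho>" 0 "br (fst \<zeta>)"] by (auto simp: weight_sq_def)
  qed
  then have "2 powr \<rho> * br (fst \<zeta>) powr (- \<rho>) \<le> 2 powr \<rho> * sqrt (weight_sq \<zeta>)"
    by (intro mult_left_mono) auto
  with jbracket_powr_neg_le_br[of \<rho> "fst \<zeta>"] \<rho>_pos
  have "jbracket (fst \<zeta>) powr (- \<rho>) \<le> 2 powr \<rho> * sqrt (weight_sq \<zeta>)" by linarith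
  moreover have "jbracket (md \<zeta>) powr (- a) \<le> 2 powr a * br (md \<zeta>) powr (- a)"
    using a_pos by (intro jbracket_powr_neg_le_br) auto
  ultimately have "X_weight (- \<rho>) (- a) \<zeta> \<le> (2 powr \<rho> * sqrt (weight_sq \<zeta>)) * (2 powr a * br (md \<zeta>) powr (- a))"
    unfolding X_weight_def by (intro mult_mono) auto
  then show ?thesis by (simp add: mult_ac)
qed

text \<open>At low time frequency \<open>weight_sq\<close> is 1 and the time weight is at most 1.
  Otherwise (br xi)^2 <= 2 + 2 xi^2 <= 2 + 8 |tau| <= 16 <tau>, so the power rho/2 in time yields
  the power rho in frequency.\<close>

lemma Z_weight_le: "Z_weight (- \<rho>) (- a) \<zeta> \<le> 16 powr (\<rho> / 2) * 2 powr a * (sqrt (weight_sq \<zeta>) * br (md \<zeta>) powr (- a))"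
proof -
  have "jbracket (snd \<zeta>) powr (- \<rho> / 2) \<le> 16 powr (\<rho> / 2) * sqrt (weight_sq \<zeta>)"
  proof (cases "\<bar>snd \<zeta>\<bar> \<le> (fst \<zeta>)\<^sup>2 / 4")
    case True
    have "jbracket (snd \<zeta>) powr (- \<rho> / 2) \<le> 1" using \<rho>_pos by (intro jbracket_powr_le_1) auto
    also have "1 \<le> (16::real) powr (\<rho> / 2)" using \<rho>_pos by (intro ge_one_powr_ge_zero) auto
    finally show ?thesis using True by (simp add: weight_sq_def)
  next
    case False
    have "(br (fst \<zeta>))\<^sup>2 / 16 \<le> jbracket (snd \<zeta>)"
      using br_square_le[of "fst \<zeta>"] False br_le_jbracket[of "snd \<zeta>"] unfolding br_def[of "snd \<zeta>"] by argo
    then have "jbracket (snd \<zeta>) powr (- \<rho> / 2) \<le> ((br (fst \<zeta>))\<^sup>2 / 16) powr (- \<rho> / 2)"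
      using \<rho>_pos by (intro powr_mono2') auto
    also have "\<dots> = 16 powr (\<rho> / 2) * ((br (fst \<zeta>))\<^sup>2) powr (- \<rho> / 2)"
      by (simp add: powr_divide powr_minus field_simps)
    also have "((br (fst \<zeta>))\<^sup>2) powr (- \<rho> / 2) = br (fst \<zeta>) powr (- \<rho>)"
      by (subst powr_square_base) auto
    also have "\<dots> = sqrt (weight_sq \<zeta>)"
      using False powr_half_sqrt[of "br (fst \<zeta>) powr (- 2 * \<rho>)"] by (simp add: weight_sq_def powr_powr)
    finally show ?thesis .
  qed
  moreover have "jbracket (md \<zeta>) powr (- a) \<le> 2 powr a * br (md \<zeta>) powr (- a)"
    using a_pos by (intro jbracket_powr_neg_le_br) auto
  ultimately have "Z_weight (- \<rho>) (- a) \<zeta> \<le> (16 powr (\<rho> / 2) * sqrt (weight_sq \<zeta>)) * (2 powr a * br (md \<zeta>) powr (- a))"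
    unfolding Z_weight_def by (intro mult_mono) auto
  then show ?thesis by (simp add: mult_ac)
qed

lemma kernel_eq:
  "kernel \<zeta> \<eta> = sqrt (weight_sq \<zeta>) * br (md \<zeta>) powr (- a)
    * (br (fst \<eta>) powr \<rho> * br (md \<eta>) powr (- b)) * (br (fst (\<zeta> - \<eta>)) powr \<rho> * br (md (\<zeta> - \<eta>)) powr (- b))"
proof -
  have sqrt_powr: "sqrt (br y powr (2 * e)) = br y powr e" for y e
    using powr_half_sqrt[of "br y powr (2 * e)"] by (simp add: powr_powr)
  show ?thesis
    unfolding kernel_def ker_sq_def
    using sqrt_powr[of _ "- a"] sqrt_powr[of _ "- b"] sqrt_powr[of _ \<rho>] by (simp add: real_sqrt_mult mult_ac)
qed

text \<open>The constant is chosen before the output weight, which enters only through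
  \<open>A\<close>; the X and Z estimates are two instances.\<close>

lemma weighted_mult_bound:
  assumes "b \<le> 1"
  obtains C where "0 \<le> C" "\<And>\<omega> A f g. moderate_weight \<omega> \<Longrightarrow> 0 \<le> A \<Longrightarrow>
    (\<And>\<zeta>. \<omega> \<zeta> \<le> A * (sqrt (weight_sq \<zeta>) * br (md \<zeta>) powr (- a))) \<Longrightarrow> f \<in> schwartz \<Longrightarrow> g \<in> schwartz \<Longrightarrow>
    weighted_norm \<omega> (\<lambda>z. f z * g z) \<le> A * C * weighted_norm (X_weight (- \<rho>) b) f * weighted_norm (X_weight (- \<rho>) b) g"
proof -
  obtain D where D: "D < \<infinity>" and bound: "\<And>f g :: plane \<Rightarrow> ennreal.
    f \<in> borel_measurable borel \<Longrightarrow> g \<in> borel_measurable borel \<Longrightarrow>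
    (\<integral>\<^sup>+\<zeta>. (\<integral>\<^sup>+\<eta>. kernel \<zeta> \<eta> * (f \<eta> * g (\<zeta> - \<eta>)) \<partial>lborel)\<^sup>2 \<partial>lborel)
      \<le> D * ((\<integral>\<^sup>+\<zeta>. (f \<zeta>)\<^sup>2 \<partial>lborel) * (\<integral>\<^sup>+\<zeta>. (g \<zeta>)\<^sup>2 \<partial>lborel))"
    using kernel_bilinear_bound by blast
  define d where "d = sqrt (enn2real D)"
  have d: "0 \<le> d" "D = (ennreal d)\<^sup>2"
    using D by (auto simp: d_def ennreal_power)
  interpret X: moderate_weight "X_weight (- \<rho>) b"
    using \<rho>_pos assms by (intro moderate_X_weight) auto
  let ?X = "weighted_norm (X_weight (- \<rho>) b)"
  show ?thesis
  proof
    show "0 \<le> d * (2 powr b * 2 powr b)" using d by simp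
    fix \<omega> A and f g :: "plane \<Rightarrow> complex"
    assume \<omega>: "moderate_weight \<omega>" and A: "0 \<le> A"
      and le: "\<And>\<zeta>. \<omega> \<zeta> \<le> A * (sqrt (weight_sq \<zeta>) * br (md \<zeta>) powr (- a))"
      and f: "f \<in> schwartz" and g: "g \<in> schwartz"
    interpret \<omega>: moderate_weight \<omega> by fact
    note [measurable] = measurable_fourier[OF schwartz_measurable[OF f]] measurable_fourier[OF schwartz_measurable[OF g]]
    \<comment> \<open>The weights of \<open>F\<close> are the inverses of the input factors in
      \<open>kernel_eq\<close>, so they cancel exactly in the product with \<open>kernel\<close>.
      They are written with \<open>br\<close>, at the cost of a factor \<open>2 powr b\<close>
      against the X norm.\<close>
    define F where "F h \<zeta> = ennreal (br (fst \<zeta>) powr (- \<rho>) * br (md \<zeta>) powr b * norm (fourier h \<zeta>))" for h \<zeta>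
    have [measurable]: "F f \<in> borel_measurable borel" "F g \<in> borel_measurable borel"
      unfolding F_def by measurable
    have F_le: "(\<integral>\<^sup>+\<zeta>. (F h \<zeta>)\<^sup>2 \<partial>lborel) \<le> (ennreal (2 powr b * ?X h))\<^sup>2" if h: "h \<in> schwartz" for h
    proof -
      note [measurable] = measurable_fourier[OF schwartz_measurable[OF h]]
      have "(\<integral>\<^sup>+\<zeta>. (F h \<zeta>)\<^sup>2 \<partial>lborel)
          \<le> (\<integral>\<^sup>+\<zeta>. (ennreal (2 powr b))\<^sup>2 * (ennreal (X_weight (- \<rho>) b \<zeta> * norm (fourier h \<zeta>)))\<^sup>2 \<partial>lborel)"
      proof (rule nn_integral_mono)
        fix \<zeta>
        have "br (fst \<zeta>) powr (- \<rho>) * br (md \<zeta>) powr b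
            \<le> jbracket (fst \<zeta>) powr (- \<rho>) * (2 powr b * jbracket (md \<zeta>) powr b)"
          using \<rho>_pos b_pos by (intro mult_mono br_powr_neg_le_jbracket br_powr_le_jbracket) auto
        also have "\<dots> = 2 powr b * X_weight (- \<rho>) b \<zeta>" by (simp add: X_weight_def)
        finally have "F h \<zeta> \<le> ennreal (2 powr b * X_weight (- \<rho>) b \<zeta> * norm (fourier h \<zeta>))"
          unfolding F_def by (intro ennreal_leI mult_right_mono) auto
        also have "\<dots> = ennreal (2 powr b) * ennreal (X_weight (- \<rho>) b \<zeta> * norm (fourier h \<zeta>))"
          by (subst ennreal_mult[symmetric]) (auto simp: X.weight_nonneg mult.assoc)
        finally have "(F h \<zeta>)\<^sup>2 \<le> (ennreal (2 powr b) * ennreal (X_weight (- \<rho>) b \<zeta> * norm (fourier h \<zeta>)))\<^sup>2"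
          by (intro power_mono) auto
        then show "(F h \<zeta>)\<^sup>2 \<le> (ennreal (2 powr b))\<^sup>2 * (ennreal (X_weight (- \<rho>) b \<zeta> * norm (fourier h \<zeta>)))\<^sup>2"
          by (simp only: power_mult_distrib)
      qed
      also have "\<dots> = (ennreal (2 powr b))\<^sup>2 * (ennreal (?X h))\<^sup>2"
        by (subst nn_integral_cmult) (simp_all add: X.nn_integral_weighted[OF h])
      also have "\<dots> = (ennreal (2 powr b * ?X h))\<^sup>2"
        by (simp add: ennreal_mult' power_mult_distrib)
      finally show ?thesis .
    qed
    have ennreal_factors: "ennreal c * (ennreal x * ennreal y) = ennreal r * (ennreal k * (ennreal u * ennreal v))"
      if "c * (x * y) = r * (k * (u * v))" "0 \<le> c" "0 \<le> x" "0 \<le> y" "0 \<le> r" "0 \<le> k" "0 \<le> u" "0 \<le> v"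
      for c x y r k u v
      using that by (metis ennreal_mult mult_nonneg_nonneg)
    have X_nonneg: "0 \<le> ?X h" for h by (simp add: weighted_norm_def integral_nonneg)
    have "(ennreal (weighted_norm \<omega> (\<lambda>z. f z * g z)))\<^sup>2
        = (\<integral>\<^sup>+\<zeta>. (ennreal (\<omega> \<zeta> * norm (fourier (\<lambda>z. f z * g z) \<zeta>)))\<^sup>2 \<partial>lborel)"
      by (rule \<omega>.nn_integral_weighted[symmetric]) (intro schwartz_mult f g)
    also have "\<dots> \<le> (\<integral>\<^sup>+\<zeta>. (ennreal A)\<^sup>2 * (\<integral>\<^sup>+\<eta>. kernel \<zeta> \<eta> * (F f \<eta> * F g (\<zeta> - \<eta>)) \<partial>lborel)\<^sup>2 \<partial>lborel)"
    proof (rule nn_integral_mono)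
      fix \<zeta>
      let ?W = "sqrt (weight_sq \<zeta>) * br (md \<zeta>) powr (- a)"
      have cancel: "u powr e * u powr (- e) = 1" if "0 < u" for u e :: real
        using that by (simp flip: powr_add)
      have "ennreal (\<omega> \<zeta> * norm (fourier (\<lambda>z. f z * g z) \<zeta>))
          \<le> ennreal (A * ?W) * ennreal (norm (fourier (\<lambda>z. f z * g z) \<zeta>))"
        using le[of \<zeta>] A by (subst ennreal_mult[symmetric]) (auto intro!: ennreal_leI mult_right_mono)
      also have "\<dots> \<le> ennreal (A * ?W) * (\<integral>\<^sup>+\<eta>. ennreal (norm (fourier f \<eta>)) * ennreal (norm (fourier g (\<zeta> - \<eta>))) \<partial>lborel)"
        by (intro mult_left_mono norm_fourier_mult_le f g) auto
      also have "\<dots> = (\<integral>\<^sup>+\<eta>. ennreal (A * ?W) * (ennreal (norm (fourier f \<eta>)) * ennreal (norm (fourier g (\<zeta> - \<eta>)))) \<partial>lborel)"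
        by (rule nn_integral_cmult[symmetric]) measurable
      also have "\<dots> = (\<integral>\<^sup>+\<eta>. ennreal A * (kernel \<zeta> \<eta> * (F f \<eta> * F g (\<zeta> - \<eta>))) \<partial>lborel)"
      proof (rule nn_integral_cong)
        fix \<eta>
        let ?P = "br (fst \<eta>) powr \<rho>" and ?P' = "br (fst \<eta>) powr (- \<rho>)"
          and ?Q = "br (md \<eta>) powr (- b)" and ?Q' = "br (md \<eta>) powr b"
          and ?R = "br (fst (\<zeta> - \<eta>)) powr \<rho>" and ?R' = "br (fst (\<zeta> - \<eta>)) powr (- \<rho>)"
          and ?S = "br (md (\<zeta> - \<eta>)) powr (- b)" and ?S' = "br (md (\<zeta> - \<eta>)) powr b"
        have "A * (kernel \<zeta> \<eta> * ((?P' * ?Q' * norm (fourier f \<eta>)) * (?R' * ?S' * norm (fourier g (\<zeta> - \<eta>)))))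
            = A * ?W * (norm (fourier f \<eta>) * norm (fourier g (\<zeta> - \<eta>)))
              * ((?P * ?P') * (?Q' * ?Q) * (?R * ?R') * (?S' * ?S))"
          unfolding kernel_eq by (simp only: mult_ac)
        also have "(?P * ?P') * (?Q' * ?Q) * (?R * ?R') * (?S' * ?S) = 1"
          by (simp only: cancel br_pos mult_1)
        finally have eq: "A * (kernel \<zeta> \<eta> * ((?P' * ?Q' * norm (fourier f \<eta>)) * (?R' * ?S' * norm (fourier g (\<zeta> - \<eta>)))))
            = A * ?W * (norm (fourier f \<eta>) * norm (fourier g (\<zeta> - \<eta>)))"
          by (simp only: mult_1_right)
        show "ennreal (A * ?W) * (ennreal (norm (fourier f \<eta>)) * ennreal (norm (fourier g (\<zeta> - \<eta>))))
            = ennreal A * (kernel \<zeta> \<eta> * (F f \<eta> * F g (\<zeta> - \<eta>)))"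
          unfolding F_def using A by (intro ennreal_factors[OF eq[symmetric]]) auto
      qed
      also have "\<dots> = ennreal A * (\<integral>\<^sup>+\<eta>. kernel \<zeta> \<eta> * (F f \<eta> * F g (\<zeta> - \<eta>)) \<partial>lborel)"
        by (rule nn_integral_cmult) measurable
      finally have "(ennreal (\<omega> \<zeta> * norm (fourier (\<lambda>z. f z * g z) \<zeta>)))\<^sup>2
          \<le> (ennreal A * (\<integral>\<^sup>+\<eta>. kernel \<zeta> \<eta> * (F f \<eta> * F g (\<zeta> - \<eta>)) \<partial>lborel))\<^sup>2"
        by (intro power_mono) auto
      then show "(ennreal (\<omega> \<zeta> * norm (fourier (\<lambda>z. f z * g z) \<zeta>)))\<^sup>2
          \<le> (ennreal A)\<^sup>2 * (\<integral>\<^sup>+\<eta>. kernel \<zeta> \<eta> * (F f \<eta> * F g (\<zeta> - \<eta>)) \<partial>lborel)\<^sup>2"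
        by (simp only: power_mult_distrib)
    qed
    also have "\<dots> = (ennreal A)\<^sup>2 * (\<integral>\<^sup>+\<zeta>. (\<integral>\<^sup>+\<eta>. kernel \<zeta> \<eta> * (F f \<eta> * F g (\<zeta> - \<eta>)) \<partial>lborel)\<^sup>2 \<partial>lborel)"
      by (rule nn_integral_cmult) measurable
    also have "\<dots> \<le> (ennreal A)\<^sup>2 * (D * ((\<integral>\<^sup>+\<zeta>. (F f \<zeta>)\<^sup>2 \<partial>lborel) * (\<integral>\<^sup>+\<zeta>. (F g \<zeta>)\<^sup>2 \<partial>lborel)))"
      by (intro mult_left_mono bound) auto
    also have "\<dots> \<le> (ennreal A)\<^sup>2 * ((ennreal d)\<^sup>2 * ((ennreal (2 powr b * ?X f))\<^sup>2 * (ennreal (2 powr b * ?X g))\<^sup>2))"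
      unfolding d(2) by (intro mult_left_mono mult_mono F_le f g) auto
    also have "\<dots> = (ennreal (A * (d * ((2 powr b * ?X f) * (2 powr b * ?X g)))))\<^sup>2"
      using A d X_nonneg by (simp add: ennreal_mult power_mult_distrib)
    finally have sq: "(ennreal (weighted_norm \<omega> (\<lambda>z. f z * g z)))\<^sup>2
        \<le> (ennreal (A * (d * ((2 powr b * ?X f) * (2 powr b * ?X g)))))\<^sup>2" .
    have nonneg: "0 \<le> A * (d * ((2 powr b * ?X f) * (2 powr b * ?X g)))"
      using A d X_nonneg by (intro mult_nonneg_nonneg) auto
    moreover have "0 \<le> weighted_norm \<omega> (\<lambda>z. f z * g z)"
      by (simp add: weighted_norm_def integral_nonneg)
    ultimately have "(weighted_norm \<omega> (\<lambda>z. f z * g z))\<^sup>2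
        \<le> (A * (d * ((2 powr b * ?X f) * (2 powr b * ?X g))))\<^sup>2"
      using sq by (simp only: ennreal_power ennreal_le_iff zero_le_power2)
    then have "weighted_norm \<omega> (\<lambda>z. f z * g z) \<le> A * (d * ((2 powr b * ?X f) * (2 powr b * ?X g)))"
      using nonneg by (rule power2_le_imp_le)
    then show "weighted_norm \<omega> (\<lambda>z. f z * g z) \<le> A * (d * (2 powr b * 2 powr b)) * ?X f * ?X g"
      by (simp add: mult_ac)
  qed
qed

end

theorem theorem5p1:
  fixes s b :: real
  assumes "- (3/4) < s" and "s < 0"
    and "max (3/8) (1/8 - s/2) < b" and "b < 1/2"
  shows "\<exists>\<sigma>\<^sub>0 > (1/2 :: real). \<forall>\<sigma>. 1/2 < \<sigma> \<and> \<sigma> < \<sigma>\<^sub>0 \<longrightarrow>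
    (\<exists>C :: real. \<forall>u \<in> X_space s b. \<forall>v \<in> X_space s b.
      (completion_mult (X_norm s (\<sigma> - 1)) u v \<in> X_space s (\<sigma> - 1) \<and>
       completion_norm (X_norm s (\<sigma> - 1)) (completion_mult (X_norm s (\<sigma> - 1)) u v)
         \<le> C * completion_norm (X_norm s b) u * completion_norm (X_norm s b) v) \<and>
      (completion_mult (Z_norm s (\<sigma> - 1)) u v \<in> Z_space s (\<sigma> - 1) \<and>
       completion_norm (Z_norm s (\<sigma> - 1)) (completion_mult (Z_norm s (\<sigma> - 1)) u v)
         \<le> C * completion_norm (X_norm s b) u * completion_norm (X_norm s b) v))"
    (is "\<exists>\<sigma>\<^sub>0 > _. \<forall>\<sigma>. _ \<longrightarrow> ?bounded \<sigma>")
proof -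
  have b: "3 / 8 < b" "1 / 8 - s / 2 < b" using assms(3) by auto
  \<comment> \<open>Four times the distance of \<open>b\<close> from the larger of the two
    thresholds 3/8 and 1/8 - s/2.\<close>
  define \<gamma> where "\<gamma> = min (4 * b - 3 / 2) (4 * b - 1 / 2 + 2 * s)"
  have \<gamma>: "0 < \<gamma>" "\<gamma> \<le> 4 * b - 3 / 2" "\<gamma> \<le> 4 * b - 1 / 2 + 2 * s"
    using b by (auto simp: \<gamma>_def)
  show ?thesis
  \<comment> \<open>With theta = gamma/4 and sigma < 1/2 + gamma/4, kappa = 4b - 2 sigma - gamma/2
    exceeds 4b - 1 - gamma, and the definition of gamma yields both gain hypotheses. The bound sigma
    < 5/8 gives 2 (1 - sigma) > 3/4 > -s, which is \<open>\<rho>_le\<close>.\<close>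
  proof (rule exI[of _ "1 / 2 + min (\<gamma> / 4) (1 / 8)"], intro conjI allI impI)
    show "1 / 2 < 1 / 2 + min (\<gamma> / 4) (1 / 8)" using \<gamma> by simp
    fix \<sigma> assume "1 / 2 < \<sigma> \<and> \<sigma> < 1 / 2 + min (\<gamma> / 4) (1 / 8)"
    then have \<sigma>: "1 / 2 < \<sigma>" "\<sigma> < 1 / 2 + \<gamma> / 4" "\<sigma> < 5 / 8" by auto
    interpret exponents "- s" "1 - \<sigma>" b "\<gamma> / 4"
      unfolding exponents_def using assms(1,2,4) b \<gamma> \<sigma> by (intro conjI; argo)
    interpret Xb: schwartz_seminorm "X_norm s b"
      unfolding X_norm_eq using assms by (intro moderate_weight.weighted_norm_seminorm moderate_X_weight) auto
    have mX: "moderate_weight (X_weight s (\<sigma> - 1))" and mZ: "moderate_weight (Z_weight s (\<sigma> - 1))"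
      using assms \<sigma> by (auto intro!: moderate_X_weight moderate_Z_weight)
    obtain C where C: "0 \<le> C" and bound: "\<And>\<omega> A f g. moderate_weight \<omega> \<Longrightarrow> 0 \<le> A \<Longrightarrow>
      (\<And>\<zeta>. \<omega> \<zeta> \<le> A * (sqrt (weight_sq \<zeta>) * br (md \<zeta>) powr (- (1 - \<sigma>)))) \<Longrightarrow> f \<in> schwartz \<Longrightarrow> g \<in> schwartz \<Longrightarrow>
      weighted_norm \<omega> (\<lambda>z. f z * g z) \<le> A * C * X_norm s b f * X_norm s b g"
      using weighted_mult_bound assms(4) unfolding X_norm_eq by auto
    \<comment> \<open>The sum of the constants of \<open>X_weight_le\<close> and
      \<open>Z_weight_le\<close>, so that a single constant serves both estimates.\<close>
    define A where "A = 2 powr (- s) * 2 powr (1 - \<sigma>) + 16 powr (- s / 2) * 2 powr (1 - \<sigma>)"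
    have A: "0 \<le> A" by (simp add: A_def)
    have W: "0 \<le> sqrt (weight_sq \<zeta>) * br (md \<zeta>) powr (- (1 - \<sigma>))" for \<zeta> by simp
    have X_le: "X_weight s (\<sigma> - 1) \<zeta> \<le> A * (sqrt (weight_sq \<zeta>) * br (md \<zeta>) powr (- (1 - \<sigma>)))" for \<zeta>
    proof -
      have "X_weight s (\<sigma> - 1) \<zeta>
          \<le> 2 powr (- s) * 2 powr (1 - \<sigma>) * (sqrt (weight_sq \<zeta>) * br (md \<zeta>) powr (- (1 - \<sigma>)))"
        using X_weight_le[of \<zeta>] by simp
      also have "\<dots> \<le> A * (sqrt (weight_sq \<zeta>) * br (md \<zeta>) powr (- (1 - \<sigma>)))"
        by (intro mult_right_mono W) (simp add: A_def)
      finally show ?thesis .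
    qed
    have Z_le: "Z_weight s (\<sigma> - 1) \<zeta> \<le> A * (sqrt (weight_sq \<zeta>) * br (md \<zeta>) powr (- (1 - \<sigma>)))" for \<zeta>
    proof -
      have "Z_weight s (\<sigma> - 1) \<zeta>
          \<le> 16 powr (- s / 2) * 2 powr (1 - \<sigma>) * (sqrt (weight_sq \<zeta>) * br (md \<zeta>) powr (- (1 - \<sigma>)))"
        using Z_weight_le[of \<zeta>] by simp
      also have "\<dots> \<le> A * (sqrt (weight_sq \<zeta>) * br (md \<zeta>) powr (- (1 - \<sigma>)))"
        by (intro mult_right_mono W) (simp add: A_def)
      finally show ?thesis .
    qed
    have X: "X_norm s (\<sigma> - 1) (\<lambda>z. f z * g z) \<le> (A * C) * X_norm s b f * X_norm s b g"
      and Z: "Z_norm s (\<sigma> - 1) (\<lambda>z. f z * g z) \<le> (A * C) * X_norm s b f * X_norm s b g"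
      if "f \<in> schwartz" "g \<in> schwartz" for f g
      using bound[OF mX A X_le that] bound[OF mZ A Z_le that] by (simp_all add: X_norm_eq Z_norm_eq)
    have sX: "schwartz_seminorm (X_norm s (\<sigma> - 1))" and sZ: "schwartz_seminorm (Z_norm s (\<sigma> - 1))"
      unfolding X_norm_eq Z_norm_eq using mX mZ by (auto intro: moderate_weight.weighted_norm_seminorm)
    have AC: "0 \<le> A * C" using A C by simp
    show "?bounded \<sigma>"
      unfolding X_space_def Z_space_def
      using completion_mult_bounded[OF Xb.schwartz_seminorm_axioms sX X AC]
        completion_mult_bounded[OF Xb.schwartz_seminorm_axioms sZ Z AC] by blast
  qed
qed

end
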